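(* Let $|\psi\rangle=\sum_{i=1}^{d}\sqrt{p_i}\,|ii\rangle_{AB}$ and $|\phi\rangle=\sum_{j=1}^{d'}\sqrt{q_j}\,|jj\rangle_{AB}$ be bipartite pure states with Schmidt coefficients $p_i>0$ and $q_j>0$, and let $\langle w\rangle$ be a real number. The transformation $|\psi\rangle\to|\phi\rangle$ is possible under BLOCC (battery-assisted LOCC) with average entanglement extracted equal to $\langle w\rangle$ if and only if $$\langle w\rangle\le S(\psi_A)-S(\phi_A),$$ where $\psi_A=\mathrm{tr}_B|\psi\rangle\langle\psi|$, $\phi_A=\mathrm{tr}_B|\phi\rangle\langle\phi|$ and $S(\rho)=-\mathrm{tr}\,\rho\log\rho$.
   Context: Logarithms are base 2. For a pure state $|\psi\rangle=\sum_i\sqrt{p_i}|ii\rangle$, "Schmidt coefficients" means the numbers $p_i$, i.e. the nonzero eigenvalues of $\psi_A$. The system is $AB$ with $A=B=\mathbb{C}^D$, $D\ge\max(d,d')$. $\Pi_k=\sum_{i\le k}|i\rangle\langle i|$. Entanglement battery. For integers $u\ge2$, $n\ge1$, put $|\Gamma^+_u\rangle=\frac1{\sqrt u}\sum_{i=1}^u|ii\rangle$, $|\Gamma^-_u\rangle=\frac1{\sqrt{u-1}}\sum_{i=u+1}^{2u-1}|ii\rangle$, and for $0\le x\le n$ let $|e_x\rangle_{A'B'}=|\Gamma^+_u\rangle^{\otimes x}\otimes|\Gamma^-_u\rangle^{\otimes(n-x)}$. Let $P_x$ be the projector onto the support of the reduced state of $|e_x\rangle$ (on $A'$ or on $B'$);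 it has rank $u^x(u-1)^{n-x}$. Let $s_x=P_x/(u^x(u-1)^{n-x})$ be that reduced state. The $P_x$ are mutually orthogonal, and $A'$, $B'$ denote the spaces on which $\sum_{x=0}^nP_x=\mathbb{I}$. Put $\delta w=\log\frac{u}{u-1}$: going from $|e_x\rangle$ to $|e_{x+1}\rangle$ raises the entanglement by $\delta w$. BLOCC. A BLOCC protocol sequence for $|\psi\rangle\to|\phi\rangle$ consists of a constant $w_{\max}>0$ and, for each $N$ in an infinite set of positive integers: integers $u=u_N$, $n=n_N$; an interval $S=S_N\subset\{0,\dots,n\}$ of $N+1$ consecutive integers, with battery state $|\eta_N\rangle=\frac1{\sqrt{N+1}}\sum_{x\in S}|e_x\rangle$; unit vectors $|\Psi_N\rangle,|\Phi_N\rangle$ in the span of the $|ii\rangle_{AB}\otimes|e_x\rangle_{A'B'}$ with non-negative coefficients; and a one-way LOCC protocol, i.e. finitely many operators $M_m$ on $AA'$ with $\sum_mM_m^\dagger M_m=\mathbb{I}$ and unitaries $V_m$ on $BB'$, such that $(M_m\otimes V_m)|\Psi_N\rangle=\sqrt{r_m}\,|\Phi_N\rangle$ for all $m$, where $r_m\ge0$. Let $\Lambda_N^*(Y)=\sum_mr_mV_m^\dagger YV_m$ (a map on operators on $BB'$) and $K=\lfloor w_{\max}/\delta w\rfloor$. As $N\to\infty$ it is required that: $N\,\delta w\to\infty$; $\||\Psi_N\rangle-|\psi\rangle\otimes|\eta_N\rangle\|\to0$; $\||\Phi_N\rangle-|\phi\rangle\otimes|\eta_N\rangle\|\to0$; and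 the action on the battery consists asymptotically only of raising and lowering by amounts at most $w_{\max}$, in the sense that both $$\tfrac1{N+1}\sum_{x'\in S}\mathrm{tr}\Big[\Big(\mathbb{I}-\sum_{|x-x'|\le K}\Pi_d\otimes P_x\Big)\Lambda_N^*(\Pi_{d'}\otimes s_{x'})\Big]\to0,$$ $$\tfrac1{N+1}\sum_{x\in S}\mathrm{tr}\Big[(\Pi_d\otimes s_x)\,\Lambda_N^*\Big(\mathbb{I}-\sum_{|x'-x|\le K}\Pi_{d'}\otimes P_{x'}\Big)\Big]\to0 .$$ Fluctuations. For $w=k\,\delta w$ with $k\in\mathbb{Z}$, $|k|\le K$, put $$P_N(i,w|j)=\tfrac1{N+1}\sum_{x'\in S}\mathrm{tr}\big[(|i\rangle\langle i|\otimes P_{x'-k})\,\Lambda_N^*(|j\rangle\langle j|\otimes s_{x'})\big]$$ (terms with $x'-k\notin\{0,\dots,n\}$ are $0$). The sequence realizes the fluctuation distribution $P(i,w|j)$ (finitely supported in $w$) if for all $i\le d$, $j\le d'$ the measures $\sum_wP_N(i,w|j)\delta_w$ on $\mathbb{R}$ converge weakly to $\sum_wP(i,w|j)\delta_w$. The transformation is possible under BLOCC with average entanglement extracted $\langle w\rangle$ if some BLOCC protocol sequence for $|\psi\rangle\to|\phi\rangle$ realizes a fluctuation distribution $P(i,w|j)$ with $\sum_{i,j,w}P(i,w|j)\,q_j\,w=\langle w\rangle$. *)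

theory Defs
  imports "HOL-Analysis.Analysis"
begin

section \<open>Finite-dimensional linear algebra over a labelled orthonormal basis\<close>

text \<open>
  The dimensions of the battery vary along a protocol sequence, so they cannot be types. The Hilbert
  space with orthonormal basis labelled by a finite set \<open>I\<close> is represented by \<open>I\<close> itself: vectors
  are amplitude functions, operators are matrices, and only arguments in \<open>I\<close> are meaningful. A tensor
  product of spaces has basis \<open>I \<times> J\<close>.
\<close>

type_synonym 'i state = "'i \<Rightarrow> complex"
type_synonym 'i oper = "'i \<Rightarrow> 'i \<Rightarrow> complex"

definition ket :: "'i \<Rightarrow> 'i state" where
  "ket a = (\<lambda>b. if a = b then 1 else 0)"

definition ketbra :: "'i state \<Rightarrow> 'i state \<Rightarrow> 'i oper" where
  "ketbra v w = (\<lambda>a b. v a * cnj (w b))"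

definition vnorm :: "'i set \<Rightarrow> 'i state \<Rightarrow> real" where
  "vnorm I v = sqrt (\<Sum>a\<in>I. (cmod (v a))\<^sup>2)"

definition id_op :: "'i oper" where
  "id_op = (\<lambda>a b. if a = b then 1 else 0)"

definition adj :: "'i oper \<Rightarrow> 'i oper" where
  "adj X = (\<lambda>a b. cnj (X b a))"

definition op_mult :: "'i set \<Rightarrow> 'i oper \<Rightarrow> 'i oper \<Rightarrow> 'i oper" where
  "op_mult I X Y = (\<lambda>a b. \<Sum>c\<in>I. X a c * Y c b)"

definition op_apply :: "'i set \<Rightarrow> 'i oper \<Rightarrow> 'i state \<Rightarrow> 'i state" where
  "op_apply I X v = (\<lambda>a. \<Sum>c\<in>I. X a c * v c)"

definition op_tensor :: "'i oper \<Rightarrow> 'j oper \<Rightarrow> ('i \<times> 'j) oper" where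
  "op_tensor X Y = (\<lambda>(a, b) (a', b'). X a a' * Y b b')"

definition tr :: "'i set \<Rightarrow> 'i oper \<Rightarrow> complex" where
  "tr I X = (\<Sum>a\<in>I. X a a)"

definition tr_B :: "'j set \<Rightarrow> ('i \<times> 'j) oper \<Rightarrow> 'i oper" where
  "tr_B J X = (\<lambda>a a'. \<Sum>b\<in>J. X (a, b) (a', b))"

definition op_eq :: "'i set \<Rightarrow> 'i oper \<Rightarrow> 'i oper \<Rightarrow> bool" where
  "op_eq I X Y \<longleftrightarrow> (\<forall>a\<in>I. \<forall>b\<in>I. X a b = Y a b)"

definition unitary_on :: "'i set \<Rightarrow> 'i oper \<Rightarrow> bool" where
  "unitary_on I U \<longleftrightarrow> op_eq I (op_mult I (adj U) U) id_op \<and> op_eq I (op_mult I U (adj U)) id_op"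

definition diag_op :: "('i \<Rightarrow> real) \<Rightarrow> 'i oper" where
  "diag_op l = (\<lambda>a b. if a = b then complex_of_real (l a) else 0)"

text \<open>
  Functional calculus of a Hermitian operator through a unitary diagonalization; the result does not
  depend on which one is chosen.
\<close>

definition op_fun :: "'i set \<Rightarrow> (real \<Rightarrow> real) \<Rightarrow> 'i oper \<Rightarrow> 'i oper" where
  "op_fun I f X = (SOME Y. \<exists>U l. unitary_on I U \<and>
      op_eq I X (op_mult I (op_mult I U (diag_op l)) (adj U)) \<and>
      op_eq I Y (op_mult I (op_mult I U (diag_op (\<lambda>a. f (l a)))) (adj U)))"

text \<open>
  On the kernel of \<open>\<rho>\<close> the value \<open>log 2 0 = 0\<close> is multiplied by the eigenvalue \<open>0\<close>, so this respects
  the convention \<open>0 log 0 = 0\<close>.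
\<close>

definition vn_entropy :: "'i set \<Rightarrow> 'i oper \<Rightarrow> real" where
  "vn_entropy I \<rho> = - Re (tr I (op_mult I \<rho> (op_fun I (log 2) \<rho>)))"


section \<open>States of the system AB\<close>

definition schmidt_state :: "nat \<Rightarrow> (nat \<Rightarrow> real) \<Rightarrow> (nat \<times> nat) state" where
  "schmidt_state d p = (\<lambda>ab. \<Sum>i\<in>{1..d}. complex_of_real (sqrt (p i)) * ket (i, i) ab)"

definition proj_upto :: "nat \<Rightarrow> nat oper" where
  "proj_upto k = (\<lambda>a b. \<Sum>i\<in>{1..k}. ketbra (ket i) (ket i) a b)"


section \<open>The entanglement battery\<close>

definition Gamma_plus :: "nat \<Rightarrow> (nat \<times> nat) state" where
  "Gamma_plus u = (\<lambda>ab. complex_of_real (1 / sqrt (real u)) * (\<Sum>i\<in>{1..u}. ket (i, i) ab))"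

definition Gamma_minus :: "nat \<Rightarrow> (nat \<times> nat) state" where
  "Gamma_minus u =
     (\<lambda>ab. complex_of_real (1 / sqrt (real (u - 1))) * (\<Sum>i\<in>{u+1..2*u-1}. ket (i, i) ab))"

text \<open>Basis vectors of an \<open>n\<close>-fold tensor power are labelled by lists of length \<open>n\<close>.\<close>

definition e_state :: "nat \<Rightarrow> nat \<Rightarrow> nat \<Rightarrow> (nat list \<times> nat list) state" where
  "e_state u n x = (\<lambda>(l, l'). \<Prod>k<n. (if k < x then Gamma_plus u else Gamma_minus u) (l ! k, l' ! k))"

text \<open>
  The local labels occurring in \<open>e_state u n x\<close>; they span the support of its reduced state. The local
  battery space is the span of the labels occurring for some \<open>x \<le> n\<close>.
\<close>

definition block :: "nat \<Rightarrow> nat \<Rightarrow> nat \<Rightarrow> nat list set" where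
  "block u n x = {l. length l = n \<and> (\<forall>k<n. l ! k \<in> (if k < x then {1..u} else {u+1..2*u-1}))}"

definition battery_basis :: "nat \<Rightarrow> nat \<Rightarrow> nat list set" where
  "battery_basis u n = (\<Union>x\<in>{0..n}. block u n x)"

definition battery_proj :: "nat \<Rightarrow> nat \<Rightarrow> nat \<Rightarrow> nat list oper" where
  "battery_proj u n x = (\<lambda>l l'. \<Sum>b\<in>block u n x. ketbra (ket b) (ket b) l l')"

definition battery_red :: "nat \<Rightarrow> nat \<Rightarrow> nat \<Rightarrow> nat list oper" where
  "battery_red u n x = (\<lambda>l l'. battery_proj u n x l l' / of_nat (u ^ x * (u - 1) ^ (n - x)))"

definition delta_w :: "nat \<Rightarrow> real" where
  "delta_w u = log 2 (real u / real (u - 1))"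


section \<open>BLOCC protocol sequences\<close>

text \<open>Labels of the local spaces AA' and BB', and of the bipartite space AA' : BB'.\<close>

type_synonym lab = "nat \<times> nat list"

definition loc_basis :: "nat \<Rightarrow> nat \<Rightarrow> nat \<Rightarrow> lab set" where
  "loc_basis D u n = {1..D} \<times> battery_basis u n"

text \<open>Tensor product of a vector on A : B and one on A' : B', as a vector on AA' : BB'.\<close>

definition bip_tensor ::
    "(nat \<times> nat) state \<Rightarrow> (nat list \<times> nat list) state \<Rightarrow> (lab \<times> lab) state" where
  "bip_tensor v w = (\<lambda>((a, l), (b, l')). v (a, b) * w (l, l'))"

text \<open>
  The data of the protocol for one value of \<open>N\<close>; the window \<open>S\<close> is \<open>{win_start..win_start + N}\<close>, and the
  outcomes are numbered \<open>m < outcomes\<close>.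
\<close>

record blocc_step =
  bat_u :: nat
  bat_n :: nat
  win_start :: nat
  init_state :: "(lab \<times> lab) state"
  fin_state :: "(lab \<times> lab) state"
  outcomes :: nat
  kraus :: "nat \<Rightarrow> lab oper"
  corr :: "nat \<Rightarrow> lab oper"
  weight :: "nat \<Rightarrow> real"

definition step_basis :: "nat \<Rightarrow> blocc_step \<Rightarrow> lab set" where
  "step_basis D st = loc_basis D (bat_u st) (bat_n st)"

definition window :: "nat \<Rightarrow> blocc_step \<Rightarrow> nat set" where
  "window N st = {win_start st..win_start st + N}"

definition battery_state :: "nat \<Rightarrow> blocc_step \<Rightarrow> (nat list \<times> nat list) state" where
  "battery_state N st = (\<lambda>ll. complex_of_real (1 / sqrt (real (N + 1))) *
     (\<Sum>x\<in>window N st. e_state (bat_u st) (bat_n st) x ll))"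

definition nonneg_battery_form :: "nat \<Rightarrow> nat \<Rightarrow> nat \<Rightarrow> (lab \<times> lab) state \<Rightarrow> bool" where
  "nonneg_battery_form D u n v \<longleftrightarrow>
     (\<exists>c :: nat \<Rightarrow> nat \<Rightarrow> real. (\<forall>i x. 0 \<le> c i x) \<and>
        (\<forall>z \<in> loc_basis D u n \<times> loc_basis D u n.
           v z = (\<Sum>i\<in>{1..D}. \<Sum>x\<in>{0..n}.
                    complex_of_real (c i x) * bip_tensor (ket (i, i)) (e_state u n x) z)))"

definition valid_step :: "nat \<Rightarrow> nat \<Rightarrow> blocc_step \<Rightarrow> bool" where
  "valid_step D N st \<longleftrightarrow>
     (let I = step_basis D st in
        2 \<le> bat_u st \<and> 1 \<le> bat_n st \<and> window N st \<subseteq> {0..bat_n st} \<and>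
        nonneg_battery_form D (bat_u st) (bat_n st) (init_state st) \<and>
        vnorm (I \<times> I) (init_state st) = 1 \<and>
        nonneg_battery_form D (bat_u st) (bat_n st) (fin_state st) \<and>
        vnorm (I \<times> I) (fin_state st) = 1 \<and>
        op_eq I (\<lambda>a b. \<Sum>m<outcomes st. op_mult I (adj (kraus st m)) (kraus st m) a b) id_op \<and>
        (\<forall>m<outcomes st. unitary_on I (corr st m) \<and> 0 \<le> weight st m \<and>
           (\<forall>z\<in>I \<times> I. op_apply (I \<times> I) (op_tensor (kraus st m) (corr st m)) (init_state st) z =
              complex_of_real (sqrt (weight st m)) * fin_state st z)))"

definition Lambda_star :: "nat \<Rightarrow> blocc_step \<Rightarrow> lab oper \<Rightarrow> lab oper" where
  "Lambda_star D st Y = (\<lambda>a b. \<Sum>m<outcomes st. complex_of_real (weight st m) *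
     op_mult (step_basis D st) (op_mult (step_basis D st) (adj (corr st m)) Y) (corr st m) a b)"

definition Kmax :: "real \<Rightarrow> nat \<Rightarrow> int" where
  "Kmax w_max u = \<lfloor>w_max / delta_w u\<rfloor>"

text \<open>\<open>\<I> - \<Sum>\<^bsub>|x - y| \<le> K\<^esub> \<Pi>\<^sub>d \<otimes> P\<^sub>x\<close>\<close>

definition far_op :: "real \<Rightarrow> nat \<Rightarrow> blocc_step \<Rightarrow> nat \<Rightarrow> lab oper" where
  "far_op w_max d st y = (\<lambda>a b. id_op a b -
     (\<Sum>x\<in>{x\<in>{0..bat_n st}. \<bar>int x - int y\<bar> \<le> Kmax w_max (bat_u st)}.
        op_tensor (proj_upto d) (battery_proj (bat_u st) (bat_n st) x) a b))"

definition far_weight_final :: "real \<Rightarrow> nat \<Rightarrow> nat \<Rightarrow> nat \<Rightarrow> nat \<Rightarrow> blocc_step \<Rightarrow> complex" where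
  "far_weight_final w_max D d d' N st = 1 / of_nat (N + 1) * (\<Sum>x'\<in>window N st.
     tr (step_basis D st) (op_mult (step_basis D st) (far_op w_max d st x')
       (Lambda_star D st (op_tensor (proj_upto d') (battery_red (bat_u st) (bat_n st) x')))))"

definition far_weight_initial :: "real \<Rightarrow> nat \<Rightarrow> nat \<Rightarrow> nat \<Rightarrow> nat \<Rightarrow> blocc_step \<Rightarrow> complex" where
  "far_weight_initial w_max D d d' N st = 1 / of_nat (N + 1) * (\<Sum>x\<in>window N st.
     tr (step_basis D st) (op_mult (step_basis D st)
       (op_tensor (proj_upto d) (battery_red (bat_u st) (bat_n st) x))
       (Lambda_star D st (far_op w_max d' st x))))"

text \<open>The limit \<open>N \<rightarrow> \<infinity>\<close> along a set of integers.\<close>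

definition along :: "nat set \<Rightarrow> nat filter" where
  "along Ns = inf sequentially (principal Ns)"

definition blocc_sequence :: "nat \<Rightarrow> nat \<Rightarrow> (nat \<Rightarrow> real) \<Rightarrow> nat \<Rightarrow> (nat \<Rightarrow> real) \<Rightarrow>
    real \<Rightarrow> nat set \<Rightarrow> (nat \<Rightarrow> blocc_step) \<Rightarrow> bool" where
  "blocc_sequence D d p d' q w_max Ns st \<longleftrightarrow>
     0 < w_max \<and> infinite Ns \<and> (\<forall>N\<in>Ns. 0 < N) \<and> (\<forall>N\<in>Ns. valid_step D N (st N)) \<and>
     filterlim (\<lambda>N. real N * delta_w (bat_u (st N))) at_top (along Ns) \<and>
     ((\<lambda>N. vnorm (step_basis D (st N) \<times> step_basis D (st N))
         (\<lambda>z. init_state (st N) z - bip_tensor (schmidt_state d p) (battery_state N (st N)) z))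
       \<longlongrightarrow> 0) (along Ns) \<and>
     ((\<lambda>N. vnorm (step_basis D (st N) \<times> step_basis D (st N))
         (\<lambda>z. fin_state (st N) z - bip_tensor (schmidt_state d' q) (battery_state N (st N)) z))
       \<longlongrightarrow> 0) (along Ns) \<and>
     ((\<lambda>N. far_weight_final w_max D d d' N (st N)) \<longlongrightarrow> 0) (along Ns) \<and>
     ((\<lambda>N. far_weight_initial w_max D d d' N (st N)) \<longlongrightarrow> 0) (along Ns)"


section \<open>Fluctuations of the extracted entanglement\<close>

text \<open>
  \<open>P\<^sub>N(i, k \<delta>w | j)\<close>. The traces are real, being traces of products of two positive operators.
\<close>

definition fluct :: "nat \<Rightarrow> nat \<Rightarrow> blocc_step \<Rightarrow> nat \<Rightarrow> int \<Rightarrow> nat \<Rightarrow> real" where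
  "fluct D N st i k j = 1 / real (N + 1) * (\<Sum>x'\<in>window N st.
     if 0 \<le> int x' - k \<and> int x' - k \<le> int (bat_n st) then
       Re (tr (step_basis D st) (op_mult (step_basis D st)
         (op_tensor (ketbra (ket i) (ket i)) (battery_proj (bat_u st) (bat_n st) (nat (int x' - k))))
         (Lambda_star D st
           (op_tensor (ketbra (ket j) (ket j)) (battery_red (bat_u st) (bat_n st) x')))))
     else 0)"

text \<open>
  Weak convergence of \<open>\<Sum>\<^sub>w P\<^sub>N(i, w | j) \<delta>\<^sub>w\<close> is tested against bounded continuous functions; the
  integrals are finite sums. The argument order of \<open>P\<close> is \<open>P i w j\<close>.
\<close>

definition realizes :: "nat \<Rightarrow> nat \<Rightarrow> nat \<Rightarrow> real \<Rightarrow> nat set \<Rightarrow> (nat \<Rightarrow> blocc_step) \<Rightarrow>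
    (nat \<Rightarrow> real \<Rightarrow> nat \<Rightarrow> real) \<Rightarrow> bool" where
  "realizes D d d' w_max Ns st P \<longleftrightarrow>
     (\<forall>i\<in>{1..d}. \<forall>j\<in>{1..d'}. finite {w. P i w j \<noteq> 0} \<and> (\<forall>w. 0 \<le> P i w j) \<and>
       (\<forall>f :: real \<Rightarrow> real. continuous_on UNIV f \<and> bounded (range f) \<longrightarrow>
         ((\<lambda>N. \<Sum>k\<in>{k. \<bar>k\<bar> \<le> Kmax w_max (bat_u (st N))}.
              fluct D N (st N) i k j * f (of_int k * delta_w (bat_u (st N))))
           \<longlongrightarrow> (\<Sum>w\<in>{w. P i w j \<noteq> 0}. P i w j * f w)) (along Ns)))"

definition blocc_possible :: "nat \<Rightarrow> nat \<Rightarrow> (nat \<Rightarrow> real) \<Rightarrow> nat \<Rightarrow> (nat \<Rightarrow> real) \<Rightarrow> real \<Rightarrow> bool" where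
  "blocc_possible D d p d' q w_avg \<longleftrightarrow>
     (\<exists>w_max Ns st P. blocc_sequence D d p d' q w_max Ns st \<and> realizes D d d' w_max Ns st P \<and>
        (\<Sum>i\<in>{1..d}. \<Sum>j\<in>{1..d'}. \<Sum>w\<in>{w. P i w j \<noteq> 0}. P i w j * q j * w) = w_avg)"


section \<open>Consistency checks\<close>

lemma sum_ket_diag: "finite A \<Longrightarrow> (\<Sum>i\<in>A. ket (i, i) (a, b)) = (if a = b \<and> a \<in> A then 1 else 0)"
proof -
  assume f: "finite A"
  have "(\<Sum>i\<in>A. ket (i, i) (a, b)) = (\<Sum>i\<in>A. if i = a then (if a = b then 1 else 0) else 0)"
    by (intro sum.cong) (auto simp: ket_def)
  also have "\<dots> = (if a = b \<and> a \<in> A then 1 else 0)"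
    using f by (simp add: sum.delta)
  finally show ?thesis .
qed

lemma prod_split_const:
  assumes "x \<le> n"
  shows "(\<Prod>k<n. if k < x then a else b) = a ^ x * (b :: 'c :: comm_semiring_1) ^ (n - x)"
proof -
  have *: "{..<n} = {..<x} \<union> {x..<n}" using assms by auto
  have "(\<Prod>k<n. if k < x then a else b) =
      (\<Prod>k<x. if k < x then a else b) * (\<Prod>k=x..<n. if k < x then a else b)"
    unfolding * by (rule prod.union_disjoint) auto
  then show ?thesis by simp
qed

lemma e_state_eq:
  assumes "x \<le> n" "length l = n" "length l' = n"
  shows "e_state u n x (l, l') = (if l = l' \<and> l \<in> block u n x
    then complex_of_real (1 / sqrt (real (u ^ x * (u - 1) ^ (n - x)))) else 0)"
proof (cases "l = l' \<and> l \<in> block u n x")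
  case True
  have "e_state u n x (l, l') = (\<Prod>k<n. if k < x then complex_of_real (1 / sqrt (real u))
        else complex_of_real (1 / sqrt (real (u - 1))))"
    unfolding e_state_def Gamma_plus_def Gamma_minus_def
    using True by (auto intro!: prod.cong simp: sum_ket_diag block_def split: if_splits)
  also have "\<dots> = complex_of_real (1 / sqrt (real u)) ^ x *
      complex_of_real (1 / sqrt (real (u - 1))) ^ (n - x)"
    using assms by (intro prod_split_const)
  also have "\<dots> = complex_of_real (1 / sqrt (real (u ^ x * (u - 1) ^ (n - x))))"
    by (simp add: real_sqrt_mult real_sqrt_power power_divide)
  finally show ?thesis unfolding if_P[OF True] .
next
  case False
  have "\<exists>k<n. (if k < x then Gamma_plus u else Gamma_minus u) (l ! k, l' ! k) = 0"
  proof (cases "l = l'")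
    case True
    then obtain k where "k < n" "l ! k \<notin> (if k < x then {1..u} else {u+1..2*u-1})"
      using False assms unfolding block_def by auto
    then show ?thesis
      by (intro exI[of _ k]) (auto simp: Gamma_plus_def Gamma_minus_def sum_ket_diag)
  next
    case ne: False
    then obtain k where "k < n" "l ! k \<noteq> l' ! k"
      using assms nth_equalityI by metis
    then show ?thesis
      by (intro exI[of _ k]) (auto simp: Gamma_plus_def Gamma_minus_def sum_ket_diag)
  qed
  then have "e_state u n x (l, l') = 0"
    unfolding e_state_def prod.case
    by (intro prod_zero finite_lessThan) (simp only: Bex_def lessThan_iff)
  then show ?thesis unfolding if_not_P[OF False] .
qed

lemma finite_block: "finite (block u n x)"
proof (rule finite_subset)
  show "block u n x \<subseteq> {l. set l \<subseteq> {1..2*u} \<and> length l = n}"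
  proof
    fix l assume l: "l \<in> block u n x"
    have "l ! k \<in> {1..2*u}" if "k < n" for k
    proof -
      have "l ! k \<in> (if k < x then {1..u} else {u+1..2*u-1})"
        using l that unfolding block_def by blast
      then show ?thesis by (cases "k < x") auto
    qed
    then show "l \<in> {l. set l \<subseteq> {1..2*u} \<and> length l = n}"
      using l unfolding block_def by (auto simp: set_conv_nth)
  qed
  show "finite {l. set l \<subseteq> {1..2*u} \<and> length l = n}"
    by (rule finite_lists_length_eq) simp
qed

lemma finite_battery_basis: "finite (battery_basis u n)"
  unfolding battery_basis_def by (simp add: finite_block)

lemma sum_ketbra_eq:
  "finite A \<Longrightarrow> (\<Sum>b\<in>A. ketbra (ket b) (ket b) l l') = (if l = l' \<and> l \<in> A then 1 else 0)"
proof -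
  assume f: "finite A"
  have "(\<Sum>b\<in>A. ketbra (ket b) (ket b) l l') = (\<Sum>b\<in>A. if b = l then (if l = l' then 1 else 0) else 0)"
    by (intro sum.cong) (auto simp: ket_def ketbra_def)
  also have "\<dots> = (if l = l' \<and> l \<in> A then 1 else 0)"
    using f by (simp add: sum.delta)
  finally show ?thesis .
qed

lemma battery_proj_eq: "battery_proj u n x l l' = (if l = l' \<and> l \<in> block u n x then 1 else 0)"
  unfolding battery_proj_def by (rule sum_ketbra_eq[OF finite_block])

lemma battery_red_eq_reduced_state:
  assumes "x \<le> n"
  shows "op_eq (battery_basis u n)
    (tr_B (battery_basis u n) (ketbra (e_state u n x) (e_state u n x))) (battery_red u n x)"
  unfolding op_eq_def
proof (intro ballI)
  fix l l' assume l: "l \<in> battery_basis u n" "l' \<in> battery_basis u n"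
  let ?R = "u ^ x * (u - 1) ^ (n - x)"
  have len: "length b = n" if "b \<in> battery_basis u n" for b
    using that unfolding battery_basis_def block_def by auto
  have "tr_B (battery_basis u n) (ketbra (e_state u n x) (e_state u n x)) l l' =
      (\<Sum>b\<in>battery_basis u n. if b = l then
        (if l = l' \<and> l \<in> block u n x then complex_of_real (1 / real ?R) else 0) else 0)"
    unfolding tr_B_def ketbra_def
  proof (intro sum.cong refl)
    fix b assume b: "b \<in> battery_basis u n"
    have sq: "complex_of_real (1 / sqrt (real ?R)) * complex_of_real (1 / sqrt (real ?R)) =
        complex_of_real (1 / real ?R)"
      by (simp only: of_real_mult[symmetric]) (simp del: of_nat_mult of_nat_power)
    show "e_state u n x (l, b) * cnj (e_state u n x (l', b)) = (if b = l then
        (if l = l' \<and> l \<in> block u n x then complex_of_real (1 / real ?R) else 0) else 0)"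
      unfolding e_state_eq[OF assms len[OF l(1)] len[OF b]] e_state_eq[OF assms len[OF l(2)] len[OF b]]
      using sq by auto
  qed
  also have "\<dots> = battery_red u n x l l'"
    using l by (auto simp: finite_battery_basis battery_red_def battery_proj_eq)
  finally show "tr_B (battery_basis u n) (ketbra (e_state u n x) (e_state u n x)) l l' =
      battery_red u n x l l'" .
qed

lemma block_disjoint:
  assumes "l \<in> block u n x" "l \<in> block u n y" "x \<le> n" "y \<le> n"
  shows "x = y"
proof -
  have False if "l \<in> block u n x" "l \<in> block u n y" "x < y" "y \<le> n" for x y
  proof -
    have "x < n" using that by simp
    then have "l ! x \<in> (if x < x then {1..u} else {u+1..2*u-1})"
      and "l ! x \<in> (if x < y then {1..u} else {u+1..2*u-1})"
      using that(1,2) unfolding block_def by blast+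
    then show False using that(3) by simp
  qed
  then show ?thesis using assms by (metis linorder_neqE_nat)
qed

lemma sum_battery_proj:
  "op_eq (battery_basis u n) (\<lambda>l l'. \<Sum>x\<in>{0..n}. battery_proj u n x l l') id_op"
  unfolding op_eq_def
proof (intro ballI)
  fix l l' assume l: "l \<in> battery_basis u n" "l' \<in> battery_basis u n"
  then obtain y where y: "y \<in> {0..n}" "l \<in> block u n y"
    unfolding battery_basis_def by auto
  have "(\<Sum>x\<in>{0..n}. battery_proj u n x l l') =
      (\<Sum>x\<in>{0..n}. if x = y then (if l = l' then 1 else 0) else 0)"
    unfolding battery_proj_eq using y by (intro sum.cong) (auto dest: block_disjoint)
  also have "\<dots> = id_op l l'"
    using y by (simp add: id_op_def)
  finally show "(\<Sum>x\<in>{0..n}. battery_proj u n x l l') = id_op l l'" .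
qed

lemma op_mult_diag_right:
  "finite I \<Longrightarrow> b \<in> I \<Longrightarrow> op_mult I U (diag_op l) a b = U a b * complex_of_real (l b)"
  unfolding op_mult_def diag_op_def by (simp add: if_distrib[of "\<lambda>x. _ * x"] cong: if_cong)

lemma op_mult_diag_left:
  "finite I \<Longrightarrow> a \<in> I \<Longrightarrow> op_mult I (diag_op l) U a b = complex_of_real (l a) * U a b"
  unfolding op_mult_def diag_op_def by (simp add: if_distrib[of "\<lambda>x. x * _"] cong: if_cong)

text \<open>On a diagonal operator the functional calculus acts entrywise, whatever diagonalization is used.\<close>

lemma op_fun_diag:
  assumes "finite I" "op_eq I X (diag_op r)"
  shows "op_eq I (op_fun I f X) (diag_op (\<lambda>a. f (r a)))"
proof -
  let ?Q = "\<lambda>Y. \<exists>U l. unitary_on I U \<and>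
      op_eq I X (op_mult I (op_mult I U (diag_op l)) (adj U)) \<and>
      op_eq I Y (op_mult I (op_mult I U (diag_op (\<lambda>a. f (l a)))) (adj U))"
  have idl: "op_mult I (op_mult I id_op (diag_op l)) (adj id_op) a b = diag_op l a b"
    if "a \<in> I" "b \<in> I" for a b l
  proof -
    have i: "(id_op :: 'a oper) = diag_op (\<lambda>_. 1)"
      by (intro ext) (simp add: id_op_def diag_op_def)
    have "adj (diag_op (\<lambda>_. 1)) = (diag_op (\<lambda>_. 1) :: 'a oper)"
      by (auto simp: adj_def diag_op_def intro!: ext)
    then show ?thesis unfolding i
      using that assms(1) by (simp add: op_mult_diag_right) (simp add: diag_op_def)
  qed
  have un: "unitary_on I (id_op :: 'a oper)"
    unfolding unitary_on_def op_eq_def op_mult_def adj_def id_op_def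
    using assms(1) by (auto simp: if_distrib[of "\<lambda>x. _ * x"] if_distrib[of cnj] cong: if_cong)
  have ex: "?Q (diag_op (\<lambda>a. f (r a)))"
    by (intro exI[of _ id_op] exI[of _ r] conjI un)
       (use assms(2) in \<open>auto simp: op_eq_def idl\<close>)
  have "?Q (op_fun I f X)"
    unfolding op_fun_def by (rule someI[of ?Q, OF ex])
  then obtain U l where U: "unitary_on I U"
    and X: "op_eq I X (op_mult I (op_mult I U (diag_op l)) (adj U))"
    and Y: "op_eq I (op_fun I f X) (op_mult I (op_mult I U (diag_op (\<lambda>a. f (l a)))) (adj U))"
    by blast
  have UU: "(\<Sum>c\<in>I. cnj (U c a) * U c b) = (if a = b then 1 else 0)" if "a \<in> I" "b \<in> I" for a b
    using U that unfolding unitary_on_def op_eq_def op_mult_def adj_def id_op_def by auto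
  have UU': "(\<Sum>c\<in>I. U a c * cnj (U b c)) = (if a = b then 1 else 0)" if "a \<in> I" "b \<in> I" for a b
    using U that unfolding unitary_on_def op_eq_def op_mult_def adj_def id_op_def by auto
  have D: "(if a = b then complex_of_real (r a) else 0) =
      (\<Sum>c\<in>I. U a c * complex_of_real (l c) * cnj (U b c))" if "a \<in> I" "b \<in> I" for a b
  proof -
    have "(if a = b then complex_of_real (r a) else 0) = X a b"
      using assms(2) that by (auto simp: op_eq_def diag_op_def)
    also have "\<dots> = op_mult I (op_mult I U (diag_op l)) (adj U) a b"
      using X that by (simp add: op_eq_def)
    also have "\<dots> = (\<Sum>c\<in>I. U a c * complex_of_real (l c) * cnj (U b c))"
      unfolding op_mult_def[of I "op_mult I U (diag_op l)"]
      using assms(1) by (intro sum.cong) (auto simp: op_mult_diag_right adj_def)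
    finally show ?thesis .
  qed
  have ent: "complex_of_real (r a) * U a c = U a c * complex_of_real (l c)"
    if "a \<in> I" "c \<in> I" for a c
  proof -
    have "complex_of_real (r a) * U a c =
        (\<Sum>b\<in>I. (if a = b then complex_of_real (r a) else 0) * U b c)"
      using that assms(1) by (simp add: if_distrib[of "\<lambda>x. x * _"] cong: if_cong)
    also have "\<dots> = (\<Sum>b\<in>I. (\<Sum>e\<in>I. U a e * complex_of_real (l e) * cnj (U b e)) * U b c)"
      using that D by (intro sum.cong) auto
    also have "\<dots> = (\<Sum>e\<in>I. U a e * complex_of_real (l e) * (\<Sum>b\<in>I. cnj (U b e) * U b c))"
      unfolding sum_distrib_left sum_distrib_right
      by (subst sum.swap) (simp add: mult.assoc)
    also have "\<dots> = (\<Sum>e\<in>I. U a e * complex_of_real (l e) * (if e = c then 1 else 0))"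
      using that UU by (intro sum.cong) auto
    also have "\<dots> = U a c * complex_of_real (l c)"
      using that assms(1) by (simp add: if_distrib[of "\<lambda>x. _ * x"] cong: if_cong)
    finally show ?thesis .
  qed
  have entf: "U a c * complex_of_real (f (l c)) = complex_of_real (f (r a)) * U a c"
    if "a \<in> I" "c \<in> I" for a c
    using ent[OF that] by (cases "U a c = 0") auto
  show ?thesis unfolding op_eq_def
  proof (intro ballI)
    fix a b assume ab: "a \<in> I" "b \<in> I"
    have "op_fun I f X a b = op_mult I (op_mult I U (diag_op (\<lambda>a. f (l a)))) (adj U) a b"
      using Y ab by (simp add: op_eq_def)
    also have "\<dots> = (\<Sum>c\<in>I. U a c * complex_of_real (f (l c)) * cnj (U b c))"
      unfolding op_mult_def[of I "op_mult I U (diag_op (\<lambda>a. f (l a)))"]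
      using assms(1) by (intro sum.cong) (auto simp: op_mult_diag_right adj_def)
    also have "\<dots> = complex_of_real (f (r a)) * (\<Sum>c\<in>I. U a c * cnj (U b c))"
      unfolding sum_distrib_left using ab entf by (intro sum.cong) (auto simp: mult.assoc)
    also have "\<dots> = diag_op (\<lambda>a. f (r a)) a b"
      using ab UU' by (auto simp: diag_op_def)
    finally show "op_fun I f X a b = diag_op (\<lambda>a. f (r a)) a b" .
  qed
qed

lemma vn_entropy_diag:
  assumes "finite I" "op_eq I \<rho> (diag_op r)"
  shows "vn_entropy I \<rho> = - (\<Sum>a\<in>I. r a * log 2 (r a))"
proof -
  have "tr I (op_mult I \<rho> (op_fun I (log 2) \<rho>)) =
      (\<Sum>a\<in>I. \<Sum>c\<in>I. diag_op r a c * diag_op (\<lambda>a. log 2 (r a)) c a)"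
    unfolding tr_def op_mult_def using assms op_fun_diag[OF assms, of "log 2"]
    by (intro sum.cong) (auto simp: op_eq_def)
  also have "\<dots> = (\<Sum>a\<in>I. complex_of_real (r a * log 2 (r a)))"
  proof (intro sum.cong refl)
    fix a assume a: "a \<in> I"
    have "(\<Sum>c\<in>I. diag_op r a c * diag_op (\<lambda>a. log 2 (r a)) c a) =
        (\<Sum>c\<in>I. if c = a then complex_of_real (r a * log 2 (r a)) else 0)"
      by (intro sum.cong) (auto simp: diag_op_def)
    then show "(\<Sum>c\<in>I. diag_op r a c * diag_op (\<lambda>a. log 2 (r a)) c a) =
        complex_of_real (r a * log 2 (r a))" using a assms(1) by (simp add: sum.delta)
  qed
  finally show ?thesis unfolding vn_entropy_def by simp
qed

end

theory Submission
  imports Defs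
begin

text \<open>
  With \<open>T(b, a) = \<Sum>\<^sub>m r\<^sub>m \<bar>V\<^sub>m(b, a)\<bar>\<^sup>2\<close>, the squared initial amplitudes of a protocol are the image of the
  squared final ones under the bistochastic matrix \<open>T\<close>. In the limit this gives
  \<open>\<Sum>\<^bsub>i,w\<^esub> P(i,w|j) = 1\<close>, \<open>\<Sum>\<^bsub>j,w\<^esub> P(i,w|j) 2\<^sup>w \<le> 1\<close> (a battery block of level \<open>x + k\<close> is larger than that of
  level \<open>x\<close> by the factor \<open>2\<^sup>w\<close>, and windows lose only \<open>K / N\<close> at their ends) and
  \<open>\<Sum>\<^bsub>j,w\<^esub> P(i,w|j) q\<^sub>j = p\<^sub>i\<close>. Hence \<open>P(i,w|j) q\<^sub>j\<close> is a probability distribution and \<open>P(i,w|j) 2\<^sup>w p\<^sub>i\<close> a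
  subdistribution, and positivity of their relative entropy is the claimed inequality.

  Equality holds for \<open>P(i,w|j) = p\<^sub>i\<close> at \<open>w = log (q\<^sub>j / p\<^sub>i)\<close>; any loss \<open>c\<close> is produced by replacing
  this value with \<open>w + log (1 \<plusminus> s)\<close>, \<open>s\<^sup>2 = 1 - 2\<^bsup>-2c\<^esup>\<close>, each with probability \<open>1/2\<close>. Such a distribution is
  realized with \<open>u \<rightarrow> \<infinity>\<close> by one permutation of the local basis that sends the right number of labels
  from each block to each other block; rounding errors are negligible because the blocks have at least
  \<open>2\<^sup>N\<close> elements, and the few remaining labels are matched arbitrarily.
\<close>

section \<open>Battery blocks and the bistochastic matrix of a protocol step\<close>

text \<open>The matrix runs against the protocol, from final labels to initial ones. This dictates
  the construction: the final state is taken to be exactly its target, the initial state is its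
  pullback, and only the initial error has to be estimated. A single permutation would pull the
  target back to amplitudes that vary inside a block, while admissible states are constant there;
  this is the reason for averaging over the block-preserving permutations.

  In the converse the marginal relation is at first only an inequality, because the fluctuations
  ignore jumps beyond \<open>K\<close>; it becomes an equality since both sides have total 1. The
  function \<open>2 powr w\<close> is unbounded and has to be truncated before weak convergence
  applies to it.

  Realizable values of w are multiples of \<open>delta_w u\<close>, so prescribed values are rounded
  and u has to grow; but \<open>N * delta_w u\<close> must diverge as well, so u has to grow more
  slowly than N. The order \<open>sqrt N\<close> serves both. With \<open>n = 3 * N\<close> and the
  window in the middle third there is room for every shift, and all levels from N upwards have
  blocks of size at least \<open>2 ^ N\<close>.\<close>

definition bsize :: "nat \<Rightarrow> nat \<Rightarrow> nat \<Rightarrow> nat" where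
  "bsize u n x = u ^ x * (u - 1) ^ (n - x)"

lemma card_lists_nth_in:
  assumes "\<And>k. k < n \<Longrightarrow> finite (A k)"
  shows "card {l. length l = n \<and> (\<forall>k<n. l ! k \<in> A k)} = (\<Prod>k<n. card (A k))"
proof -
  have "bij_betw (\<lambda>f. map f [0..<n]) (PiE {..<n} A) {l. length l = n \<and> (\<forall>k<n. l ! k \<in> A k)}"
  proof (rule bij_betw_byWitness[where f' = "\<lambda>l. restrict (nth l) {..<n}"])
    show "\<forall>f\<in>PiE {..<n} A. restrict (nth (map f [0..<n])) {..<n} = f"
    proof
      fix f assume "f \<in> PiE {..<n} A"
      then show "restrict (nth (map f [0..<n])) {..<n} = f"
        by (intro ext) (auto simp: restrict_def PiE_def extensional_def)
    qed
    show "\<forall>l\<in>{l. length l = n \<and> (\<forall>k<n. l ! k \<in> A k)}. map (restrict (nth l) {..<n}) [0..<n] = l"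
      by (auto intro: nth_equalityI)
    show "(\<lambda>f. map f [0..<n]) ` PiE {..<n} A \<subseteq> {l. length l = n \<and> (\<forall>k<n. l ! k \<in> A k)}"
      by (auto simp: PiE_def Pi_def)
    show "(\<lambda>l. restrict (nth l) {..<n}) ` {l. length l = n \<and> (\<forall>k<n. l ! k \<in> A k)} \<subseteq> PiE {..<n} A"
      by (intro image_subsetI) (simp only: mem_Collect_eq restrict_PiE_iff lessThan_iff Ball_def, blast)
  qed
  then have "card {l. length l = n \<and> (\<forall>k<n. l ! k \<in> A k)} = card (PiE {..<n} A)"
    by (rule bij_betw_same_card[symmetric])
  then show ?thesis
    by (simp add: card_PiE)
qed

lemma card_block: "x \<le> n \<Longrightarrow> card (block u n x) = bsize u n x"
proof -
  assume x: "x \<le> n"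
  have "card (block u n x) = (\<Prod>k<n. card (if k < x then {1..u} else {u+1..2*u-1}))"
    unfolding block_def by (rule card_lists_nth_in) simp
  also have "\<dots> = (\<Prod>k<n. if k < x then u else u - 1)"
    by (intro prod.cong) auto
  also have "\<dots> = bsize u n x"
    using prod_split_const[OF x, of u "u - 1"] by (simp add: bsize_def)
  finally show ?thesis .
qed

lemma bsize_pos: "2 \<le> u \<Longrightarrow> 0 < bsize u n x"
  by (simp add: bsize_def)

section \<open>Partition of the local basis into blocks\<close>

lemma length_battery_basis: "l \<in> battery_basis u n \<Longrightarrow> length l = n"
  unfolding battery_basis_def block_def by auto

lemma finite_step_basis: "finite (step_basis D st)"
  by (simp add: step_basis_def loc_basis_def finite_battery_basis)

text \<open>These labels span the range of |i><i| (x) P_x. The blocks partition the local basis, and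
  the operators appearing in the conditions on \<open>Lambda_star\<close> are diagonal and constant
  on each of them.\<close>

definition blk :: "nat \<Rightarrow> nat \<Rightarrow> nat \<Rightarrow> nat \<Rightarrow> lab set" where
  "blk u n i x = {i} \<times> block u n x"

lemma finite_blk: "finite (blk u n i x)"
  by (simp add: blk_def finite_block)

lemma card_blk: "x \<le> n \<Longrightarrow> card (blk u n i x) = bsize u n x"
  by (simp add: blk_def card_block card_cartesian_product_singleton)

lemma blk_subset: "i \<in> {1..D} \<Longrightarrow> x \<le> bat_n st \<Longrightarrow> blk (bat_u st) (bat_n st) i x \<subseteq> step_basis D st"
  by (auto simp: blk_def step_basis_def loc_basis_def battery_basis_def)

lemma blk_disjoint:
  assumes "a \<in> blk u n i x" "a \<in> blk u n j y" "x \<le> n" "y \<le> n"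
  shows "i = j \<and> x = y"
  using assms block_disjoint by (auto simp: blk_def)

lemma step_basis_eq_Union:
  "step_basis D st = (\<Union>(i, x)\<in>{1..D} \<times> {0..bat_n st}. blk (bat_u st) (bat_n st) i x)"
  by (auto simp: blk_def step_basis_def loc_basis_def battery_basis_def)

lemma sum_step_basis:
  "(\<Sum>a\<in>step_basis D st. f a) =
     (\<Sum>i=1..D. \<Sum>x=0..bat_n st. \<Sum>a\<in>blk (bat_u st) (bat_n st) i x. f a)"
  unfolding step_basis_eq_Union
  by (subst sum.UNION_disjoint)
     (auto simp: finite_blk sum.cartesian_product split_beta dest: blk_disjoint)

lemma sum_swap3:
  "(\<Sum>b\<in>B. \<Sum>i\<in>C. \<Sum>x\<in>E. h b i x) = (\<Sum>i\<in>C. \<Sum>x\<in>E. \<Sum>b\<in>B. h b i x)"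
  by (subst sum.swap) (intro sum.cong refl sum.swap)

lemma sum_swap4:
  "(\<Sum>a\<in>A. \<Sum>b\<in>B. \<Sum>i\<in>C. \<Sum>x\<in>E. h a b i x) =
   (\<Sum>i\<in>C. \<Sum>x\<in>E. \<Sum>a\<in>A. \<Sum>b\<in>B. h a b i x)"
  by (rule trans[OF sum.cong[OF refl sum_swap3] sum_swap3])

lemma sum_indicator_subset:
  fixes f :: "'a \<Rightarrow> real"
  shows "finite A \<Longrightarrow> B \<subseteq> A \<Longrightarrow> (\<Sum>a\<in>A. indicator B a * f a) = (\<Sum>a\<in>B. f a)"
  by (rule sum.mono_neutral_cong_right) (auto simp: indicator_def)

text \<open>
  Every operator to which \<open>\<Lambda>\<^sup>*\<close> is applied, and every one it is traced against, is diagonal, so a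
  protocol step enters all conditions only through this matrix.
\<close>

definition jump :: "blocc_step \<Rightarrow> lab \<Rightarrow> lab \<Rightarrow> real" where
  "jump st b a = (\<Sum>m<outcomes st. weight st m * (cmod (corr st m b a))\<^sup>2)"

definition flow :: "blocc_step \<Rightarrow> lab set \<Rightarrow> lab set \<Rightarrow> real" where
  "flow st A B = (\<Sum>a\<in>A. \<Sum>b\<in>B. jump st b a)"

text \<open>For admissible indices this is the trace of |i><i| (x) P_x against
  \<open>Lambda_star\<close> of |j><j| (x) P_y. Dividing by the size of the block (j, y) replaces
  P_y by the reduced state s_y.\<close>

definition mass :: "blocc_step \<Rightarrow> nat \<Rightarrow> nat \<Rightarrow> nat \<Rightarrow> nat \<Rightarrow> real" where
  "mass st i x j y =
     flow st (blk (bat_u st) (bat_n st) i x) (blk (bat_u st) (bat_n st) j y)"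

text \<open>A diagonal X sees only the diagonal of \<open>Lambda_star D st Y\<close>, and for
  diagonal Y the phases in that diagonal cancel: each V contributes only its squared moduli.\<close>

lemma tr_mult_Lambda_star_diag:
  fixes D st
  defines "I \<equiv> step_basis D st"
  assumes X: "\<And>a b. a \<in> I \<Longrightarrow> b \<in> I \<Longrightarrow> X a b = (if a = b then complex_of_real (f a) else 0)"
    and Y: "\<And>a b. a \<in> I \<Longrightarrow> b \<in> I \<Longrightarrow> Y a b = (if a = b then complex_of_real (g a) else 0)"
  shows "tr I (op_mult I X (Lambda_star D st Y)) =
    complex_of_real (\<Sum>a\<in>I. \<Sum>b\<in>I. f a * g b * jump st b a)"
proof -
  have fin: "finite I" by (simp add: I_def finite_step_basis)
  have L: "Lambda_star D st Y a a = complex_of_real (\<Sum>b\<in>I. g b * jump st b a)" if a: "a \<in> I" for a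
  proof -
    have inner: "op_mult I (op_mult I (adj V) Y) V a a = complex_of_real (\<Sum>b\<in>I. g b * (cmod (V b a))\<^sup>2)" for V
    proof -
      have "op_mult I (adj V) Y a b = cnj (V b a) * complex_of_real (g b)" if "b \<in> I" for b
      proof -
        have "op_mult I (adj V) Y a b = (\<Sum>c\<in>I. if c = b then cnj (V b a) * complex_of_real (g b) else 0)"
          unfolding op_mult_def adj_def by (intro sum.cong) (use Y that in auto)
        then show ?thesis using fin that by simp
      qed
      then have "op_mult I (op_mult I (adj V) Y) V a a =
          (\<Sum>b\<in>I. complex_of_real (g b) * (V b a * cnj (V b a)))"
        unfolding op_mult_def[of I "op_mult I (adj V) Y"]
        by (intro sum.cong) auto
      also have "\<dots> = complex_of_real (\<Sum>b\<in>I. g b * (cmod (V b a))\<^sup>2)"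
        by (simp add: complex_norm_square[symmetric])
      finally show ?thesis .
    qed
    have "Lambda_star D st Y a a =
        complex_of_real (\<Sum>m<outcomes st. weight st m * (\<Sum>b\<in>I. g b * (cmod (corr st m b a))\<^sup>2))"
      unfolding Lambda_star_def I_def[symmetric] inner by simp
    also have "(\<Sum>m<outcomes st. weight st m * (\<Sum>b\<in>I. g b * (cmod (corr st m b a))\<^sup>2)) =
        (\<Sum>b\<in>I. g b * jump st b a)"
      unfolding jump_def sum_distrib_left by (subst sum.swap) (simp add: algebra_simps)
    finally show ?thesis .
  qed
  have "tr I (op_mult I X (Lambda_star D st Y)) =
      (\<Sum>a\<in>I. complex_of_real (f a) * Lambda_star D st Y a a)"
    unfolding tr_def
  proof (intro sum.cong refl)
    fix a assume a: "a \<in> I"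
    have "op_mult I X (Lambda_star D st Y) a a =
        (\<Sum>c\<in>I. if c = a then complex_of_real (f a) * Lambda_star D st Y a a else 0)"
      unfolding op_mult_def by (intro sum.cong) (use X a in auto)
    then show "op_mult I X (Lambda_star D st Y) a a =
        complex_of_real (f a) * Lambda_star D st Y a a" using fin a by simp
  qed
  also have "\<dots> = complex_of_real (\<Sum>a\<in>I. \<Sum>b\<in>I. f a * g b * jump st b a)"
    using L by (simp add: sum_distrib_left mult.assoc)
  finally show ?thesis .
qed

section \<open>Diagonal entries of the protocol operators\<close>

lemma op_tensor_ketbra_battery_proj:
  "op_tensor (ketbra (ket i) (ket i)) (battery_proj u n x) a b =
     (if a = b then complex_of_real (indicator (blk u n i x) a) else 0)"
  by (cases a; cases b) (auto simp: op_tensor_def ketbra_def ket_def battery_proj_eq blk_def indicator_def)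

lemma op_tensor_battery_red:
  "op_tensor X (battery_red u n x) a b = op_tensor X (battery_proj u n x) a b / of_nat (bsize u n x)"
  by (cases a; cases b) (auto simp: op_tensor_def battery_red_def bsize_def)

lemma op_tensor_proj_upto:
  "op_tensor (proj_upto d) Y a b = (\<Sum>i=1..d. op_tensor (ketbra (ket i) (ket i)) Y a b)"
  by (cases a; cases b) (auto simp: op_tensor_def proj_upto_def sum_distrib_right)

lemma op_tensor_proj_upto_battery_proj:
  "op_tensor (proj_upto d) (battery_proj u n x) a b =
     (if a = b then complex_of_real (\<Sum>i=1..d. indicator (blk u n i x) a) else 0)"
  by (simp add: op_tensor_proj_upto op_tensor_ketbra_battery_proj)

lemma op_tensor_proj_upto_battery_red:
  "op_tensor (proj_upto d) (battery_red u n x) a b =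
     (if a = b then complex_of_real ((\<Sum>i=1..d. indicator (blk u n i x) a) / bsize u n x) else 0)"
  by (simp add: op_tensor_battery_red op_tensor_proj_upto_battery_proj)

definition near :: "real \<Rightarrow> blocc_step \<Rightarrow> nat \<Rightarrow> nat set" where
  "near w_max st y = {x\<in>{0..bat_n st}. \<bar>int x - int y\<bar> \<le> Kmax w_max (bat_u st)}"

lemma finite_near: "finite (near w_max st y)"
  by (simp add: near_def)

lemma near_le: "x \<in> near w_max st y \<Longrightarrow> x \<le> bat_n st"
  by (simp add: near_def)

lemma far_op_eq:
  "far_op w_max d st y a b = (if a = b then complex_of_real
     (1 - (\<Sum>i=1..d. \<Sum>x\<in>near w_max st y. indicator (blk (bat_u st) (bat_n st) i x) a)) else 0)"
  unfolding far_op_def near_def[symmetric] op_tensor_proj_upto_battery_proj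
  by (subst sum.swap) (simp add: id_op_def)

text \<open>What is left of a step once its states and Kraus operators are forgotten. Column and row
  sums have separate uses: \<open>jump_to\<close> normalizes the fluctuations for a given j,
  \<open>jump_from\<close> bounds the outflow of an initial block. Both the converse and the
  construction work in this setting.\<close>

locale bistochastic_step =
  fixes D N :: nat and st :: blocc_step
  assumes u_ge_2: "2 \<le> bat_u st"
    and window_subset: "window N st \<subseteq> {0..bat_n st}"
    and weight_nonneg: "\<And>m. m < outcomes st \<Longrightarrow> 0 \<le> weight st m"
    and jump_from: "\<And>a. a \<in> step_basis D st \<Longrightarrow> (\<Sum>b\<in>step_basis D st. jump st b a) = 1"
    and jump_to: "\<And>b. b \<in> step_basis D st \<Longrightarrow> (\<Sum>a\<in>step_basis D st. jump st b a) = 1"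
begin

abbreviation I where "I \<equiv> step_basis D st"
abbreviation u where "u \<equiv> bat_u st"
abbreviation n where "n \<equiv> bat_n st"
abbreviation g where "g x \<equiv> real (bsize (bat_u st) (bat_n st) x)"

lemma g_pos: "0 < g x"
  using bsize_pos[OF u_ge_2] by simp

lemma jump_nonneg: "0 \<le> jump st b a"
  unfolding jump_def by (intro sum_nonneg mult_nonneg_nonneg weight_nonneg) auto

lemma mass_nonneg: "0 \<le> mass st i x j y"
  unfolding mass_def flow_def by (intro sum_nonneg jump_nonneg)

lemma window_le: "x \<in> window N st \<Longrightarrow> x \<le> n"
  using window_subset by auto

lemma sum_indicator_jump:
  assumes "A \<subseteq> I" "B \<subseteq> I"
  shows "(\<Sum>a\<in>I. \<Sum>b\<in>I. indicator A a * indicator B b * jump st b a) = flow st A B"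
proof -
  have "(\<Sum>b\<in>I. indicator A a * indicator B b * jump st b a) = indicator A a * (\<Sum>b\<in>B. jump st b a)" for a
    unfolding mult.assoc sum_distrib_left[symmetric]
    by (simp only: sum_indicator_subset[OF finite_step_basis assms(2)])
  then show ?thesis
    unfolding flow_def
    by (simp only: sum_indicator_subset[OF finite_step_basis assms(1)])
qed

lemma flow_UNIV_left: "B \<subseteq> I \<Longrightarrow> flow st I B = card B"
  unfolding flow_def by (subst sum.swap, subst sum.cong[OF refl jump_to]) auto

lemma flow_UNIV_right: "A \<subseteq> I \<Longrightarrow> flow st A I = card A"
  unfolding flow_def by (subst sum.cong[OF refl jump_from]) auto

lemma fluct_eq:
  assumes "i \<in> {1..D}" "j \<in> {1..D}"
  shows "fluct D N st i k j = 1 / real (N + 1) * (\<Sum>y\<in>window N st.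
    if 0 \<le> int y - k \<and> int y - k \<le> int n then mass st i (nat (int y - k)) j y / g y else 0)"
proof -
  have "Re (tr I (op_mult I
         (op_tensor (ketbra (ket i) (ket i)) (battery_proj u n x))
         (Lambda_star D st (op_tensor (ketbra (ket j) (ket j)) (battery_red u n y))))) =
      mass st i x j y / g y" if "x \<le> n" "y \<le> n" for x y
  proof -
    have "tr I (op_mult I
         (op_tensor (ketbra (ket i) (ket i)) (battery_proj u n x))
         (Lambda_star D st (op_tensor (ketbra (ket j) (ket j)) (battery_red u n y)))) =
       complex_of_real (\<Sum>a\<in>I. \<Sum>b\<in>I. indicator (blk u n i x) a * (indicator (blk u n j y) b / g y) * jump st b a)"
      by (rule tr_mult_Lambda_star_diag)
         (auto simp: op_tensor_battery_red op_tensor_ketbra_battery_proj)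
    also have "(\<Sum>a\<in>I. \<Sum>b\<in>I. indicator (blk u n i x) a * (indicator (blk u n j y) b / g y) * jump st b a) =
       mass st i x j y / g y"
      unfolding mass_def using that assms
      by (subst sum_indicator_jump[symmetric]) (auto simp: blk_subset sum_divide_distrib)
    finally show ?thesis by simp
  qed
  then show ?thesis
    unfolding fluct_def by (intro arg_cong[where f = "(*) _"] sum.cong) (auto simp: window_le)
qed

lemma far_weight_final_eq:
  assumes "d \<le> D" "d' \<le> D"
  shows "far_weight_final w_max D d d' N st = complex_of_real (1 / real (N + 1) *
    (\<Sum>y\<in>window N st. \<Sum>j=1..d'.
       1 - (\<Sum>i=1..d. \<Sum>x\<in>near w_max st y. mass st i x j y / g y)))"
proof -
  have "tr I (op_mult I (far_op w_max d st y)
       (Lambda_star D st (op_tensor (proj_upto d') (battery_red u n y)))) =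
      complex_of_real (\<Sum>j=1..d'. 1 - (\<Sum>i=1..d. \<Sum>x\<in>near w_max st y. mass st i x j y / g y))"
    if y: "y \<in> window N st" for y
  proof -
    let ?f = "\<lambda>a. 1 - (\<Sum>i=1..d. \<Sum>x\<in>near w_max st y. indicator (blk u n i x) a) :: real"
    let ?B = "\<lambda>j. indicator (blk u n j y) :: lab \<Rightarrow> real"
    have sub: "i \<in> {1..d} \<Longrightarrow> x \<in> near w_max st y \<Longrightarrow> blk u n i x \<subseteq> I" for i x
      using assms by (intro blk_subset near_le) auto
    have sub': "j \<in> {1..d'} \<Longrightarrow> blk u n j y \<subseteq> I" for j
      using assms y by (intro blk_subset window_le) auto
    have one: "(\<Sum>a\<in>I. \<Sum>b\<in>I. ?f a * ?B j b * jump st b a) =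
        g y - (\<Sum>i=1..d. \<Sum>x\<in>near w_max st y. mass st i x j y)" if j: "j \<in> {1..d'}" for j
    proof -
      \<comment> \<open>The constant 1 in \<open>?f\<close> is read as the indicator of the whole
        basis, whose flow into the block (j, y) is the block size by bistochasticity.\<close>
      have "(\<Sum>a\<in>I. \<Sum>b\<in>I. ?f a * ?B j b * jump st b a) =
         (\<Sum>a\<in>I. \<Sum>b\<in>I. indicator I a * ?B j b * jump st b a) -
         (\<Sum>a\<in>I. \<Sum>b\<in>I. \<Sum>i=1..d. \<Sum>x\<in>near w_max st y. indicator (blk u n i x) a * ?B j b * jump st b a)"
        unfolding sum_subtractf[symmetric]
        by (intro sum.cong refl) (simp add: algebra_simps sum_distrib_left)
      also have "(\<Sum>a\<in>I. \<Sum>b\<in>I. \<Sum>i=1..d. \<Sum>x\<in>near w_max st y. indicator (blk u n i x) a * ?B j b * jump st b a)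
        = (\<Sum>i=1..d. \<Sum>x\<in>near w_max st y. \<Sum>a\<in>I. \<Sum>b\<in>I. indicator (blk u n i x) a * ?B j b * jump st b a)"
        by (rule sum_swap4)
      also have "\<dots> = (\<Sum>i=1..d. \<Sum>x\<in>near w_max st y. mass st i x j y)"
        using sub sub' j by (intro sum.cong refl) (simp add: sum_indicator_jump mass_def)
      also have "(\<Sum>a\<in>I. \<Sum>b\<in>I. indicator I a * ?B j b * jump st b a) = g y"
        using sub'[OF j] window_le[OF y] by (simp only: sum_indicator_jump flow_UNIV_left card_blk subset_refl)
      finally show ?thesis .
    qed
    have "tr I (op_mult I (far_op w_max d st y)
        (Lambda_star D st (op_tensor (proj_upto d') (battery_red u n y)))) =
      complex_of_real (\<Sum>a\<in>I. \<Sum>b\<in>I. ?f a * ((\<Sum>j=1..d'. ?B j b) / g y) * jump st b a)"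
      by (rule tr_mult_Lambda_star_diag) (simp_all add: far_op_eq op_tensor_proj_upto_battery_red)
    also have "(\<Sum>a\<in>I. \<Sum>b\<in>I. ?f a * ((\<Sum>j=1..d'. ?B j b) / g y) * jump st b a) =
       (\<Sum>a\<in>I. \<Sum>b\<in>I. \<Sum>j=1..d'. ?f a * ?B j b * jump st b a) / g y"
      unfolding sum_divide_distrib by (intro sum.cong refl)
        (simp add: sum_distrib_left sum_distrib_right sum_divide_distrib mult.commute mult.left_commute)
    also have "(\<Sum>a\<in>I. \<Sum>b\<in>I. \<Sum>j=1..d'. ?f a * ?B j b * jump st b a) =
        (\<Sum>j=1..d'. \<Sum>a\<in>I. \<Sum>b\<in>I. ?f a * ?B j b * jump st b a)"
      by (rule sum_swap3[symmetric])
    also have "\<dots> = (\<Sum>j=1..d'. g y - (\<Sum>i=1..d. \<Sum>x\<in>near w_max st y. mass st i x j y))"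
      by (intro sum.cong refl one)
    also have "\<dots> / g y = (\<Sum>j=1..d'. 1 - (\<Sum>i=1..d. \<Sum>x\<in>near w_max st y. mass st i x j y / g y))"
      unfolding sum_divide_distrib using g_pos[of y]
      by (intro sum.cong refl) (simp add: diff_divide_distrib sum_divide_distrib)
    finally show ?thesis .
  qed
  then show ?thesis unfolding far_weight_final_def by simp
qed

text \<open>The mirror image of the final far weight: the total is now the flow out of an initial
  block, so sizes of initial blocks appear in the denominators.\<close>

lemma far_weight_initial_eq:
  assumes "d \<le> D" "d' \<le> D"
  shows "far_weight_initial w_max D d d' N st = complex_of_real (1 / real (N + 1) *
    (\<Sum>x\<in>window N st. \<Sum>i=1..d.
       1 - (\<Sum>j=1..d'. \<Sum>y\<in>near w_max st x. mass st i x j y / g x)))"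
proof -
  have "tr I (op_mult I (op_tensor (proj_upto d) (battery_red u n x))
       (Lambda_star D st (far_op w_max d' st x))) =
      complex_of_real (\<Sum>i=1..d. 1 - (\<Sum>j=1..d'. \<Sum>y\<in>near w_max st x. mass st i x j y / g x))"
    if x: "x \<in> window N st" for x
  proof -
    let ?f = "\<lambda>b. 1 - (\<Sum>j=1..d'. \<Sum>y\<in>near w_max st x. indicator (blk u n j y) b) :: real"
    let ?A = "\<lambda>i. indicator (blk u n i x) :: lab \<Rightarrow> real"
    have sub: "j \<in> {1..d'} \<Longrightarrow> y \<in> near w_max st x \<Longrightarrow> blk u n j y \<subseteq> I" for j y
      using assms by (intro blk_subset near_le) auto
    have sub': "i \<in> {1..d} \<Longrightarrow> blk u n i x \<subseteq> I" for i
      using assms x by (intro blk_subset window_le) auto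
    have one: "(\<Sum>a\<in>I. \<Sum>b\<in>I. ?A i a * ?f b * jump st b a) =
        g x - (\<Sum>j=1..d'. \<Sum>y\<in>near w_max st x. mass st i x j y)" if i: "i \<in> {1..d}" for i
    proof -
      have "(\<Sum>a\<in>I. \<Sum>b\<in>I. ?A i a * ?f b * jump st b a) =
         (\<Sum>a\<in>I. \<Sum>b\<in>I. ?A i a * indicator I b * jump st b a) -
         (\<Sum>a\<in>I. \<Sum>b\<in>I. \<Sum>j=1..d'. \<Sum>y\<in>near w_max st x. ?A i a * indicator (blk u n j y) b * jump st b a)"
        unfolding sum_subtractf[symmetric]
        by (intro sum.cong refl) (simp add: algebra_simps sum_distrib_left)
      also have "(\<Sum>a\<in>I. \<Sum>b\<in>I. \<Sum>j=1..d'. \<Sum>y\<in>near w_max st x. ?A i a * indicator (blk u n j y) b * jump st b a)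
        = (\<Sum>j=1..d'. \<Sum>y\<in>near w_max st x. \<Sum>a\<in>I. \<Sum>b\<in>I. ?A i a * indicator (blk u n j y) b * jump st b a)"
        by (rule sum_swap4)
      also have "\<dots> = (\<Sum>j=1..d'. \<Sum>y\<in>near w_max st x. mass st i x j y)"
        using sub sub' i by (intro sum.cong refl) (simp add: sum_indicator_jump mass_def)
      also have "(\<Sum>a\<in>I. \<Sum>b\<in>I. ?A i a * indicator I b * jump st b a) = g x"
        using sub'[OF i] window_le[OF x] by (simp only: sum_indicator_jump flow_UNIV_right card_blk subset_refl)
      finally show ?thesis .
    qed
    have "tr I (op_mult I (op_tensor (proj_upto d) (battery_red u n x))
        (Lambda_star D st (far_op w_max d' st x))) =
      complex_of_real (\<Sum>a\<in>I. \<Sum>b\<in>I. ((\<Sum>i=1..d. ?A i a) / g x) * ?f b * jump st b a)"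
      by (rule tr_mult_Lambda_star_diag) (simp_all add: far_op_eq op_tensor_proj_upto_battery_red)
    also have "(\<Sum>a\<in>I. \<Sum>b\<in>I. ((\<Sum>i=1..d. ?A i a) / g x) * ?f b * jump st b a) =
       (\<Sum>a\<in>I. \<Sum>b\<in>I. \<Sum>i=1..d. ?A i a * ?f b * jump st b a) / g x"
      unfolding sum_divide_distrib by (intro sum.cong refl)
        (simp add: sum_distrib_left sum_distrib_right sum_divide_distrib mult.commute mult.left_commute)
    also have "(\<Sum>a\<in>I. \<Sum>b\<in>I. \<Sum>i=1..d. ?A i a * ?f b * jump st b a) =
        (\<Sum>i=1..d. \<Sum>a\<in>I. \<Sum>b\<in>I. ?A i a * ?f b * jump st b a)"
      by (rule sum_swap3[symmetric])
    also have "\<dots> = (\<Sum>i=1..d. g x - (\<Sum>j=1..d'. \<Sum>y\<in>near w_max st x. mass st i x j y))"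
      by (intro sum.cong refl one)
    also have "\<dots> / g x = (\<Sum>i=1..d. 1 - (\<Sum>j=1..d'. \<Sum>y\<in>near w_max st x. mass st i x j y / g x))"
      unfolding sum_divide_distrib using g_pos[of x]
      by (intro sum.cong refl) (simp add: diff_divide_distrib sum_divide_distrib)
    finally show ?thesis .
  qed
  then show ?thesis unfolding far_weight_initial_def by simp
qed

end

section \<open>Diagonal amplitudes of a valid step and their balance\<close>

lemma bip_tensor_ket_e_state:
  assumes "x \<le> n" "length (snd a) = n" "length (snd b) = n"
  shows "bip_tensor (ket (i, i)) (e_state u n x) (a, b) =
    (if a = b \<and> a \<in> blk u n i x then complex_of_real (1 / sqrt (real (bsize u n x))) else 0)"
  using assms by (cases a; cases b) (auto simp: bip_tensor_def ket_def e_state_eq blk_def bsize_def)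

text \<open>Every |ii> (x) |e_x> is a diagonal matrix in the labels of AA' and BB', so a state in
  their span is given by one nonnegative amplitude per local label.\<close>

lemma nonneg_battery_form_diagonal:
  assumes "nonneg_battery_form D u n v"
  shows "\<exists>c. (\<forall>a. 0 \<le> c a) \<and> (\<forall>a\<in>loc_basis D u n. \<forall>b\<in>loc_basis D u n.
    v (a, b) = (if a = b then complex_of_real (c a) else 0))"
proof -
  obtain k :: "nat \<Rightarrow> nat \<Rightarrow> real" where k: "\<And>i x. 0 \<le> k i x"
    and v: "\<And>z. z \<in> loc_basis D u n \<times> loc_basis D u n \<Longrightarrow>
       v z = (\<Sum>i=1..D. \<Sum>x=0..n.
                complex_of_real (k i x) * bip_tensor (ket (i, i)) (e_state u n x) z)"
    using assms unfolding nonneg_battery_form_def by blast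
  define c where "c a = (\<Sum>i=1..D. \<Sum>x=0..n.
    if a \<in> blk u n i x then k i x / sqrt (real (bsize u n x)) else 0)" for a
  show ?thesis
  proof (intro exI[of _ c] conjI allI ballI)
    show "0 \<le> c a" for a
      unfolding c_def by (intro sum_nonneg) (simp add: k)
    fix a b assume ab: "a \<in> loc_basis D u n" "b \<in> loc_basis D u n"
    then have "length (snd a) = n" "length (snd b) = n"
      by (auto simp: loc_basis_def length_battery_basis)
    then have e: "x \<in> {0..n} \<Longrightarrow> bip_tensor (ket (i, i)) (e_state u n x) (a, b) =
        (if a = b \<and> a \<in> blk u n i x then complex_of_real (1 / sqrt (real (bsize u n x))) else 0)" for i x
      by (intro bip_tensor_ket_e_state) auto
    have "v (a, b) = (\<Sum>i=1..D. \<Sum>x=0..n. complex_of_real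
        (if a = b \<and> a \<in> blk u n i x then k i x / sqrt (real (bsize u n x)) else 0))"
      unfolding v[OF SigmaI[OF ab]] by (intro sum.cong refl) (auto simp: e)
    then show "v (a, b) = (if a = b then complex_of_real (c a) else 0)"
      by (cases "a = b") (simp_all add: c_def)
  qed
qed

lemma sum_product_diagonal:
  assumes "finite I" "\<And>a b. a \<in> I \<Longrightarrow> b \<in> I \<Longrightarrow> a \<noteq> b \<Longrightarrow> f (a, b) = 0"
  shows "(\<Sum>z\<in>I \<times> I. f z) = (\<Sum>a\<in>I. f (a, a))"
proof -
  have "(\<Sum>z\<in>I \<times> I. f z) = (\<Sum>a\<in>I. \<Sum>b\<in>I. f (a, b))"
    by (simp add: sum.cartesian_product)
  also have "\<dots> = (\<Sum>a\<in>I. \<Sum>b\<in>I. if b = a then f (a, a) else 0)"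
    using assms(2) by (intro sum.cong refl) auto
  finally show ?thesis using assms(1) by simp
qed

lemma vnorm_diagonal:
  assumes "finite I" "\<And>a b. a \<in> I \<Longrightarrow> b \<in> I \<Longrightarrow> v (a, b) = (if a = b then complex_of_real (c a) else 0)"
  shows "vnorm (I \<times> I) v = sqrt (\<Sum>a\<in>I. (c a)\<^sup>2)"
  unfolding vnorm_def using assms by (subst sum_product_diagonal) auto

text \<open>
  With the states written as diagonal matrices \<open>C\<close>, \<open>C'\<close>, the protocol says
  \<open>M C V\<^sup>T = \<surd>r C'\<close>, that is \<open>M C = \<surd>r C' V\<^sup>*\<close>. Summing \<open>\<bar>M C\<bar>\<^sup>2\<close> over a column and over the outcomes
  removes \<open>M\<close>.
\<close>

lemma valid_step_majorization:
  assumes valid: "valid_step D N st"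
  shows "bistochastic_step D N st"
    and "\<exists>c c'. (\<forall>a\<in>step_basis D st. \<forall>b\<in>step_basis D st.
        init_state st (a, b) = (if a = b then complex_of_real (c a) else 0) \<and>
        fin_state st (a, b) = (if a = b then complex_of_real (c' a) else 0)) \<and>
      (\<Sum>a\<in>step_basis D st. (c a)\<^sup>2) = 1 \<and> (\<Sum>a\<in>step_basis D st. (c' a)\<^sup>2) = 1 \<and>
      (\<forall>a\<in>step_basis D st. (c a)\<^sup>2 = (\<Sum>b\<in>step_basis D st. (c' b)\<^sup>2 * jump st b a))"
proof -
  define I where "I = step_basis D st"
  have fin: "finite I" by (simp add: I_def finite_step_basis)
  have "I = loc_basis D (bat_u st) (bat_n st)" by (simp add: I_def step_basis_def)
  then have nn: "nonneg_battery_form D (bat_u st) (bat_n st) (init_state st)"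
      "nonneg_battery_form D (bat_u st) (bat_n st) (fin_state st)"
    and Il: "loc_basis D (bat_u st) (bat_n st) = I"
    using valid unfolding valid_step_def Let_def by simp_all
  obtain c where c1: "\<And>a. 0 \<le> c a"
    "\<And>a b. a \<in> I \<Longrightarrow> b \<in> I \<Longrightarrow> init_state st (a, b) = (if a = b then complex_of_real (c a) else 0)"
    using nonneg_battery_form_diagonal[OF nn(1)] unfolding Il by blast
  obtain c' where c2: "\<And>a. 0 \<le> c' a"
    "\<And>a b. a \<in> I \<Longrightarrow> b \<in> I \<Longrightarrow> fin_state st (a, b) = (if a = b then complex_of_real (c' a) else 0)"
    using nonneg_battery_form_diagonal[OF nn(2)] unfolding Il by blast
  note c = c1(1) c2(1) c1(2) c2(2)
  have norm: "(\<Sum>a\<in>I. (c a)\<^sup>2) = 1" "(\<Sum>a\<in>I. (c' a)\<^sup>2) = 1"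
    using valid vnorm_diagonal[OF fin c(3)] vnorm_diagonal[OF fin c(4)]
    unfolding valid_step_def Let_def I_def[symmetric] by auto
  have w: "0 \<le> weight st m" and un: "unitary_on I (corr st m)"
    and act: "\<And>z. z \<in> I \<times> I \<Longrightarrow> op_apply (I \<times> I) (op_tensor (kraus st m) (corr st m)) (init_state st) z =
              complex_of_real (sqrt (weight st m)) * fin_state st z" if "m < outcomes st" for m
    using valid that unfolding valid_step_def Let_def I_def[symmetric] by blast+
  have col: "(\<Sum>e\<in>I. cnj (corr st m e a) * corr st m e b) = (if a = b then 1 else 0)"
    and row: "(\<Sum>e\<in>I. corr st m a e * cnj (corr st m b e)) = (if a = b then 1 else 0)"
    if "m < outcomes st" "a \<in> I" "b \<in> I" for m a b
    using un[OF that(1)] that unfolding unitary_on_def op_eq_def op_mult_def adj_def id_op_def by auto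
  have colR: "(\<Sum>e\<in>I. (cmod (corr st m e a))\<^sup>2) = 1" if "m < outcomes st" "a \<in> I" for m a
  proof -
    have "complex_of_real (\<Sum>e\<in>I. (cmod (corr st m e a))\<^sup>2) = 1"
      using col[OF that(1,2,2)] by (simp add: complex_norm_square mult.commute del: of_real_power)
    then show ?thesis by (simp only: of_real_eq_1_iff)
  qed
  have rowR: "(\<Sum>e\<in>I. (cmod (corr st m a e))\<^sup>2) = 1" if "m < outcomes st" "a \<in> I" for m a
  proof -
    have "complex_of_real (\<Sum>e\<in>I. (cmod (corr st m a e))\<^sup>2) = 1"
      using row[OF that(1,2,2)] by (simp add: complex_norm_square mult.commute del: of_real_power)
    then show ?thesis by (simp only: of_real_eq_1_iff)
  qed
  have kraus_col: "(\<Sum>m<outcomes st. \<Sum>a\<in>I. (cmod (kraus st m a e))\<^sup>2) = 1" if "e \<in> I" for e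
  proof -
    have "(\<Sum>m<outcomes st. op_mult I (adj (kraus st m)) (kraus st m) e e) = 1"
      using valid that unfolding valid_step_def Let_def I_def[symmetric] op_eq_def id_op_def by auto
    then have "complex_of_real (\<Sum>m<outcomes st. \<Sum>a\<in>I. (cmod (kraus st m a e))\<^sup>2) = 1"
      by (simp add: op_mult_def adj_def complex_norm_square mult.commute del: of_real_power)
    then show ?thesis by (simp only: of_real_eq_1_iff)
  qed
  \<comment> \<open>Multiplying the matrix identity from the right by the entrywise conjugate of V
    cancels the transpose of V, by orthonormality of the columns of V, and isolates the Kraus
    operator.\<close>
  have MC: "kraus st m a e * complex_of_real (c e) =
      complex_of_real (sqrt (weight st m) * c' a) * cnj (corr st m a e)"
    if m: "m < outcomes st" and ae: "a \<in> I" "e \<in> I" for m a e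
  proof -
    have A: "(\<Sum>f\<in>I. kraus st m a f * corr st m b f * complex_of_real (c f)) =
        (if a = b then complex_of_real (sqrt (weight st m) * c' a) else 0)" if b: "b \<in> I" for b
    proof -
      have "(\<Sum>f\<in>I. kraus st m a f * corr st m b f * complex_of_real (c f)) =
          op_apply (I \<times> I) (op_tensor (kraus st m) (corr st m)) (init_state st) (a, b)"
        unfolding op_apply_def
        by (subst sum_product_diagonal[OF fin]) (auto simp: c(3) op_tensor_def)
      also have "\<dots> = (if a = b then complex_of_real (sqrt (weight st m) * c' a) else 0)"
        using act[OF m, of "(a, b)"] c(4) ae b by auto
      finally show ?thesis .
    qed
    have "kraus st m a e * complex_of_real (c e) =
        (\<Sum>f\<in>I. kraus st m a f * complex_of_real (c f) * (if e = f then 1 else 0))"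
      using fin ae by (simp add: if_distrib[of "\<lambda>x. _ * x"] cong: if_cong)
    also have "\<dots> = (\<Sum>f\<in>I. kraus st m a f * complex_of_real (c f) *
        (\<Sum>b\<in>I. cnj (corr st m b e) * corr st m b f))"
      using col[OF m] ae by (intro sum.cong refl) auto
    also have "\<dots> = (\<Sum>b\<in>I. cnj (corr st m b e) *
        (\<Sum>f\<in>I. kraus st m a f * corr st m b f * complex_of_real (c f)))"
      unfolding sum_distrib_left by (subst sum.swap) (simp add: mult_ac)
    also have "\<dots> = (\<Sum>b\<in>I. if a = b then cnj (corr st m b e) * complex_of_real (sqrt (weight st m) * c' a) else 0)"
      using A by (intro sum.cong refl) auto
    also have "\<dots> = complex_of_real (sqrt (weight st m) * c' a) * cnj (corr st m a e)"
      using fin ae by simp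
    finally show ?thesis .
  qed
  \<comment> \<open>The diagonal entry e of the completeness relation says that the squared moduli
    in column e, over all outcomes, add up to 1; multiplied by \<open>(c e)\<^sup>2\<close> this is
    the balance.\<close>
  have bal: "(c e)\<^sup>2 = (\<Sum>a\<in>I. (c' a)\<^sup>2 * jump st a e)" if e: "e \<in> I" for e
  proof -
    have "(c e)\<^sup>2 = (\<Sum>m<outcomes st. \<Sum>a\<in>I. (cmod (kraus st m a e * complex_of_real (c e)))\<^sup>2)"
      using kraus_col[OF e] by (simp add: norm_mult power_mult_distrib sum_distrib_right[symmetric])
    also have "\<dots> = (\<Sum>m<outcomes st. \<Sum>a\<in>I. (c' a)\<^sup>2 * (weight st m * (cmod (corr st m a e))\<^sup>2))"
    proof (intro sum.cong refl)
      fix m a assume "m \<in> {..<outcomes st}" "a \<in> I"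
      then show "(cmod (kraus st m a e * complex_of_real (c e)))\<^sup>2 =
          (c' a)\<^sup>2 * (weight st m * (cmod (corr st m a e))\<^sup>2)"
        using MC[of m a e] e w[of m] by (simp add: norm_mult power_mult_distrib)
    qed
    also have "\<dots> = (\<Sum>a\<in>I. (c' a)\<^sup>2 * jump st a e)"
      unfolding jump_def sum_distrib_left by (rule sum.swap)
    finally show ?thesis .
  qed
  have to: "(\<Sum>a\<in>I. jump st b a) = (\<Sum>m<outcomes st. weight st m)" if "b \<in> I" for b
    unfolding jump_def using rowR that by (subst sum.swap) (simp add: sum_distrib_left[symmetric])
  have "from": "(\<Sum>b\<in>I. jump st b a) = (\<Sum>m<outcomes st. weight st m)" if "a \<in> I" for a
    unfolding jump_def using colR that by (subst sum.swap) (simp add: sum_distrib_left[symmetric])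
  \<comment> \<open>All row and column sums of \<open>jump\<close> equal the total weight. Summing
    the balance over all labels and using that both states are normalized shows that this total is
    1.\<close>
  have "1 = (\<Sum>a\<in>I. \<Sum>b\<in>I. (c' b)\<^sup>2 * jump st b a)"
    using norm(1) bal by simp
  also have "\<dots> = (\<Sum>b\<in>I. (c' b)\<^sup>2 * (\<Sum>a\<in>I. jump st b a))"
    unfolding sum_distrib_left by (rule sum.swap)
  also have "\<dots> = (\<Sum>m<outcomes st. weight st m)"
    using norm(2) to by (simp add: sum_distrib_right[symmetric])
  finally have tot: "(\<Sum>m<outcomes st. weight st m) = 1" ..
  show "bistochastic_step D N st"
    using valid w to "from" tot unfolding valid_step_def Let_def I_def
    by unfold_locales auto
  show "\<exists>c c'. (\<forall>a\<in>step_basis D st. \<forall>b\<in>step_basis D st.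
        init_state st (a, b) = (if a = b then complex_of_real (c a) else 0) \<and>
        fin_state st (a, b) = (if a = b then complex_of_real (c' a) else 0)) \<and>
      (\<Sum>a\<in>step_basis D st. (c a)\<^sup>2) = 1 \<and> (\<Sum>a\<in>step_basis D st. (c' a)\<^sup>2) = 1 \<and>
      (\<forall>a\<in>step_basis D st. (c a)\<^sup>2 = (\<Sum>b\<in>step_basis D st. (c' b)\<^sup>2 * jump st b a))"
    unfolding I_def[symmetric] by (intro exI[of _ c] exI[of _ c'] conjI ballI c norm bal)
qed

section \<open>The upper bound on the extracted entanglement\<close>

lemma delta_w_pos: "2 \<le> u \<Longrightarrow> 0 < delta_w u"
  by (simp add: delta_w_def)

lemma powr_delta_w: "2 \<le> u \<Longrightarrow> 2 powr delta_w u = real u / real (u - 1)"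
  by (simp add: delta_w_def)

text \<open>Raising the level by one trades a factor u - 1 for a factor u, so the sizes form a
  geometric progression of ratio \<open>2 powr delta_w u\<close>. Raising by k levels thus
  multiplies the size by \<open>2 powr w\<close> with \<open>w = k * delta_w u\<close>.\<close>

lemma bsize_eq_powr:
  assumes "2 \<le> u" "x \<le> n"
  shows "real (bsize u n x) = real (u - 1) ^ n * 2 powr (real x * delta_w u)"
proof -
  have "0 < real u / real (u - 1)" using assms by simp
  then have "2 powr (real x * delta_w u) = (real u / real (u - 1)) ^ x"
    using powr_delta_w[OF assms(1)] by (simp add: powr_powr[symmetric] mult.commute[of "real x"] powr_realpow assms)
  moreover have "real (u - 1) ^ n = real (u - 1) ^ x * real (u - 1) ^ (n - x)"
    using assms by (simp add: power_add[symmetric])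
  ultimately show ?thesis
    using assms by (simp add: bsize_def power_divide)
qed

lemma bsize_shift:
  assumes "2 \<le> u" "x \<le> n" "y \<le> n"
  shows "real (bsize u n y) = real (bsize u n x) * 2 powr ((real y - real x) * delta_w u)"
  using assms by (simp add: bsize_eq_powr powr_add[symmetric] algebra_simps)

lemma Kmax_nonneg: "0 < w_max \<Longrightarrow> 2 \<le> u \<Longrightarrow> 0 \<le> Kmax w_max u"
  using delta_w_pos[of u] by (simp add: Kmax_def)

lemma Kmax_mult_delta_w_le: "2 \<le> u \<Longrightarrow> real_of_int (Kmax w_max u) * delta_w u \<le> w_max"
  using delta_w_pos[of u] by (simp add: Kmax_def pos_le_divide_eq[symmetric])

lemma finite_abs_le_int: "finite {k::int. \<bar>k\<bar> \<le> K}"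
  by (rule finite_subset[of _ "{-K..K}"]) auto

text \<open>The substitution \<open>x = y - k\<close> turns the sum over shifts, as in the
  fluctuations, into the sum over initial levels, as in the far weights; the guard removes levels
  that the battery does not have.\<close>

lemma sum_shift_near:
  "(\<Sum>k\<in>{k. \<bar>k\<bar> \<le> Kmax w_max (bat_u st)}.
      if 0 \<le> int y - k \<and> int y - k \<le> int (bat_n st) then F (nat (int y - k)) k else 0) =
   (\<Sum>x\<in>near w_max st y. F x (int y - int x))" (is "sum ?h ?S = _")
proof -
  have "sum ?h ?S =
      (\<Sum>k\<in>{k\<in>?S. 0 \<le> int y - k \<and> int y - k \<le> int (bat_n st)}. F (nat (int y - k)) k)"
    by (rule sum.inter_filter[OF finite_abs_le_int, symmetric])
  also have "\<dots> = (\<Sum>x\<in>near w_max st y. F x (int y - int x))"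
    by (rule sum.reindex_bij_witness[of _ "\<lambda>x. int y - int x" "\<lambda>k. nat (int y - k)"])
       (auto simp: near_def)
  finally show ?thesis .
qed

text \<open>The diagonal entry of the ideal product of a Schmidt state and the battery state. On the
  local basis at most one summand of the window sum is nonzero, since blocks of different levels are
  disjoint; the sum avoids a function reading off the level of a label.\<close>

definition amplitude :: "nat \<Rightarrow> nat \<Rightarrow> (nat \<Rightarrow> real) \<Rightarrow> blocc_step \<Rightarrow> lab \<Rightarrow> real" where
  "amplitude N d p st a = (if fst a \<in> {1..d} then sqrt (p (fst a)) else 0) *
     (\<Sum>x\<in>window N st. if snd a \<in> block (bat_u st) (bat_n st) x
        then 1 / sqrt (real (bsize (bat_u st) (bat_n st) x)) else 0) / sqrt (real (N + 1))"

lemma schmidt_state_eq: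
  "schmidt_state d p (a, b) = (if a = b then complex_of_real (if a \<in> {1..d} then sqrt (p a) else 0) else 0)"
proof -
  have "schmidt_state d p (a, b) =
      (\<Sum>i=1..d. if i = a then (if a = b then complex_of_real (sqrt (p a)) else 0) else 0)"
    unfolding schmidt_state_def by (intro sum.cong) (auto simp: ket_def)
  then show ?thesis by auto
qed

context bistochastic_step
begin

lemma bip_tensor_schmidt_battery:
  assumes "a \<in> I" "b \<in> I"
  shows "bip_tensor (schmidt_state d p) (battery_state N st) (a, b) =
    (if a = b then complex_of_real (amplitude N d p st a) else 0)"
proof -
  obtain i l j m where ab: "a = (i, l)" "b = (j, m)" by (cases a; cases b)
  have len: "length l = n" "length m = n"
    using assms by (auto simp: ab step_basis_def loc_basis_def length_battery_basis)
  have "(\<Sum>x\<in>window N st. e_state u n x (l, m)) = complex_of_real (if l = m then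
      (\<Sum>x\<in>window N st. if l \<in> block u n x then 1 / sqrt (g x) else 0) else 0)"
  proof (cases "l = m")
    case True
    have "(\<Sum>x\<in>window N st. e_state u n x (l, m)) =
        (\<Sum>x\<in>window N st. complex_of_real (if l \<in> block u n x then 1 / sqrt (g x) else 0))"
      using True by (intro sum.cong refl) (auto simp: e_state_eq len window_le bsize_def)
    then show ?thesis using True by simp
  qed (simp add: e_state_eq len window_le)
  then show ?thesis
    by (simp add: bip_tensor_def ab schmidt_state_eq battery_state_def amplitude_def)
qed

lemma amplitude_on_blk:
  assumes "a \<in> blk u n i x" "x \<le> n"
  shows "amplitude N d p st a =
    (if i \<in> {1..d} \<and> x \<in> window N st then sqrt (p i) / sqrt (g x) / sqrt (real (N + 1)) else 0)"
proof -
  have a: "fst a = i" "snd a \<in> block u n x" using assms(1) by (auto simp: blk_def)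
  have "(\<Sum>y\<in>window N st. if snd a \<in> block u n y then 1 / sqrt (g y) else 0) =
      (\<Sum>y\<in>window N st. if y = x then 1 / sqrt (g x) else 0)"
    using a(2) assms(2) window_le by (intro sum.cong refl) (auto dest: block_disjoint)
  then show ?thesis
    by (simp add: amplitude_def a window_def)
qed

lemma amplitude_sq_on_blk:
  assumes "a \<in> blk u n i x" "x \<le> n" "\<And>i. i \<in> {1..d} \<Longrightarrow> 0 < p i"
  shows "(amplitude N d p st a)\<^sup>2 =
    (if i \<in> {1..d} \<and> x \<in> window N st then p i / (g x * real (N + 1)) else 0)"
proof -
  have "(sqrt (p i))\<^sup>2 = p i" if "i \<in> {1..d}" using assms(3)[OF that] by simp
  then show ?thesis
    using amplitude_on_blk[OF assms(1,2), of d p]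
    by (simp add: power_divide power_mult_distrib del: of_nat_add)
qed

lemma sum_row:
  assumes "i \<in> {1..D}"
  shows "(\<Sum>a\<in>{a\<in>I. fst a = i}. f a) = (\<Sum>x=0..n. \<Sum>a\<in>blk u n i x. f a)"
proof -
  have "(\<Sum>a\<in>{a\<in>I. fst a = i}. f a) = (\<Sum>a\<in>I. if fst a = i then f a else 0)"
    by (simp add: sum.inter_filter finite_step_basis)
  also have "\<dots> = (\<Sum>j=1..D. \<Sum>x=0..n. \<Sum>a\<in>blk u n j x. if fst a = i then f a else 0)"
    by (rule sum_step_basis)
  also have "\<dots> = (\<Sum>j=1..D. if j = i then (\<Sum>x=0..n. \<Sum>a\<in>blk u n i x. f a) else 0)"
    by (intro sum.cong refl) (auto simp: blk_def intro!: sum.cong sum.neutral)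
  finally show ?thesis using assms by simp
qed

lemma card_window: "card (window N st) = N + 1"
  by (simp add: window_def)

lemma finite_window: "finite (window N st)"
  by (simp add: window_def)

lemma sum_row_amplitude_sq:
  assumes "i \<in> {1..d}" "d \<le> D" "\<And>i. i \<in> {1..d} \<Longrightarrow> 0 < p i"
  shows "(\<Sum>a\<in>{a\<in>I. fst a = i}. (amplitude N d p st a)\<^sup>2) = p i"
proof -
  have "(\<Sum>a\<in>{a\<in>I. fst a = i}. (amplitude N d p st a)\<^sup>2) =
      (\<Sum>x=0..n. \<Sum>a\<in>blk u n i x. (amplitude N d p st a)\<^sup>2)"
    using assms by (intro sum_row) auto
  also have "\<dots> = (\<Sum>x=0..n. if x \<in> window N st then p i / real (N + 1) else 0)"
  proof (intro sum.cong refl)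
    fix x assume x: "x \<in> {0..n}"
    have "(\<Sum>a\<in>blk u n i x. (amplitude N d p st a)\<^sup>2) =
        (\<Sum>a\<in>blk u n i x. if x \<in> window N st then p i / (g x * real (N + 1)) else 0)"
      using x assms by (intro sum.cong refl) (subst amplitude_sq_on_blk, auto)
    then show "(\<Sum>a\<in>blk u n i x. (amplitude N d p st a)\<^sup>2) =
        (if x \<in> window N st then p i / real (N + 1) else 0)"
      using x g_pos[of x] by (simp add: card_blk)
  qed
  also have "\<dots> = (\<Sum>x\<in>window N st. p i / real (N + 1))"
    using window_subset by (subst sum.inter_restrict[symmetric]) (auto simp: Int_absorb1)
  also have "\<dots> = p i" by (simp add: card_window)
  finally show ?thesis .
qed

lemma sum_amplitude_sq:
  assumes "d \<le> D" "\<And>i. i \<in> {1..d} \<Longrightarrow> 0 < p i" "(\<Sum>i=1..d. p i) = 1"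
  shows "(\<Sum>a\<in>I. (amplitude N d p st a)\<^sup>2) = 1"
proof -
  have "(\<Sum>a\<in>I. (amplitude N d p st a)\<^sup>2) =
      (\<Sum>i=1..D. \<Sum>a\<in>{a\<in>I. fst a = i}. (amplitude N d p st a)\<^sup>2)"
    by (simp add: sum_step_basis sum_row)
  also have "\<dots> = (\<Sum>i=1..d. \<Sum>a\<in>{a\<in>I. fst a = i}. (amplitude N d p st a)\<^sup>2)"
    using assms(1) by (intro sum.mono_neutral_right) (auto simp: amplitude_def)
  also have "\<dots> = (\<Sum>i=1..d. p i)"
    using assms by (intro sum.cong refl sum_row_amplitude_sq) auto
  also have "\<dots> = 1" by (rule assms)
  finally show ?thesis .
qed

lemma sum_fluct:
  assumes "i \<in> {1..D}" "j \<in> {1..D}"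
  shows "(\<Sum>k\<in>{k. \<bar>k\<bar> \<le> Kmax w_max u}. fluct D N st i k j * f k) =
    1 / real (N + 1) * (\<Sum>y\<in>window N st. \<Sum>x\<in>near w_max st y. mass st i x j y / g y * f (int y - int x))"
proof -
  have "(\<Sum>k\<in>{k. \<bar>k\<bar> \<le> Kmax w_max u}. fluct D N st i k j * f k) =
    1 / real (N + 1) * (\<Sum>y\<in>window N st. \<Sum>k\<in>{k. \<bar>k\<bar> \<le> Kmax w_max u}.
      if 0 \<le> int y - k \<and> int y - k \<le> int n then mass st i (nat (int y - k)) j y / g y * f k else 0)"
    unfolding fluct_eq[OF assms] sum_distrib_left sum_distrib_right
    by (subst sum.swap) (intro sum.cong refl, simp)
  also have "\<dots> = 1 / real (N + 1) * (\<Sum>y\<in>window N st. \<Sum>x\<in>near w_max st y. mass st i x j y / g y * f (int y - int x))"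
    by (intro arg_cong[where f = "(*) _"] sum.cong refl sum_shift_near)
  finally show ?thesis .
qed

text \<open>Extending both sums to all blocks gives the whole flow into the block (j, y), and
  bistochasticity makes that its size.\<close>

lemma sum_mass_to_le:
  assumes "d \<le> D" "j \<in> {1..D}" "X \<subseteq> {0..n}" "y \<le> n"
  shows "(\<Sum>i=1..d. \<Sum>x\<in>X. mass st i x j y) \<le> g y"
proof -
  have "(\<Sum>i=1..d. \<Sum>x\<in>X. mass st i x j y) \<le> (\<Sum>i=1..D. \<Sum>x=0..n. mass st i x j y)"
  proof -
    have "(\<Sum>i=1..d. \<Sum>x\<in>X. mass st i x j y) \<le> (\<Sum>i=1..d. \<Sum>x=0..n. mass st i x j y)"
      by (rule sum_mono, rule sum_mono2) (use assms in \<open>auto simp: mass_nonneg\<close>)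
    also have "\<dots> \<le> (\<Sum>i=1..D. \<Sum>x=0..n. mass st i x j y)"
      by (rule sum_mono2) (use assms in \<open>auto simp: mass_nonneg intro!: sum_nonneg\<close>)
    finally show ?thesis .
  qed
  also have "\<dots> = flow st I (blk u n j y)"
    unfolding flow_def sum_step_basis mass_def by simp
  also have "\<dots> = g y"
    using assms by (simp add: flow_UNIV_left blk_subset card_blk)
  finally show ?thesis .
qed

lemma sum_mass_from_le:
  assumes "d' \<le> D" "i \<in> {1..D}" "Y \<subseteq> {0..n}" "x \<le> n"
  shows "(\<Sum>j=1..d'. \<Sum>y\<in>Y. mass st i x j y) \<le> g x"
proof -
  have "(\<Sum>j=1..d'. \<Sum>y\<in>Y. mass st i x j y) \<le> (\<Sum>j=1..D. \<Sum>y=0..n. mass st i x j y)"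
  proof -
    have "(\<Sum>j=1..d'. \<Sum>y\<in>Y. mass st i x j y) \<le> (\<Sum>j=1..d'. \<Sum>y=0..n. mass st i x j y)"
      by (rule sum_mono, rule sum_mono2) (use assms in \<open>auto simp: mass_nonneg\<close>)
    also have "\<dots> \<le> (\<Sum>j=1..D. \<Sum>y=0..n. mass st i x j y)"
      by (rule sum_mono2) (use assms in \<open>auto simp: mass_nonneg intro!: sum_nonneg\<close>)
    finally show ?thesis .
  qed
  also have "\<dots> = flow st (blk u n i x) I"
    unfolding flow_def sum_step_basis mass_def by (rule sum_swap3[symmetric])
  also have "\<dots> = g x"
    using assms by (simp add: flow_UNIV_right blk_subset card_blk)
  finally show ?thesis .
qed

lemma near_subset: "near w_max st y \<subseteq> {0..n}"
  by (auto simp: near_def)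

text \<open>The final far weight is precisely the total defect, over all j, in the normalization of
  the fluctuation distribution. Its decay therefore says that no probability is lost in the
  limit.\<close>

lemma far_weight_final_eq_fluct:
  assumes "d \<le> D" "d' \<le> D"
  shows "far_weight_final w_max D d d' N st = complex_of_real (\<Sum>j=1..d'.
    1 - (\<Sum>i=1..d. \<Sum>k\<in>{k. \<bar>k\<bar> \<le> Kmax w_max u}. fluct D N st i k j))"
proof -
  have "(\<Sum>i=1..d. \<Sum>k\<in>{k. \<bar>k\<bar> \<le> Kmax w_max u}. fluct D N st i k j) =
      1 / real (N + 1) * (\<Sum>y\<in>window N st. \<Sum>i=1..d. \<Sum>x\<in>near w_max st y. mass st i x j y / g y)"
    if "j \<in> {1..d'}" for j
  proof -
    have "(\<Sum>i=1..d. \<Sum>k\<in>{k. \<bar>k\<bar> \<le> Kmax w_max u}. fluct D N st i k j) =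
      (\<Sum>i=1..d. 1 / real (N + 1) * (\<Sum>y\<in>window N st. \<Sum>x\<in>near w_max st y. mass st i x j y / g y))"
      using assms that by (intro sum.cong refl) (subst sum_fluct[where f = "\<lambda>_. 1", simplified], auto)
    then show ?thesis by (simp only: sum_distrib_left[symmetric] sum.swap[of _ "window N st"])
  qed
  then have "(\<Sum>j=1..d'. 1 - (\<Sum>i=1..d. \<Sum>k\<in>{k. \<bar>k\<bar> \<le> Kmax w_max u}. fluct D N st i k j)) =
    (\<Sum>j=1..d'. 1 / real (N + 1) * (\<Sum>y\<in>window N st. 1 - (\<Sum>i=1..d. \<Sum>x\<in>near w_max st y. mass st i x j y / g y)))"
    by (intro sum.cong refl) (simp add: sum_subtractf card_window diff_divide_distrib)
  then show ?thesis
    unfolding far_weight_final_eq[OF assms]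
    by (simp only: sum_distrib_left[symmetric] sum.swap[of _ "window N st"])
qed

lemma sum_fluct_le_1:
  assumes "d \<le> D" "j \<in> {1..D}"
  shows "(\<Sum>i=1..d. \<Sum>k\<in>{k. \<bar>k\<bar> \<le> Kmax w_max u}. fluct D N st i k j) \<le> 1"
proof -
  have "(\<Sum>i=1..d. \<Sum>k\<in>{k. \<bar>k\<bar> \<le> Kmax w_max u}. fluct D N st i k j) =
      (\<Sum>i=1..d. 1 / real (N + 1) * (\<Sum>y\<in>window N st. \<Sum>x\<in>near w_max st y. mass st i x j y / g y))"
    using assms by (intro sum.cong refl) (subst sum_fluct[where f = "\<lambda>_. 1", simplified], auto)
  also have "\<dots> = 1 / real (N + 1) * (\<Sum>y\<in>window N st. (\<Sum>i=1..d. \<Sum>x\<in>near w_max st y. mass st i x j y) / g y)"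
    by (simp only: sum_distrib_left[symmetric] sum.swap[of _ _ "window N st"] sum_divide_distrib)
  also have "\<dots> \<le> 1 / real (N + 1) * (\<Sum>y\<in>window N st. 1)"
  proof (intro mult_left_mono sum_mono)
    fix y assume "y \<in> window N st"
    then show "(\<Sum>i=1..d. \<Sum>x\<in>near w_max st y. mass st i x j y) / g y \<le> 1"
      using sum_mass_to_le[OF assms near_subset window_le, of y w_max] g_pos[of y] by simp
  qed simp
  also have "\<dots> = 1" by (simp add: card_window)
  finally show ?thesis .
qed

text \<open>The factor \<open>2 powr w\<close> is the ratio of the final block size to the initial
  one, so it exchanges normalization by final blocks for normalization by initial blocks. Each
  initial level then contributes at most 1, its block having total outflow equal to its size, and at
  most \<open>N + 1 + 2 * K\<close> levels lie within K of the window.\<close>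

lemma sum_fluct_weighted_le:
  assumes "d' \<le> D" "i \<in> {1..D}" "0 < w_max"
  shows "(\<Sum>j=1..d'. \<Sum>k\<in>{k. \<bar>k\<bar> \<le> Kmax w_max u}. fluct D N st i k j * 2 powr (k * delta_w u)) \<le>
    (real N + 1 + 2 * Kmax w_max u) / (real N + 1)"
proof -
  define K where "K = Kmax w_max u"
  have K: "0 \<le> K" unfolding K_def by (rule Kmax_nonneg[OF assms(3) u_ge_2])
  \<comment> \<open>The initial levels from which the window can be reached by a permitted shift.
    They may protrude by K on either side of it, which is the only excess over 1.\<close>
  define X where "X = {x\<in>{0..n}. \<exists>y\<in>window N st. \<bar>int x - int y\<bar> \<le> K}"
  have "(\<Sum>j=1..d'. \<Sum>k\<in>{k. \<bar>k\<bar> \<le> Kmax w_max u}. fluct D N st i k j * 2 powr (k * delta_w u)) =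
      (\<Sum>j=1..d'. 1 / real (N + 1) * (\<Sum>y\<in>window N st. \<Sum>x\<in>near w_max st y. mass st i x j y / g x))"
  proof (intro sum.cong refl)
    fix j assume "j \<in> {1..d'}"
    then have j: "j \<in> {1..D}" using assms by auto
    show "(\<Sum>k\<in>{k. \<bar>k\<bar> \<le> Kmax w_max u}. fluct D N st i k j * 2 powr (k * delta_w u)) =
      1 / real (N + 1) * (\<Sum>y\<in>window N st. \<Sum>x\<in>near w_max st y. mass st i x j y / g x)"
      unfolding sum_fluct[OF assms(2) j, where f = "\<lambda>k. 2 powr (real_of_int k * delta_w u)"]
    proof (intro arg_cong[where f = "(*) _"] sum.cong refl)
      fix y x assume "y \<in> window N st" "x \<in> near w_max st y"
      then have "g y = g x * 2 powr ((real y - real x) * delta_w u)"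
        by (intro bsize_shift u_ge_2 window_le near_le)
      then show "mass st i x j y / g y * 2 powr (real_of_int (int y - int x) * delta_w u) = mass st i x j y / g x"
        by simp
    qed
  qed
  also have "\<dots> = 1 / real (N + 1) * (\<Sum>j=1..d'. \<Sum>y\<in>window N st. \<Sum>x\<in>near w_max st y. mass st i x j y / g x)"
    by (simp only: sum_distrib_left)
  finally have eq: "(\<Sum>j=1..d'. \<Sum>k\<in>{k. \<bar>k\<bar> \<le> Kmax w_max u}. fluct D N st i k j * 2 powr (k * delta_w u)) =
    1 / real (N + 1) * (\<Sum>j=1..d'. \<Sum>y\<in>window N st. \<Sum>x\<in>near w_max st y. mass st i x j y / g x)" .
  have "(\<Sum>j=1..d'. \<Sum>y\<in>window N st. \<Sum>x\<in>near w_max st y. mass st i x j y / g x) =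
      (\<Sum>j=1..d'. \<Sum>y\<in>window N st. \<Sum>x\<in>X. if x \<in> near w_max st y then mass st i x j y / g x else 0)"
  proof (rule sum.cong[OF refl], rule sum.cong[OF refl])
    fix j y assume "y \<in> window N st"
    then have "near w_max st y = X \<inter> near w_max st y"
      by (auto simp: X_def K_def near_def)
    moreover have "finite X" by (simp add: X_def)
    ultimately show "(\<Sum>x\<in>near w_max st y. mass st i x j y / g x) =
        (\<Sum>x\<in>X. if x \<in> near w_max st y then mass st i x j y / g x else 0)"
      by (simp add: sum.inter_restrict[symmetric])
  qed
  also have "\<dots> = (\<Sum>x\<in>X. \<Sum>j=1..d'. \<Sum>y\<in>window N st. if x \<in> near w_max st y then mass st i x j y / g x else 0)"
    by (rule sum_swap3[symmetric])
  also have "\<dots> \<le> (\<Sum>x\<in>X. 1)"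
  proof (rule sum_mono)
    fix x assume "x \<in> X"
    then have x: "x \<le> n" by (simp add: X_def)
    have "(\<Sum>j=1..d'. \<Sum>y\<in>window N st. if x \<in> near w_max st y then mass st i x j y / g x else 0) \<le>
        (\<Sum>j=1..d'. \<Sum>y\<in>window N st. mass st i x j y / g x)"
      using g_pos[of x] by (intro sum_mono) (auto intro!: divide_nonneg_nonneg mass_nonneg)
    also have "\<dots> = (\<Sum>j=1..d'. \<Sum>y\<in>window N st. mass st i x j y) / g x"
      by (simp only: sum_divide_distrib)
    also have "\<dots> \<le> 1"
      using sum_mass_from_le[OF assms(1,2) window_subset x] g_pos[of x] by simp
    finally show "(\<Sum>j=1..d'. \<Sum>y\<in>window N st. if x \<in> near w_max st y then mass st i x j y / g x else 0) \<le> 1" .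
  qed
  also have "\<dots> = real (card X)" by simp
  also have "card X = card (int ` X)" by (simp add: card_image)
  also have "real (card (int ` X)) \<le> real (card {int (win_start st) - K..int (win_start st + N) + K})"
    by (intro of_nat_mono card_mono) (auto simp: X_def window_def)
  also have "real (card {int (win_start st) - K..int (win_start st + N) + K}) = real N + 1 + 2 * K"
    using K by simp
  finally show ?thesis
    unfolding eq by (simp add: K_def divide_right_mono add.commute)
qed

end

text \<open>Closeness of amplitudes in Euclidean norm gives closeness of probabilities in l1 norm:
  factor the difference of squares, apply Cauchy-Schwarz, and bound the norm of \<open>c + t\<close>
  by 2.\<close>

lemma sum_abs_square_diff_le:
  fixes c t :: "'a \<Rightarrow> real"
  assumes "(\<Sum>a\<in>A. (c a)\<^sup>2) = 1" "(\<Sum>a\<in>A. (t a)\<^sup>2) = 1"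
  shows "(\<Sum>a\<in>A. \<bar>(c a)\<^sup>2 - (t a)\<^sup>2\<bar>) \<le> 2 * sqrt (\<Sum>a\<in>A. (c a - t a)\<^sup>2)"
proof -
  have "(\<Sum>a\<in>A. (c a + t a)\<^sup>2) \<le> (\<Sum>a\<in>A. 2 * (c a)\<^sup>2 + 2 * (t a)\<^sup>2)"
  proof (rule sum_mono)
    fix a
    have "0 \<le> (c a - t a)\<^sup>2" by simp
    then show "(c a + t a)\<^sup>2 \<le> 2 * (c a)\<^sup>2 + 2 * (t a)\<^sup>2"
      by (simp add: power2_eq_square algebra_simps)
  qed
  also have "\<dots> = 2\<^sup>2"
    using assms by (simp add: sum.distrib sum_distrib_left[symmetric])
  finally have s: "(\<Sum>a\<in>A. (c a + t a)\<^sup>2) \<le> 2\<^sup>2" .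
  have "(\<Sum>a\<in>A. \<bar>(c a)\<^sup>2 - (t a)\<^sup>2\<bar>) = (\<Sum>a\<in>A. \<bar>c a - t a\<bar> * \<bar>c a + t a\<bar>)"
    by (intro sum.cong refl) (simp add: power2_eq_square abs_mult[symmetric] algebra_simps)
  also have "\<dots> \<le> sqrt ((\<Sum>a\<in>A. (c a - t a)\<^sup>2) * (\<Sum>a\<in>A. (c a + t a)\<^sup>2))"
    using Cauchy_Schwarz_ineq_sum[of "\<lambda>a. \<bar>c a - t a\<bar>" "\<lambda>a. \<bar>c a + t a\<bar>" A]
    by (intro real_le_rsqrt) simp
  also have "\<dots> \<le> sqrt ((\<Sum>a\<in>A. (c a - t a)\<^sup>2) * 2\<^sup>2)"
    using s by (intro real_sqrt_le_mono mult_left_mono) (auto intro: sum_nonneg)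
  also have "\<dots> = 2 * sqrt (\<Sum>a\<in>A. (c a - t a)\<^sup>2)"
    by (simp only: real_sqrt_mult real_sqrt_abs)
  finally show ?thesis .
qed

section \<open>Marginal distribution of the initial Schmidt index\<close>

context bistochastic_step
begin

text \<open>The right-hand side is the probability of the index i after the ideal final distribution
  has been pulled back through \<open>jump\<close>. The fluctuations count only jumps of at most K
  levels, hence an inequality.\<close>

lemma sum_fluct_marginal_le:
  assumes d: "d' \<le> D" "i \<in> {1..D}" and q: "\<And>j. j \<in> {1..d'} \<Longrightarrow> 0 < q j"
  shows "(\<Sum>j=1..d'. q j * (\<Sum>k\<in>{k. \<bar>k\<bar> \<le> Kmax w_max u}. fluct D N st i k j)) \<le>
    (\<Sum>a\<in>{a\<in>I. fst a = i}. \<Sum>b\<in>I. (amplitude N d' q st b)\<^sup>2 * jump st b a)"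
proof -
  have blk_sum: "(\<Sum>b\<in>blk u n j y. (amplitude N d' q st b)\<^sup>2 * (\<Sum>a\<in>{a\<in>I. fst a = i}. jump st b a)) =
      (if j \<in> {1..d'} \<and> y \<in> window N st then q j / real (N + 1) * (\<Sum>x=0..n. mass st i x j y / g y) else 0)"
    if "y \<le> n" for j y
  proof -
    have "(\<Sum>b\<in>blk u n j y. (amplitude N d' q st b)\<^sup>2 * (\<Sum>a\<in>{a\<in>I. fst a = i}. jump st b a)) =
       (if j \<in> {1..d'} \<and> y \<in> window N st then q j / (g y * real (N + 1)) else 0) *
       (\<Sum>b\<in>blk u n j y. \<Sum>a\<in>{a\<in>I. fst a = i}. jump st b a)"
      unfolding sum_distrib_left[of _ _ "blk u n j y"]
    proof (intro sum.cong refl)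
      fix b assume b: "b \<in> blk u n j y"
      show "(amplitude N d' q st b)\<^sup>2 * (\<Sum>a\<in>{a\<in>I. fst a = i}. jump st b a) =
          (if j \<in> {1..d'} \<and> y \<in> window N st then q j / (g y * real (N + 1)) else 0) *
          (\<Sum>a\<in>{a\<in>I. fst a = i}. jump st b a)"
        by (simp only: amplitude_sq_on_blk[OF b that q])
    qed
    also have "(\<Sum>b\<in>blk u n j y. \<Sum>a\<in>{a\<in>I. fst a = i}. jump st b a) = (\<Sum>x=0..n. mass st i x j y)"
      unfolding mass_def flow_def
      by (subst sum.swap) (rule sum_row[OF d(2)])
    finally show ?thesis by (simp add: sum_divide_distrib sum_distrib_left mult_ac)
  qed
  have "(\<Sum>j=1..d'. q j * (\<Sum>k\<in>{k. \<bar>k\<bar> \<le> Kmax w_max u}. fluct D N st i k j)) =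
     (\<Sum>j=1..d'. \<Sum>y\<in>window N st. q j / real (N + 1) * (\<Sum>x\<in>near w_max st y. mass st i x j y / g y))"
  proof (intro sum.cong refl)
    fix j assume "j \<in> {1..d'}"
    then have "j \<in> {1..D}" using d by auto
    then show "q j * (\<Sum>k\<in>{k. \<bar>k\<bar> \<le> Kmax w_max u}. fluct D N st i k j) =
        (\<Sum>y\<in>window N st. q j / real (N + 1) * (\<Sum>x\<in>near w_max st y. mass st i x j y / g y))"
      using sum_fluct[OF d(2), where j = j and f = "\<lambda>_. 1" and w_max = w_max] by (simp add: sum_distrib_left)
  qed
  also have "\<dots> \<le> (\<Sum>j=1..d'. \<Sum>y\<in>window N st. q j / real (N + 1) * (\<Sum>x=0..n. mass st i x j y / g y))"
  proof (intro sum_mono mult_left_mono sum_mono2 near_subset)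
    fix j assume "j \<in> {1..d'}"
    then show "0 \<le> q j / real (N + 1)" using q[of j] by simp
  qed (auto intro!: divide_nonneg_nonneg mass_nonneg)
  also have "\<dots> = (\<Sum>j=1..d'. \<Sum>y=0..n. \<Sum>b\<in>blk u n j y.
      (amplitude N d' q st b)\<^sup>2 * (\<Sum>a\<in>{a\<in>I. fst a = i}. jump st b a))"
  proof (intro sum.cong[OF refl])
    fix j assume j: "j \<in> {1..d'}"
    have "(\<Sum>y\<in>window N st. q j / real (N + 1) * (\<Sum>x=0..n. mass st i x j y / g y)) =
        (\<Sum>y=0..n. if y \<in> window N st then q j / real (N + 1) * (\<Sum>x=0..n. mass st i x j y / g y) else 0)"
      using window_subset by (subst sum.inter_restrict[symmetric]) (auto simp: Int_absorb1)
    also have "\<dots> = (\<Sum>y=0..n. \<Sum>b\<in>blk u n j y.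
      (amplitude N d' q st b)\<^sup>2 * (\<Sum>a\<in>{a\<in>I. fst a = i}. jump st b a))"
      using j by (intro sum.cong refl) (simp add: blk_sum)
    finally show "(\<Sum>y\<in>window N st. q j / real (N + 1) * (\<Sum>x=0..n. mass st i x j y / g y)) =
      (\<Sum>y=0..n. \<Sum>b\<in>blk u n j y. (amplitude N d' q st b)\<^sup>2 * (\<Sum>a\<in>{a\<in>I. fst a = i}. jump st b a))" .
  qed
  also have "\<dots> \<le> (\<Sum>j=1..D. \<Sum>y=0..n. \<Sum>b\<in>blk u n j y.
      (amplitude N d' q st b)\<^sup>2 * (\<Sum>a\<in>{a\<in>I. fst a = i}. jump st b a))"
    by (rule sum_mono2) (use d in \<open>auto intro!: sum_nonneg mult_nonneg_nonneg jump_nonneg\<close>)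
  also have "\<dots> = (\<Sum>b\<in>I. (amplitude N d' q st b)\<^sup>2 * (\<Sum>a\<in>{a\<in>I. fst a = i}. jump st b a))"
    by (rule sum_step_basis[symmetric])
  also have "\<dots> = (\<Sum>a\<in>{a\<in>I. fst a = i}. \<Sum>b\<in>I. (amplitude N d' q st b)\<^sup>2 * jump st b a)"
    unfolding sum_distrib_left by (rule sum.swap)
  finally show ?thesis .
qed

end

text \<open>Replacing the ideal final distribution by the actual one costs an l1 error that
  \<open>jump\<close> does not increase; the balance then gives the actual initial distribution, and
  a second l1 error leads to the ideal one, whose marginal is \<open>p i\<close>.\<close>

lemma valid_step_marginal_le:
  assumes valid: "valid_step D N st" and d: "d \<le> D" "d' \<le> D" "i \<in> {1..d}"
    and p: "\<And>i. i \<in> {1..d} \<Longrightarrow> 0 < p i" "(\<Sum>i=1..d. p i) = 1"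
    and q: "\<And>j. j \<in> {1..d'} \<Longrightarrow> 0 < q j" "(\<Sum>j=1..d'. q j) = 1"
  shows "(\<Sum>j=1..d'. q j * (\<Sum>k\<in>{k. \<bar>k\<bar> \<le> Kmax w_max (bat_u st)}. fluct D N st i k j)) \<le> p i +
    2 * vnorm (step_basis D st \<times> step_basis D st)
         (\<lambda>z. init_state st z - bip_tensor (schmidt_state d p) (battery_state N st) z) +
    2 * vnorm (step_basis D st \<times> step_basis D st)
         (\<lambda>z. fin_state st z - bip_tensor (schmidt_state d' q) (battery_state N st) z)"
proof -
  interpret bistochastic_step D N st
    by (rule valid_step_majorization(1)[OF valid])
  obtain c c' where init: "\<And>a b. a \<in> step_basis D st \<Longrightarrow> b \<in> step_basis D st \<Longrightarrow>
       init_state st (a, b) = (if a = b then complex_of_real (c a) else 0)"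
    and fin: "\<And>a b. a \<in> step_basis D st \<Longrightarrow> b \<in> step_basis D st \<Longrightarrow>
       fin_state st (a, b) = (if a = b then complex_of_real (c' a) else 0)"
    and norm: "(\<Sum>a\<in>step_basis D st. (c a)\<^sup>2) = 1" "(\<Sum>a\<in>step_basis D st. (c' a)\<^sup>2) = 1"
    and bal: "\<And>a. a \<in> step_basis D st \<Longrightarrow> (c a)\<^sup>2 = (\<Sum>b\<in>step_basis D st. (c' b)\<^sup>2 * jump st b a)"
    using valid_step_majorization(2)[OF valid] by blast
  let ?t = "amplitude N d p st" and ?t' = "amplitude N d' q st"
  let ?row = "{a\<in>I. fst a = i}"
  have vn: "vnorm (I \<times> I) (\<lambda>z. init_state st z - bip_tensor (schmidt_state d p) (battery_state N st) z) =
      sqrt (\<Sum>a\<in>I. (c a - ?t a)\<^sup>2)"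
    by (rule vnorm_diagonal[OF finite_step_basis]) (simp add: init bip_tensor_schmidt_battery)
  have vn': "vnorm (I \<times> I) (\<lambda>z. fin_state st z - bip_tensor (schmidt_state d' q) (battery_state N st) z) =
      sqrt (\<Sum>a\<in>I. (c' a - ?t' a)\<^sup>2)"
    by (rule vnorm_diagonal[OF finite_step_basis]) (simp add: fin bip_tensor_schmidt_battery)
  have "(\<Sum>a\<in>?row. \<Sum>b\<in>I. (?t' b)\<^sup>2 * jump st b a) \<le>
      (\<Sum>a\<in>?row. (c a)\<^sup>2 + (\<Sum>b\<in>I. \<bar>(c' b)\<^sup>2 - (?t' b)\<^sup>2\<bar> * jump st b a))"
  proof (rule sum_mono)
    fix a assume "a \<in> ?row"
    then have "(c a)\<^sup>2 + (\<Sum>b\<in>I. \<bar>(c' b)\<^sup>2 - (?t' b)\<^sup>2\<bar> * jump st b a) =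
        (\<Sum>b\<in>I. ((c' b)\<^sup>2 + \<bar>(c' b)\<^sup>2 - (?t' b)\<^sup>2\<bar>) * jump st b a)"
      using bal by (simp add: distrib_right sum.distrib)
    also have "\<dots> \<ge> (\<Sum>b\<in>I. (?t' b)\<^sup>2 * jump st b a)"
      by (intro sum_mono mult_right_mono jump_nonneg) linarith
    finally show "(\<Sum>b\<in>I. (?t' b)\<^sup>2 * jump st b a) \<le>
        (c a)\<^sup>2 + (\<Sum>b\<in>I. \<bar>(c' b)\<^sup>2 - (?t' b)\<^sup>2\<bar> * jump st b a)" by simp
  qed
  also have "\<dots> = (\<Sum>a\<in>?row. (c a)\<^sup>2) + (\<Sum>a\<in>?row. \<Sum>b\<in>I. \<bar>(c' b)\<^sup>2 - (?t' b)\<^sup>2\<bar> * jump st b a)"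
    by (rule sum.distrib)
  also have "(\<Sum>a\<in>?row. \<Sum>b\<in>I. \<bar>(c' b)\<^sup>2 - (?t' b)\<^sup>2\<bar> * jump st b a) \<le>
      (\<Sum>a\<in>I. \<Sum>b\<in>I. \<bar>(c' b)\<^sup>2 - (?t' b)\<^sup>2\<bar> * jump st b a)"
    by (rule sum_mono2) (auto simp: finite_step_basis intro!: sum_nonneg mult_nonneg_nonneg jump_nonneg)
  also have "\<dots> = (\<Sum>b\<in>I. \<bar>(c' b)\<^sup>2 - (?t' b)\<^sup>2\<bar> * (\<Sum>a\<in>I. jump st b a))"
    unfolding sum_distrib_left by (rule sum.swap)
  also have "\<dots> = (\<Sum>b\<in>I. \<bar>(c' b)\<^sup>2 - (?t' b)\<^sup>2\<bar>)"
    by (simp add: jump_to)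
  also have "\<dots> \<le> 2 * sqrt (\<Sum>a\<in>I. (c' a - ?t' a)\<^sup>2)"
    by (rule sum_abs_square_diff_le[OF norm(2) sum_amplitude_sq[OF d(2) q]])
  also have "(\<Sum>a\<in>?row. (c a)\<^sup>2) \<le> (\<Sum>a\<in>?row. (?t a)\<^sup>2 + \<bar>(c a)\<^sup>2 - (?t a)\<^sup>2\<bar>)"
    by (intro sum_mono) linarith
  also have "\<dots> = p i + (\<Sum>a\<in>?row. \<bar>(c a)\<^sup>2 - (?t a)\<^sup>2\<bar>)"
    using sum_row_amplitude_sq[OF d(3,1) p(1)] by (simp add: sum.distrib)
  also have "(\<Sum>a\<in>?row. \<bar>(c a)\<^sup>2 - (?t a)\<^sup>2\<bar>) \<le> (\<Sum>a\<in>I. \<bar>(c a)\<^sup>2 - (?t a)\<^sup>2\<bar>)"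
    by (rule sum_mono2) (auto simp: finite_step_basis)
  also have "\<dots> \<le> 2 * sqrt (\<Sum>a\<in>I. (c a - ?t a)\<^sup>2)"
    by (rule sum_abs_square_diff_le[OF norm(1) sum_amplitude_sq[OF d(1) p]])
  finally have "(\<Sum>a\<in>?row. \<Sum>b\<in>I. (?t' b)\<^sup>2 * jump st b a) \<le>
      p i + 2 * sqrt (\<Sum>a\<in>I. (c a - ?t a)\<^sup>2) + 2 * sqrt (\<Sum>a\<in>I. (c' a - ?t' a)\<^sup>2)"
    by simp
  moreover have "i \<in> {1..D}" using d by auto
  ultimately show ?thesis
    unfolding vn vn' using sum_fluct_marginal_le[where i = i and w_max = w_max and q = q, OF d(2) _ q(1)] by linarith
qed

text \<open>The reduced state is diagonal with eigenvalues \<open>p i\<close> padded by zeros up to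
  D; the padding contributes nothing because \<open>0 * log 2 0 = 0\<close>.\<close>

lemma vn_entropy_schmidt:
  assumes "d \<le> D" "\<And>i. i \<in> {1..d} \<Longrightarrow> 0 < p i"
  shows "vn_entropy {1..D} (tr_B {1..D} (ketbra (schmidt_state d p) (schmidt_state d p))) =
    - (\<Sum>i=1..d. p i * log 2 (p i))"
proof -
  let ?r = "\<lambda>i. if i \<in> {1..d} then p i else 0"
  have "op_eq {1..D} (tr_B {1..D} (ketbra (schmidt_state d p) (schmidt_state d p))) (diag_op ?r)"
    unfolding op_eq_def
  proof (intro ballI)
    fix a b assume ab: "a \<in> {1..D}" "b \<in> {1..D}"
    have "tr_B {1..D} (ketbra (schmidt_state d p) (schmidt_state d p)) a b =
        (\<Sum>e=1..D. if e = a then diag_op ?r a b else 0)"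
      unfolding tr_B_def
    proof (intro sum.cong refl)
      fix e
      have "complex_of_real (sqrt (p i)) * complex_of_real (sqrt (p i)) = complex_of_real (p i)"
        if "i \<in> {1..d}" for i
        using assms(2)[OF that] by (simp add: of_real_mult[symmetric] del: of_real_mult)
      then show "ketbra (schmidt_state d p) (schmidt_state d p) (a, e) (b, e) =
          (if e = a then diag_op ?r a b else 0)"
        by (auto simp: ketbra_def schmidt_state_eq diag_op_def)
    qed
    then show "tr_B {1..D} (ketbra (schmidt_state d p) (schmidt_state d p)) a b = diag_op ?r a b"
      using ab by simp
  qed
  then have "vn_entropy {1..D} (tr_B {1..D} (ketbra (schmidt_state d p) (schmidt_state d p))) =
      - (\<Sum>i=1..D. ?r i * log 2 (?r i))"
    by (intro vn_entropy_diag) auto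
  also have "(\<Sum>i=1..D. ?r i * log 2 (?r i)) = (\<Sum>i=1..d. ?r i * log 2 (?r i))"
    using assms(1) by (intro sum.mono_neutral_right) auto
  also have "\<dots> = (\<Sum>i=1..d. p i * log 2 (p i))"
    by (intro sum.cong) auto
  finally show ?thesis .
qed

text \<open>
  Positivity of the relative entropy of \<open>P(i,w|j) q\<^sub>j\<close> with respect to \<open>P(i,w|j) 2\<^sup>w p\<^sub>i\<close>.
\<close>

lemma average_fluctuation_le:
  fixes P :: "nat \<Rightarrow> real \<Rightarrow> nat \<Rightarrow> real" and S :: "nat \<Rightarrow> nat \<Rightarrow> real set"
  assumes nonneg: "\<And>i w j. i \<in> A \<Longrightarrow> j \<in> B \<Longrightarrow> 0 \<le> P i w j"
    and p: "\<And>i. i \<in> A \<Longrightarrow> 0 < p i" "(\<Sum>i\<in>A. p i) = 1"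
    and q: "\<And>j. j \<in> B \<Longrightarrow> 0 < q j" "(\<Sum>j\<in>B. q j) = 1"
    and norm: "\<And>j. j \<in> B \<Longrightarrow> (\<Sum>i\<in>A. \<Sum>w\<in>S i j. P i w j) = 1"
    and weighted: "\<And>i. i \<in> A \<Longrightarrow> (\<Sum>j\<in>B. \<Sum>w\<in>S i j. P i w j * 2 powr w) \<le> 1"
    and marginal: "\<And>i. i \<in> A \<Longrightarrow> (\<Sum>j\<in>B. q j * (\<Sum>w\<in>S i j. P i w j)) = p i"
  shows "(\<Sum>i\<in>A. \<Sum>j\<in>B. \<Sum>w\<in>S i j. P i w j * q j * w) \<le>
    (\<Sum>j\<in>B. q j * log 2 (q j)) - (\<Sum>i\<in>A. p i * log 2 (p i))"
proof -
  \<comment> \<open>Pointwise form of the relative entropy inequality: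
    \<open>ln t \<le> t - 1\<close> at the likelihood ratio \<open>t = 2 powr w * p i / q j\<close>,
    weighted by \<open>P i w j * q j\<close>. Zero values of P cause no trouble since P cancels from
    the ratio.\<close>
  have pt: "P i w j * q j * (w + log 2 (p i) - log 2 (q j)) \<le> (P i w j * 2 powr w * p i - P i w j * q j) / ln 2"
    if "i \<in> A" "j \<in> B" for i j w
  proof -
    have pos: "0 < p i" "0 < q j" "0 \<le> P i w j" using p q nonneg that by auto
    have "w + log 2 (p i) - log 2 (q j) = log 2 (2 powr w * p i / q j)"
      using pos by (simp add: log_mult log_divide)
    also have "\<dots> \<le> (2 powr w * p i / q j - 1) / ln 2"
      unfolding log_def using pos by (intro divide_right_mono ln_le_minus_one) auto
    finally have "P i w j * q j * (w + log 2 (p i) - log 2 (q j)) \<le> P i w j * q j * ((2 powr w * p i / q j - 1) / ln 2)"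
      using pos by (intro mult_left_mono) auto
    also have "\<dots> = (P i w j * 2 powr w * p i - P i w j * q j) / ln 2"
      using pos by (simp add: field_simps)
    finally show ?thesis .
  qed
  have "(\<Sum>i\<in>A. \<Sum>j\<in>B. \<Sum>w\<in>S i j. P i w j * q j * (w + log 2 (p i) - log 2 (q j))) \<le>
      (\<Sum>i\<in>A. \<Sum>j\<in>B. \<Sum>w\<in>S i j. (P i w j * 2 powr w * p i - P i w j * q j) / ln 2)"
    by (intro sum_mono pt)
  also have "\<dots> = ((\<Sum>i\<in>A. p i * (\<Sum>j\<in>B. \<Sum>w\<in>S i j. P i w j * 2 powr w)) -
      (\<Sum>i\<in>A. \<Sum>j\<in>B. q j * (\<Sum>w\<in>S i j. P i w j))) / ln 2"
    by (simp add: sum_divide_distrib[symmetric] sum_subtractf sum_distrib_left mult_ac)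
  also have "\<dots> \<le> 0"
  proof -
    have "(\<Sum>i\<in>A. p i * (\<Sum>j\<in>B. \<Sum>w\<in>S i j. P i w j * 2 powr w)) \<le> (\<Sum>i\<in>A. p i * 1)"
      using p weighted by (intro sum_mono mult_left_mono) (auto simp: less_imp_le)
    then show ?thesis using marginal p by (simp add: divide_nonpos_pos)
  qed
  finally have "(\<Sum>i\<in>A. \<Sum>j\<in>B. \<Sum>w\<in>S i j. P i w j * q j * (w + log 2 (p i) - log 2 (q j))) \<le> 0" .
  also have "(\<Sum>i\<in>A. \<Sum>j\<in>B. \<Sum>w\<in>S i j. P i w j * q j * (w + log 2 (p i) - log 2 (q j))) =
     (\<Sum>i\<in>A. \<Sum>j\<in>B. \<Sum>w\<in>S i j. P i w j * q j * w) +
     (\<Sum>i\<in>A. log 2 (p i) * (\<Sum>j\<in>B. q j * (\<Sum>w\<in>S i j. P i w j))) -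
     (\<Sum>i\<in>A. \<Sum>j\<in>B. log 2 (q j) * q j * (\<Sum>w\<in>S i j. P i w j))"
    by (simp add: sum.distrib sum_subtractf sum_distrib_left algebra_simps)
  also have "(\<Sum>i\<in>A. log 2 (p i) * (\<Sum>j\<in>B. q j * (\<Sum>w\<in>S i j. P i w j))) = (\<Sum>i\<in>A. p i * log 2 (p i))"
    using marginal by (simp add: mult.commute)
  also have "(\<Sum>i\<in>A. \<Sum>j\<in>B. log 2 (q j) * q j * (\<Sum>w\<in>S i j. P i w j)) =
      (\<Sum>j\<in>B. log 2 (q j) * q j * (\<Sum>i\<in>A. \<Sum>w\<in>S i j. P i w j))"
    unfolding sum_distrib_left[of "log 2 (q _) * q _" _ A] by (rule sum.swap)
  also have "\<dots> = (\<Sum>j\<in>B. q j * log 2 (q j))"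
    using norm by (simp add: mult.commute)
  finally show ?thesis by simp
qed

section \<open>Passage to the limit along a protocol sequence\<close>

lemma eventually_along: "eventually (\<lambda>N. N \<in> Ns) (along Ns)"
  by (simp add: along_def eventually_inf_principal)

lemma along_neq_bot: "infinite Ns \<Longrightarrow> along Ns \<noteq> bot"
  by (simp add: along_def trivial_limit_def eventually_inf_principal eventually_sequentially
      infinite_nat_iff_unbounded_le)

text \<open>This is where the divergence of \<open>N * delta_w\<close> enters:
  \<open>K * delta_w \<le> w_max\<close> gives \<open>K / N \<le> w_max / (N * delta_w)\<close>, so
  the ends of the window become negligible.\<close>

lemma tendsto_Kmax_window:
  assumes "filterlim (\<lambda>N. real N * delta_w (bat_u (st N))) at_top (along Ns)"
    and u: "\<And>N. N \<in> Ns \<Longrightarrow> 2 \<le> bat_u (st N)" and "0 < w_max"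
  shows "((\<lambda>N. (real N + 1 + 2 * Kmax w_max (bat_u (st N))) / (real N + 1)) \<longlongrightarrow> 1) (along Ns)"
proof (rule tendsto_sandwich)
  show "((\<lambda>N. 1) \<longlongrightarrow> 1) (along Ns)" by simp
  have "((\<lambda>N. w_max / (real N * delta_w (bat_u (st N)))) \<longlongrightarrow> 0) (along Ns)"
    using assms(1) by (rule tendsto_divide_0[OF tendsto_const filterlim_at_top_imp_at_infinity])
  then have "((\<lambda>N. 1 + 2 * (w_max / (real N * delta_w (bat_u (st N))))) \<longlongrightarrow> 1 + 2 * 0) (along Ns)"
    by (intro tendsto_add tendsto_mult tendsto_const)
  then show "((\<lambda>N. 1 + 2 * (w_max / (real N * delta_w (bat_u (st N))))) \<longlongrightarrow> 1) (along Ns)"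
    by simp
  show "\<forall>\<^sub>F N in along Ns. 1 \<le> (real N + 1 + 2 * Kmax w_max (bat_u (st N))) / (real N + 1)"
    using eventually_along[of Ns]
  proof eventually_elim
    case (elim N)
    then show ?case using Kmax_nonneg[OF assms(3) u] by (simp add: field_simps)
  qed
  have "eventually (\<lambda>N. 0 < real N * delta_w (bat_u (st N))) (along Ns)"
    using assms(1) by (simp add: filterlim_at_top_dense)
  then show "\<forall>\<^sub>F N in along Ns. (real N + 1 + 2 * Kmax w_max (bat_u (st N))) / (real N + 1) \<le>
      1 + 2 * (w_max / (real N * delta_w (bat_u (st N))))"
    using eventually_along[of Ns]
  proof eventually_elim
    case (elim N)
    let ?\<delta> = "delta_w (bat_u (st N))" and ?K = "real_of_int (Kmax w_max (bat_u (st N)))"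
    have \<delta>: "0 < ?\<delta>" by (rule delta_w_pos[OF u[OF elim(2)]])
    have N: "0 < real N" using elim(1) \<delta> by (simp add: zero_less_mult_iff)
    have "?K / (real N + 1) \<le> ?K / real N"
      using Kmax_nonneg[OF assms(3) u[OF elim(2)]] N by (intro divide_left_mono) auto
    also have "\<dots> \<le> w_max / (real N * ?\<delta>)"
      using Kmax_mult_delta_w_le[OF u[OF elim(2)], of w_max] N \<delta> by (simp add: field_simps)
    finally show ?case by (simp add: add_divide_distrib)
  qed
qed

lemma blocc_possible_imp_le:
  assumes poss: "blocc_possible D d p d' q w" and d: "d \<le> D" "d' \<le> D"
    and p: "\<And>i. i \<in> {1..d} \<Longrightarrow> 0 < p i" "(\<Sum>i=1..d. p i) = 1"
    and q: "\<And>j. j \<in> {1..d'} \<Longrightarrow> 0 < q j" "(\<Sum>j=1..d'. q j) = 1"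
  shows "w \<le> (\<Sum>j=1..d'. q j * log 2 (q j)) - (\<Sum>i=1..d. p i * log 2 (p i))"
proof -
  obtain w_max Ns st P where seq: "blocc_sequence D d p d' q w_max Ns st"
    and realz: "realizes D d d' w_max Ns st P"
    and avg: "(\<Sum>i=1..d. \<Sum>j=1..d'. \<Sum>w\<in>{w. P i w j \<noteq> 0}. P i w j * q j * w) = w"
    using poss unfolding blocc_possible_def by blast
  define S where "S i j = {w. P i w j \<noteq> 0}" for i j
  define W where "W = along Ns"
  let ?u = "\<lambda>N. bat_u (st N)"
  let ?Ks = "\<lambda>N. {k. \<bar>k\<bar> \<le> Kmax w_max (?u N)}"
  let ?fl = "\<lambda>N i k j. fluct D N (st N) i k j"
  have wm: "0 < w_max" and Ns: "infinite Ns" and valid: "\<And>N. N \<in> Ns \<Longrightarrow> valid_step D N (st N)"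
    using seq unfolding blocc_sequence_def by auto
  have W: "W \<noteq> bot" unfolding W_def by (rule along_neq_bot[OF Ns])
  have ev: "eventually (\<lambda>N. N \<in> Ns) W" unfolding W_def by (rule eventually_along)
  have bi: "bistochastic_step D N (st N)" if "N \<in> Ns" for N
    by (rule valid_step_majorization(1)[OF valid[OF that]])
  have u2: "N \<in> Ns \<Longrightarrow> 2 \<le> ?u N" for N
    using bi bistochastic_step.u_ge_2 by blast
  have P_nonneg: "0 \<le> P i w j" and S_fin: "finite (S i j)"
    if "i \<in> {1..d}" "j \<in> {1..d'}" for i w j
    using realz that unfolding realizes_def S_def by auto
  have lim: "((\<lambda>N. \<Sum>k\<in>?Ks N. ?fl N i k j * f (of_int k * delta_w (?u N))) \<longlongrightarrow> (\<Sum>w\<in>S i j. P i w j * f w)) W"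
    if "i \<in> {1..d}" "j \<in> {1..d'}" "continuous_on UNIV f" "bounded (range f)" for i j and f :: "real \<Rightarrow> real"
    using realz that unfolding realizes_def S_def W_def by blast
  have lim1: "((\<lambda>N. \<Sum>k\<in>?Ks N. ?fl N i k j) \<longlongrightarrow> (\<Sum>w\<in>S i j. P i w j)) W"
    if "i \<in> {1..d}" "j \<in> {1..d'}" for i j
    using lim[OF that, of "\<lambda>_. 1"] by simp
  \<comment> \<open>The far weight yields only the sum over j of the defects. Each defect is
    nonnegative in the limit, so a vanishing sum makes every one of them vanish.\<close>
  have norm: "(\<Sum>i=1..d. \<Sum>w\<in>S i j. P i w j) = 1" if j: "j \<in> {1..d'}" for j
  proof -
    have le1: "(\<Sum>i=1..d. \<Sum>w\<in>S i j. P i w j) \<le> 1" if "j \<in> {1..d'}" for j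
    proof (rule tendsto_upperbound[OF _ _ W])
      show "((\<lambda>N. \<Sum>i=1..d. \<Sum>k\<in>?Ks N. ?fl N i k j) \<longlongrightarrow> (\<Sum>i=1..d. \<Sum>w\<in>S i j. P i w j)) W"
        by (intro tendsto_sum lim1 that)
      show "\<forall>\<^sub>F N in W. (\<Sum>i=1..d. \<Sum>k\<in>?Ks N. ?fl N i k j) \<le> 1"
        using ev
      proof eventually_elim
        case (elim N)
        show ?case
          by (rule bistochastic_step.sum_fluct_le_1[OF bi[OF elim] d(1)]) (use that d in auto)
      qed
    qed
    have "((\<lambda>N. \<Sum>j=1..d'. 1 - (\<Sum>i=1..d. \<Sum>k\<in>?Ks N. ?fl N i k j)) \<longlongrightarrow> 0) W"
    proof (rule Lim_transform_eventually)
      have "((\<lambda>N. far_weight_final w_max D d d' N (st N)) \<longlongrightarrow> 0) W"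
        using seq unfolding blocc_sequence_def W_def by blast
      then show "((\<lambda>N. Re (far_weight_final w_max D d d' N (st N))) \<longlongrightarrow> 0) W"
        using tendsto_Re by fastforce
      show "\<forall>\<^sub>F N in W. Re (far_weight_final w_max D d d' N (st N)) =
          (\<Sum>j=1..d'. 1 - (\<Sum>i=1..d. \<Sum>k\<in>?Ks N. ?fl N i k j))"
        using ev by eventually_elim (use bi d in \<open>simp add: bistochastic_step.far_weight_final_eq_fluct\<close>)
    qed
    moreover have "((\<lambda>N. \<Sum>j=1..d'. 1 - (\<Sum>i=1..d. \<Sum>k\<in>?Ks N. ?fl N i k j)) \<longlongrightarrow>
        (\<Sum>j=1..d'. 1 - (\<Sum>i=1..d. \<Sum>w\<in>S i j. P i w j))) W"
      by (intro tendsto_sum tendsto_diff tendsto_const lim1)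
    ultimately have "(\<Sum>j=1..d'. 1 - (\<Sum>i=1..d. \<Sum>w\<in>S i j. P i w j)) = 0"
      using tendsto_unique[OF W] by blast
    then have "\<forall>j\<in>{1..d'}. 1 - (\<Sum>i=1..d. \<Sum>w\<in>S i j. P i w j) = 0"
      using le1 by (subst (asm) sum_nonneg_eq_0_iff) auto
    then show ?thesis using j by simp
  qed
  have marg_le: "(\<Sum>j=1..d'. q j * (\<Sum>w\<in>S i j. P i w j)) \<le> p i" if i: "i \<in> {1..d}" for i
  proof (rule tendsto_le[OF W])
    let ?I = "\<lambda>N. step_basis D (st N)"
    let ?e = "\<lambda>N. vnorm (?I N \<times> ?I N) (\<lambda>z. init_state (st N) z - bip_tensor (schmidt_state d p) (battery_state N (st N)) z)"
    let ?e' = "\<lambda>N. vnorm (?I N \<times> ?I N) (\<lambda>z. fin_state (st N) z - bip_tensor (schmidt_state d' q) (battery_state N (st N)) z)"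
    have "(?e \<longlongrightarrow> 0) W" "(?e' \<longlongrightarrow> 0) W"
      using seq unfolding blocc_sequence_def W_def by blast+
    then have "((\<lambda>N. p i + 2 * ?e N + 2 * ?e' N) \<longlongrightarrow> p i + 2 * 0 + 2 * 0) W"
      by (intro tendsto_intros)
    then show "((\<lambda>N. p i + 2 * ?e N + 2 * ?e' N) \<longlongrightarrow> p i) W" by simp
    show "((\<lambda>N. \<Sum>j=1..d'. q j * (\<Sum>k\<in>?Ks N. ?fl N i k j)) \<longlongrightarrow> (\<Sum>j=1..d'. q j * (\<Sum>w\<in>S i j. P i w j))) W"
      by (intro tendsto_intros lim1 i)
    show "\<forall>\<^sub>F N in W. (\<Sum>j=1..d'. q j * (\<Sum>k\<in>?Ks N. ?fl N i k j)) \<le> p i + 2 * ?e N + 2 * ?e' N"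
      using ev by eventually_elim (intro valid_step_marginal_le valid d i p q)
  qed
  \<comment> \<open>Summed over i, both sides of \<open>marg_le\<close> equal 1, by
    \<open>norm\<close> on the left and by normalization of p on the right; so no single inequality
    can be strict.\<close>
  have marginal: "(\<Sum>j=1..d'. q j * (\<Sum>w\<in>S i j. P i w j)) = p i" if i: "i \<in> {1..d}" for i
  proof -
    have "(\<Sum>i=1..d. \<Sum>j=1..d'. q j * (\<Sum>w\<in>S i j. P i w j)) =
        (\<Sum>j=1..d'. q j * (\<Sum>i=1..d. \<Sum>w\<in>S i j. P i w j))"
      unfolding sum_distrib_left[of "q _" _ "{1..d}"] by (rule sum.swap)
    also have "\<dots> = (\<Sum>i=1..d. p i)" using norm p q by simp
    finally have "(\<Sum>i=1..d. p i - (\<Sum>j=1..d'. q j * (\<Sum>w\<in>S i j. P i w j))) = 0"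
      by (simp add: sum_subtractf)
    then have "\<forall>i\<in>{1..d}. p i - (\<Sum>j=1..d'. q j * (\<Sum>w\<in>S i j. P i w j)) = 0"
      using marg_le by (subst (asm) sum_nonneg_eq_0_iff) auto
    then show ?thesis using i by simp
  qed
  have weighted: "(\<Sum>j=1..d'. \<Sum>w\<in>S i j. P i w j * 2 powr w) \<le> 1" if i: "i \<in> {1..d}" for i
  proof -
    \<comment> \<open>The cutoff B exceeds \<open>w_max\<close>, hence every value
      \<open>k * delta_w\<close> occurring along the sequence, and also every atom of the limit. The
      truncated exponential f is bounded and continuous and agrees with \<open>2 powr w\<close> at
      all these points.\<close>
    define B where "B = Max (insert w_max (abs ` (\<Union>j\<in>{1..d'}. S i j)))"
    have fin: "finite (insert w_max (abs ` (\<Union>j\<in>{1..d'}. S i j)))"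
      using S_fin i by auto
    have B: "w_max \<le> B" "\<And>j w. j \<in> {1..d'} \<Longrightarrow> w \<in> S i j \<Longrightarrow> \<bar>w\<bar> \<le> B"
      unfolding B_def by (intro Max_ge[OF fin], blast)+
    define f where "f w = 2 powr (max (-B) (min B w))" for w :: real
    have f: "continuous_on UNIV f" "bounded (range f)"
    proof -
      show "continuous_on UNIV f" unfolding f_def by (intro continuous_intros) auto
      have "\<bar>f w\<bar> \<le> 2 powr B" for w
        unfolding f_def using B(1) wm by (auto intro!: powr_mono)
      then show "bounded (range f)" by (auto simp: bounded_iff)
    qed
    have "(\<Sum>j=1..d'. \<Sum>w\<in>S i j. P i w j * f w) \<le> 1"
    proof (rule tendsto_le[OF W])
      show "((\<lambda>N. (real N + 1 + 2 * Kmax w_max (?u N)) / (real N + 1)) \<longlongrightarrow> 1) W"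
        unfolding W_def using seq by (intro tendsto_Kmax_window u2 wm) (auto simp: blocc_sequence_def)
      show "((\<lambda>N. \<Sum>j=1..d'. \<Sum>k\<in>?Ks N. ?fl N i k j * f (of_int k * delta_w (?u N))) \<longlongrightarrow>
          (\<Sum>j=1..d'. \<Sum>w\<in>S i j. P i w j * f w)) W"
        by (intro tendsto_sum lim i f)
      show "\<forall>\<^sub>F N in W. (\<Sum>j=1..d'. \<Sum>k\<in>?Ks N. ?fl N i k j * f (of_int k * delta_w (?u N)))
          \<le> (real N + 1 + 2 * Kmax w_max (?u N)) / (real N + 1)"
        using ev
      proof eventually_elim
        case (elim N)
        have "f (of_int k * delta_w (?u N)) = 2 powr (of_int k * delta_w (?u N))" if "k \<in> ?Ks N" for k
        proof -
          have \<delta>: "0 < delta_w (?u N)" by (rule delta_w_pos[OF u2[OF elim]])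
          have "\<bar>of_int k * delta_w (?u N)\<bar> = of_int \<bar>k\<bar> * delta_w (?u N)"
            using \<delta> by (simp add: abs_mult)
          also have "\<dots> \<le> of_int (Kmax w_max (?u N)) * delta_w (?u N)"
            using that \<delta> by (intro mult_right_mono) (simp_all only: of_int_le_iff mem_Collect_eq less_imp_le)
          also have "\<dots> \<le> B"
            using Kmax_mult_delta_w_le[OF u2[OF elim], of w_max] B(1) by linarith
          finally show ?thesis unfolding f_def by (simp add: abs_le_iff)
        qed
        moreover have "i \<in> {1..D}" using i d by auto
        ultimately show ?case
          using bistochastic_step.sum_fluct_weighted_le[OF bi[OF elim] d(2) _ wm, of i] by simp
      qed
    qed
    moreover have "f w = 2 powr w" if "j \<in> {1..d'}" "w \<in> S i j" for j w
      using B(2)[OF that] unfolding f_def by (simp add: abs_le_iff)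
    ultimately show ?thesis by simp
  qed
  show ?thesis
    using average_fluctuation_le[where S = S and P = P, OF P_nonneg p q norm weighted marginal] avg
    unfolding S_def by simp
qed

section \<open>Protocol steps from permutations\<close>

lemma disjoint_subsets_of_card:
  fixes S :: "'e \<Rightarrow> 'a set" and c :: "'e \<Rightarrow> nat"
  assumes "finite E" "\<And>e. e \<in> E \<Longrightarrow> finite (S e)"
    and "\<And>e e'. e \<in> E \<Longrightarrow> e' \<in> E \<Longrightarrow> S e = S e' \<or> S e \<inter> S e' = {}"
    and "\<And>e. e \<in> E \<Longrightarrow> (\<Sum>e'\<in>{e'\<in>E. S e' = S e}. c e') \<le> card (S e)"
  shows "\<exists>A. (\<forall>e\<in>E. A e \<subseteq> S e \<and> card (A e) = c e) \<and> disjoint_family_on A E"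
  using assms
proof (induction E rule: finite_induct)
  case empty
  then show ?case by (simp add: disjoint_family_on_def)
next
  case (insert e E)
  have le: "(\<Sum>e'\<in>{e'\<in>E. S e' = S f}. c e') \<le> (\<Sum>e'\<in>{e'\<in>insert e E. S e' = S f}. c e')" for f
    using insert.hyps by (intro sum_mono2) auto
  have "\<exists>A. (\<forall>e\<in>E. A e \<subseteq> S e \<and> card (A e) = c e) \<and> disjoint_family_on A E"
  proof (rule insert.IH)
    show "(\<Sum>e'\<in>{e'\<in>E. S e' = S f}. c e') \<le> card (S f)" if "f \<in> E" for f
      using le[of f] insert.prems(3)[of f] that by simp
  qed (use insert.prems in auto)
  then obtain A where A: "\<And>e. e \<in> E \<Longrightarrow> A e \<subseteq> S e" "\<And>e. e \<in> E \<Longrightarrow> card (A e) = c e"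
    "disjoint_family_on A E" by blast
  let ?same = "{e'\<in>E. S e' = S e}"
  let ?used = "\<Union>e'\<in>?same. A e'"
  have "finite ?used"
    using insert.hyps insert.prems(1) A(1) by (auto intro: finite_subset)
  have "card ?used \<le> (\<Sum>e'\<in>?same. card (A e'))"
    using insert.hyps by (intro card_UN_le) auto
  also have "\<dots> = (\<Sum>e'\<in>?same. c e')"
    using A(2) by (intro sum.cong) auto
  finally have "card ?used + c e \<le> (\<Sum>e'\<in>insert e ?same. c e')"
    using insert.hyps by simp
  also have "insert e ?same = {e'\<in>insert e E. S e' = S e}" by auto
  also have "sum c \<dots> \<le> card (S e)" using insert.prems(3)[of e] by simp
  finally have "c e \<le> card (S e - ?used)"
    using diff_card_le_card_Diff[OF \<open>finite ?used\<close>, of "S e"] by linarith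
  then obtain T where T: "T \<subseteq> S e - ?used" "card T = c e"
    by (meson obtain_subset_with_card_n)
  have disj: "T \<inter> A f = {}" if f: "f \<in> E" for f
  proof (cases "S f = S e")
    case True
    then show ?thesis using T f by auto
  next
    case False
    then show ?thesis using insert.prems(2)[of f e] f A(1)[OF f] T by auto
  qed
  let ?A = "A(e := T)"
  have ne: "f \<noteq> e" if "f \<in> E" for f using that insert.hyps by auto
  have "\<forall>f\<in>insert e E. ?A f \<subseteq> S f \<and> card (?A f) = c f"
    using A T ne by auto
  moreover have "disjoint_family_on ?A (insert e E)"
    unfolding disjoint_family_on_def
  proof (intro ballI impI)
    fix f f' assume "f \<in> insert e E" "f' \<in> insert e E" "f \<noteq> f'"
    then show "?A f \<inter> ?A f' = {}"
      using A(3) disj ne unfolding disjoint_family_on_def by (cases "f = e"; cases "f' = e") auto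
  qed
  ultimately show ?case by blast
qed

lemma bij_betw_UN_disjoint_families:
  assumes "finite E" "disjoint_family_on A E" "disjoint_family_on B E"
    and "\<And>e. e \<in> E \<Longrightarrow> finite (A e)" "\<And>e. e \<in> E \<Longrightarrow> finite (B e)" "\<And>e. e \<in> E \<Longrightarrow> card (A e) = card (B e)"
  obtains f where "bij_betw f (\<Union>e\<in>E. A e) (\<Union>e\<in>E. B e)" "\<And>e. e \<in> E \<Longrightarrow> f ` A e = B e"
proof -
  have "\<forall>e\<in>E. \<exists>h. bij_betw h (A e) (B e)"
    using assms finite_same_card_bij by metis
  then obtain h where h: "\<And>e. e \<in> E \<Longrightarrow> bij_betw (h e) (A e) (B e)" by metis
  define f where "f a = h (THE e. e \<in> E \<and> a \<in> A e) a" for a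
  have f: "f a = h e a" if "e \<in> E" "a \<in> A e" for e a
  proof -
    have "(THE e. e \<in> E \<and> a \<in> A e) = e"
      using that assms(2) unfolding disjoint_family_on_def by (intro the_equality) auto
    then show ?thesis by (simp add: f_def)
  qed
  have img: "f ` A e = B e" if "e \<in> E" for e
    using h[OF that] f[OF that] unfolding bij_betw_def by (metis image_cong)
  have "inj_on f (\<Union>e\<in>E. A e)"
  proof (rule inj_onI)
    fix a b assume "a \<in> (\<Union>e\<in>E. A e)" "b \<in> (\<Union>e\<in>E. A e)" and eq: "f a = f b"
    then obtain e e' where e: "e \<in> E" "a \<in> A e" "e' \<in> E" "b \<in> A e'" by blast
    then have "f a \<in> B e \<inter> B e'" using img eq by (metis IntI imageI)
    then have "e = e'" using assms(3) e unfolding disjoint_family_on_def by auto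
    then show "a = b" using e eq f h[OF e(1)] by (metis bij_betw_inv_into_left)
  qed
  moreover have "f ` (\<Union>e\<in>E. A e) = (\<Union>e\<in>E. B e)"
    using img by (simp add: image_UN)
  ultimately show ?thesis using that img by (auto simp: bij_betw_def)
qed

lemma permutes_extend_bij_betw:
  assumes "finite I" "X \<subseteq> I" "Y \<subseteq> I" "bij_betw f X Y"
  obtains \<pi> where "\<pi> permutes I" "\<And>a. a \<in> X \<Longrightarrow> \<pi> a = f a"
proof -
  have "card (I - X) = card (I - Y)"
    using assms bij_betw_same_card[OF assms(4)] by (simp add: card_Diff_subset finite_subset)
  then obtain k where k: "bij_betw k (I - X) (I - Y)"
    using assms(1) finite_same_card_bij[of "I - X" "I - Y"] by auto
  define \<pi> where "\<pi> a = (if a \<in> X then f a else if a \<in> I then k a else a)" for a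
  have "bij_betw \<pi> X Y"
    using assms(4) by (rule bij_betw_cong[THEN iffD1, rotated]) (simp add: \<pi>_def)
  moreover have "bij_betw \<pi> (I - X) (I - Y)"
    using k by (rule bij_betw_cong[THEN iffD1, rotated]) (simp add: \<pi>_def)
  ultimately have "bij_betw \<pi> (X \<union> (I - X)) (Y \<union> (I - Y))"
    by (rule bij_betw_combine) auto
  moreover have "X \<union> (I - X) = I" "Y \<union> (I - Y) = I" using assms by auto
  ultimately have "\<pi> permutes I"
    using assms(2) by (intro bij_imp_permutes) (auto simp: \<pi>_def)
  then show ?thesis using that by (simp add: \<pi>_def)
qed

text \<open>A discrete transport problem with capacities at sources and targets: disjoint parts of
  the prescribed sizes are cut out on both sides and matched. The conclusion is only a lower bound
  because the arbitrary matching of the remaining elements can add to any pair, and it sums over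
  slots because several may share source and target.\<close>

lemma permutation_with_prescribed_flow:
  fixes S T :: "'e \<Rightarrow> 'a set" and c :: "'e \<Rightarrow> nat"
  assumes "finite I" "finite E"
    and sub: "\<And>e. e \<in> E \<Longrightarrow> S e \<subseteq> I" "\<And>e. e \<in> E \<Longrightarrow> T e \<subseteq> I"
    and disj: "\<And>e e'. e \<in> E \<Longrightarrow> e' \<in> E \<Longrightarrow> S e = S e' \<or> S e \<inter> S e' = {}"
      "\<And>e e'. e \<in> E \<Longrightarrow> e' \<in> E \<Longrightarrow> T e = T e' \<or> T e \<inter> T e' = {}"
    and S_le: "\<And>e. e \<in> E \<Longrightarrow> (\<Sum>e'\<in>{e'\<in>E. S e' = S e}. c e') \<le> card (S e)"
    and T_le: "\<And>e. e \<in> E \<Longrightarrow> (\<Sum>e'\<in>{e'\<in>E. T e' = T e}. c e') \<le> card (T e)"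
  shows "\<exists>\<pi>. \<pi> permutes I \<and> (\<forall>X Y. finite X \<longrightarrow>
     (\<Sum>e\<in>{e\<in>E. S e = X \<and> T e = Y}. c e) \<le> card {a\<in>X. \<pi> a \<in> Y})"
proof -
  have fin: "finite (S e)" "finite (T e)" if "e \<in> E" for e
    using sub[OF that] assms(1) by (auto intro: finite_subset)
  obtain A where A: "\<And>e. e \<in> E \<Longrightarrow> A e \<subseteq> S e" "\<And>e. e \<in> E \<Longrightarrow> card (A e) = c e" "disjoint_family_on A E"
    using disjoint_subsets_of_card[where S = S and c = c, OF assms(2) fin(1) disj(1) S_le] by blast
  obtain B where B: "\<And>e. e \<in> E \<Longrightarrow> B e \<subseteq> T e" "\<And>e. e \<in> E \<Longrightarrow> card (B e) = c e" "disjoint_family_on B E"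
    using disjoint_subsets_of_card[where S = T and c = c, OF assms(2) fin(2) disj(2) T_le] by blast
  have finAB: "finite (A e)" "finite (B e)" if "e \<in> E" for e
    using A(1)[OF that] B(1)[OF that] fin[OF that] by (auto intro: finite_subset)
  have cardAB: "e \<in> E \<Longrightarrow> card (A e) = card (B e)" for e
    using A(2) B(2) by simp
  obtain f where f: "bij_betw f (\<Union>e\<in>E. A e) (\<Union>e\<in>E. B e)" "\<And>e. e \<in> E \<Longrightarrow> f ` A e = B e"
    using bij_betw_UN_disjoint_families[OF assms(2) A(3) B(3) finAB cardAB] by blast
  have "(\<Union>e\<in>E. A e) \<subseteq> I" "(\<Union>e\<in>E. B e) \<subseteq> I" using A(1) B(1) sub by blast+
  then obtain \<pi> where \<pi>: "\<pi> permutes I" "\<And>a. a \<in> (\<Union>e\<in>E. A e) \<Longrightarrow> \<pi> a = f a"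
    using permutes_extend_bij_betw[OF assms(1) _ _ f(1)] by blast
  have "(\<Sum>e\<in>{e\<in>E. S e = X \<and> T e = Y}. c e) \<le> card {a\<in>X. \<pi> a \<in> Y}" if "finite X" for X Y
  proof -
    let ?E = "{e\<in>E. S e = X \<and> T e = Y}"
    have "(\<Sum>e\<in>?E. c e) = (\<Sum>e\<in>?E. card (A e))" using A(2) by simp
    also have "\<dots> = card (\<Union>e\<in>?E. A e)"
      using A(3) assms(2) finAB
      by (intro card_UN_disjoint[symmetric]) (auto simp: disjoint_family_on_def)
    also have "\<dots> \<le> card {a\<in>X. \<pi> a \<in> Y}"
    proof (rule card_mono)
      show "finite {a\<in>X. \<pi> a \<in> Y}" using that by simp
      show "(\<Union>e\<in>?E. A e) \<subseteq> {a\<in>X. \<pi> a \<in> Y}"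
      proof
        fix a assume "a \<in> (\<Union>e\<in>?E. A e)"
        then obtain e where e: "e \<in> E" "S e = X" "T e = Y" "a \<in> A e" by blast
        then have "\<pi> a \<in> f ` A e" using \<pi>(2) by auto
        then show "a \<in> {a\<in>X. \<pi> a \<in> Y}" using e A(1) B(1) f(2) by blast
      qed
    qed
    finally show ?thesis .
  qed
  then show ?thesis using \<pi>(1) by blast
qed

section \<open>Averaging over permutations that preserve the blocks\<close>

definition blk_perms :: "nat \<Rightarrow> nat \<Rightarrow> nat \<Rightarrow> (lab \<Rightarrow> lab) set" where
  "blk_perms D u n = {h. h permutes loc_basis D u n \<and>
     (\<forall>i x. i \<in> {1..D} \<longrightarrow> x \<le> n \<longrightarrow> h ` blk u n i x = blk u n i x)}"

lemma finite_loc_basis: "finite (loc_basis D u n)"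
  by (simp add: loc_basis_def finite_battery_basis)

lemma finite_blk_perms: "finite (blk_perms D u n)"
  unfolding blk_perms_def by (rule finite_subset[OF _ finite_permutations[OF finite_loc_basis]]) auto

lemma id_blk_perms: "id \<in> blk_perms D u n"
  by (simp add: blk_perms_def permutes_id)

lemma card_blk_perms_pos: "0 < card (blk_perms D u n)"
  using id_blk_perms finite_blk_perms card_gt_0_iff by blast

lemma sum_blk_image:
  assumes "h \<in> blk_perms D u n" "i \<in> {1..D}" "x \<le> n"
  shows "(\<Sum>a\<in>blk u n i x. f (h a)) = (\<Sum>a\<in>blk u n i x. f a)"
proof -
  have "inj_on h (blk u n i x)"
    using assms(1) permutes_inj_on by (auto simp: blk_perms_def)
  then have "(\<Sum>a\<in>blk u n i x. f (h a)) = (\<Sum>a\<in>h ` blk u n i x. f a)"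
    by (simp add: sum.reindex)
  then show ?thesis using assms by (simp add: blk_perms_def)
qed

text \<open>Composing with a transposition of two labels of one block is a bijection of
  \<open>blk_perms\<close>, so the sum over h has the same value at every label of the block.
  Summing over the block and exchanging the sums identifies this value as the block mean.\<close>

lemma sum_blk_perms:
  fixes f :: "lab \<Rightarrow> real"
  assumes i: "i \<in> {1..D}" and x: "x \<le> n" and a: "a \<in> blk u n i x"
  shows "real (bsize u n x) * (\<Sum>h\<in>blk_perms D u n. f (h a)) =
    real (card (blk_perms D u n)) * (\<Sum>b\<in>blk u n i x. f b)"
proof -
  have "(\<Sum>h\<in>blk_perms D u n. f (h b)) = (\<Sum>h\<in>blk_perms D u n. f (h a))" if b: "b \<in> blk u n i x" for b
  proof -
    let ?t = "Transposition.transpose a b"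
    have sub: "blk u n i x \<subseteq> loc_basis D u n"
      using i x by (auto simp: blk_def loc_basis_def battery_basis_def)
    have tp: "?t permutes loc_basis D u n"
      using a b sub by (intro permutes_swap_id) auto
    have ti: "?t ` blk u n j y = blk u n j y" if "y \<le> n" for j y
    proof (cases "i = j \<and> x = y")
      case True
      then show ?thesis using a b by (auto simp: Transposition.transpose_def image_iff)
    next
      case False
      then have "a \<notin> blk u n j y" "b \<notin> blk u n j y"
        using blk_disjoint a b x that by blast+
      then show ?thesis by (auto simp: Transposition.transpose_def image_iff)
    qed
    have closed: "h \<circ> ?t \<in> blk_perms D u n" if "h \<in> blk_perms D u n" for h
    proof -
      have h: "h permutes loc_basis D u n" "\<And>i x. i \<in> {1..D} \<Longrightarrow> x \<le> n \<Longrightarrow> h ` blk u n i x = blk u n i x"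
        using that by (auto simp: blk_perms_def)
      have "(h \<circ> ?t) ` blk u n j y = blk u n j y" if "j \<in> {1..D}" "y \<le> n" for j y
        unfolding image_comp[symmetric] ti[OF that(2)] by (rule h(2)[OF that])
      then show ?thesis
        using permutes_compose[OF tp h(1)] by (simp add: blk_perms_def)
    qed
    have inv: "h \<circ> ?t \<circ> ?t = h" for h :: "lab \<Rightarrow> lab"
      by (simp add: comp_assoc)
    show ?thesis
      by (rule sum.reindex_bij_witness[of _ "\<lambda>h. h \<circ> ?t" "\<lambda>h. h \<circ> ?t"])
         (use closed inv in auto)
  qed
  then have "real (bsize u n x) * (\<Sum>h\<in>blk_perms D u n. f (h a)) =
      (\<Sum>b\<in>blk u n i x. \<Sum>h\<in>blk_perms D u n. f (h b))"
    using x by (simp add: card_blk)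
  also have "\<dots> = (\<Sum>h\<in>blk_perms D u n. \<Sum>b\<in>blk u n i x. f (h b))"
    by (rule sum.swap)
  also have "\<dots> = (\<Sum>h\<in>blk_perms D u n. \<Sum>b\<in>blk u n i x. f b)"
    by (rule sum.cong[OF refl sum_blk_image[OF _ i x]])
  finally show ?thesis by simp
qed

text \<open>Diagonality alone does not bring a state back into the required span: its amplitude must
  be constant on each block. The square root of the block size converts that constant into the
  coefficient of a normalized |e_x>.\<close>

lemma nonneg_battery_formI:
  fixes k :: "nat \<Rightarrow> nat \<Rightarrow> real"
  assumes "\<And>i x. 0 \<le> k i x"
    and "\<And>i x a b. i \<in> {1..D} \<Longrightarrow> x \<le> n \<Longrightarrow> a \<in> blk u n i x \<Longrightarrow> b \<in> loc_basis D u n \<Longrightarrow>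
      v (a, b) = (if a = b then complex_of_real (k i x / sqrt (real (bsize u n x))) else 0)"
  shows "nonneg_battery_form D u n v"
  unfolding nonneg_battery_form_def
proof (intro exI[of _ k] conjI allI ballI assms(1))
  fix z assume "z \<in> loc_basis D u n \<times> loc_basis D u n"
  then obtain a b where z: "z = (a, b)" and ab: "a \<in> loc_basis D u n" "b \<in> loc_basis D u n" by auto
  have len: "length (snd a) = n" "length (snd b) = n"
    using ab by (auto simp: loc_basis_def length_battery_basis)
  obtain i x where ix: "i \<in> {1..D}" "x \<le> n" "a \<in> blk u n i x"
    using ab(1) by (auto simp: loc_basis_def battery_basis_def blk_def)
  have "(\<Sum>j=1..D. \<Sum>y=0..n. complex_of_real (k j y) * bip_tensor (ket (j, j)) (e_state u n y) z) =
     (\<Sum>j=1..D. if j = i then (\<Sum>y=0..n. if y = x then v (a, b) else 0) else 0)"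
  proof (intro sum.cong refl)
    fix j
    have *: "complex_of_real (k j y) * bip_tensor (ket (j, j)) (e_state u n y) z =
        (if j = i then (if y = x then v (a, b) else 0) else 0)" if "y \<in> {0..n}" for y
    proof -
      have y: "y \<le> n" using that by simp
      have v: "v (a, b) = (if a = b then complex_of_real (k i x / sqrt (real (bsize u n x))) else 0)"
        by (rule assms(2)[OF ix ab(2)])
      show ?thesis
      proof (cases "j = i \<and> y = x")
        case True
        then show ?thesis
          using ix(3) unfolding z bip_tensor_ket_e_state[OF y len] v by simp
      next
        case False
        then have "a \<notin> blk u n j y" using blk_disjoint[OF ix(3) _ ix(2) y] by blast
        then show ?thesis
          using False unfolding z bip_tensor_ket_e_state[OF y len] by auto
      qed
    qed
    have "(\<Sum>y=0..n. complex_of_real (k j y) * bip_tensor (ket (j, j)) (e_state u n y) z) =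
        (\<Sum>y=0..n. if j = i then (if y = x then v (a, b) else 0) else 0)"
      by (rule sum.cong[OF refl *])
    then show "(\<Sum>y=0..n. complex_of_real (k j y) * bip_tensor (ket (j, j)) (e_state u n y) z) =
        (if j = i then (\<Sum>y=0..n. if y = x then v (a, b) else 0) else 0)"
      by (cases "j = i") simp_all
  qed
  also have "\<dots> = v (a, b)" using ix by simp
  finally show "v z = (\<Sum>j=1..D. \<Sum>y=0..n. complex_of_real (k j y) * bip_tensor (ket (j, j)) (e_state u n y) z)"
    by (simp add: z)
qed

text \<open>
  The outcomes are the permutations \<open>\<pi> \<circ> h\<close> with \<open>h\<close> preserving the blocks: averaging over \<open>h\<close> makes
  the squared initial amplitudes constant on blocks. Where the initial amplitude vanishes, the Kraus
  operators are extended by \<open>\<pi> \<circ> h\<close> itself to keep \<open>\<Sum> M\<^sup>\<dagger> M = \<I>\<close>.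
\<close>

lemma permutation_step:
  assumes u: "2 \<le> u" and n: "1 \<le> n" "s + N \<le> n" and \<pi>: "\<pi> permutes loc_basis D u n"
    and d': "d' \<le> D" and q_pos: "\<forall>j\<in>{1..d'}. 0 < q j" and q_sum: "(\<Sum>j=1..d'. q j) = 1"
  shows "\<exists>st k. bat_u st = u \<and> bat_n st = n \<and> win_start st = s \<and> valid_step D N st \<and>
    (\<forall>i\<in>{1..D}. \<forall>x\<in>{0..n}. \<forall>j\<in>{1..D}. \<forall>y\<in>{0..n}.
       mass st i x j y = card {a\<in>blk u n i x. \<pi> a \<in> blk u n j y}) \<and>
    (\<forall>a\<in>step_basis D st. \<forall>b\<in>step_basis D st.
       fin_state st (a, b) = (if a = b then complex_of_real (amplitude N d' q st a) else 0)) \<and>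
    (\<forall>i x. 0 \<le> k i x) \<and>
    (\<forall>i\<in>{1..D}. \<forall>x\<in>{0..n}. \<forall>a\<in>blk u n i x. \<forall>b\<in>step_basis D st.
       init_state st (a, b) = (if a = b then complex_of_real (k i x / sqrt (real (bsize u n x))) else 0))"
proof -
  have q: "\<And>j. j \<in> {1..d'} \<Longrightarrow> 0 < q j" "(\<Sum>j=1..d'. q j) = 1"
    using q_pos q_sum by auto
  define I where "I = loc_basis D u n"
  define G where "G = blk_perms D u n"
  have fin: "finite I" by (simp add: I_def finite_loc_basis)
  have finG: "finite G" by (simp add: G_def finite_blk_perms)
  have cG: "0 < real (card G)" using card_blk_perms_pos by (simp add: G_def)
  have \<pi>I: "\<pi> permutes I" using \<pi> by (simp add: I_def)
  have GI: "h permutes I" if "h \<in> G" for h using that by (simp add: G_def blk_perms_def I_def)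
  have inI: "\<pi> (h a) \<in> I \<longleftrightarrow> a \<in> I" if "h \<in> G" for h a
    using permutes_in_image[OF \<pi>I] permutes_in_image[OF GI[OF that]] by simp
  have inj: "\<pi> (h a) = \<pi> (h b) \<longleftrightarrow> a = b" if "h \<in> G" for h a b
    using permutes_inj[OF \<pi>I] permutes_inj[OF GI[OF that]] by (auto dest: injD)
  obtain e where e: "bij_betw e {0..<card G} G"
    using ex_bij_betw_nat_finite[OF finG] by blast
  have eG: "e m \<in> G" if "m < card G" for m
    using bij_betwE[OF e] that by auto
  have sum_e: "(\<Sum>m<card G. f (e m)) = (\<Sum>h\<in>G. f h)" for f :: "(lab \<Rightarrow> lab) \<Rightarrow> 'z::comm_monoid_add"
    using sum.reindex_bij_betw[OF e, of f] by (simp add: atLeast0LessThan)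
  \<comment> \<open>The record is built in two stages: the target amplitudes depend only on the
    battery parameters and the window, so they can be read off a record with dummy states before the
    real states are filled in.\<close>
  define st0 where "st0 = \<lparr>bat_u = u, bat_n = n, win_start = s, init_state = (\<lambda>_. 0), fin_state = (\<lambda>_. 0),
    outcomes = card G, kraus = (\<lambda>_ _ _. 0), corr = (\<lambda>m b a. if b = \<pi> (e m a) then 1 else 0),
    weight = (\<lambda>_. 1 / real (card G))\<rparr>"
  define t where "t = amplitude N d' q st0"
  \<comment> \<open>Forced by the balance: \<open>(r a)\<^sup>2\<close> is the pullback of the
    squared final amplitudes through the averaged permutations. It is also what makes the squared
    Kraus entries \<open>t b / r a\<close>, weighted by \<open>1 / card G\<close>, sum to 1 in each
    column.\<close>
  define r where "r a = sqrt ((\<Sum>h\<in>G. (t (\<pi> (h a)))\<^sup>2) / card G)" for a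
  define k where "k i x = sqrt (\<Sum>a\<in>blk u n i x. (t (\<pi> a))\<^sup>2)" for i x
  define st where "st = st0\<lparr>init_state := (\<lambda>(a, b). if a = b then complex_of_real (r a) else 0),
    fin_state := (\<lambda>(a, b). if a = b then complex_of_real (t a) else 0),
    kraus := (\<lambda>m b a. if b = \<pi> (e m a) then
      complex_of_real (sqrt (1 / real (card G)) * (if r a = 0 then 1 else t b / r a)) else 0)\<rparr>"
  have st: "bat_u st = u" "bat_n st = n" "win_start st = s" "outcomes st = card G"
    "corr st m b a = (if b = \<pi> (e m a) then 1 else 0)" "weight st m = 1 / real (card G)"
    "init_state st (a, b) = (if a = b then complex_of_real (r a) else 0)"
    "fin_state st (a, b) = (if a = b then complex_of_real (t a) else 0)"
    "kraus st m b a = (if b = \<pi> (e m a) then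
      complex_of_real (sqrt (1 / real (card G)) * (if r a = 0 then 1 else t b / r a)) else 0)" for m a b
    by (simp_all add: st_def st0_def)
  have I: "step_basis D st = I" by (simp add: step_basis_def st I_def)
  have t: "amplitude N d' q st = t"
    by (intro ext) (simp add: t_def amplitude_def st_def st0_def window_def cong: if_cong)
  have rowsum: "(\<Sum>b\<in>I. if b = \<pi> (h a) then f b else 0) = f (\<pi> (h a))"
    if "h \<in> G" "a \<in> I" for h a and f :: "lab \<Rightarrow> 'z::comm_monoid_add"
    using that fin inI by simp
  have colsum: "(\<Sum>a\<in>I. if b = \<pi> (h a) then f a else 0) = f (inv h (inv \<pi> b))"
    if "h \<in> G" "b \<in> I" for h b and f :: "lab \<Rightarrow> 'z::comm_monoid_add"
  proof -
    let ?a = "inv h (inv \<pi> b)"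
    have a: "\<pi> (h ?a) = b"
      using permutes_inverses(1)[OF \<pi>I] permutes_inverses(1)[OF GI[OF that(1)]] by simp
    then have "?a \<in> I" using inI[OF that(1), of ?a] that(2) by simp
    moreover have "b = \<pi> (h c) \<longleftrightarrow> c = ?a" for c
      using a inj[OF that(1), of c ?a] by auto
    ultimately show ?thesis using fin by simp
  qed
  have jump: "jump st b a = (\<Sum>h\<in>G. if b = \<pi> (h a) then 1 else 0) / card G" for a b
  proof -
    have "jump st b a = (\<Sum>m<card G. (if b = \<pi> (e m a) then 1 else 0) / card G)"
      unfolding jump_def st by (intro sum.cong refl) simp
    then show ?thesis
      by (simp only: sum_e[of "\<lambda>h. (if b = \<pi> (h a) then 1 else 0) / real (card G)"] sum_divide_distrib)
  qed
  have colG: "(\<Sum>h\<in>G. \<Sum>a\<in>I. if b = \<pi> (h a) then 1 else 0) = real (card G)" if "b \<in> I" for b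
    using colsum[of _ b "\<lambda>_. 1 :: real"] that by simp
  have rowG: "(\<Sum>h\<in>G. \<Sum>b\<in>I. if b = \<pi> (h a) then 1 else 0) = real (card G)" if "a \<in> I" for a
    using rowsum[of _ a "\<lambda>_. 1 :: real"] that by simp
  interpret bistochastic_step D N st
  proof
    show "2 \<le> bat_u st" "window N st \<subseteq> {0..bat_n st}"
      using u n by (auto simp: st window_def)
    show "0 \<le> weight st m" for m by (simp add: st)
    show "(\<Sum>b\<in>step_basis D st. jump st b a) = 1" if "a \<in> step_basis D st" for a
      using that rowG[of a] cG unfolding I jump sum_divide_distrib[symmetric]
      by (subst sum.swap) simp
    show "(\<Sum>a\<in>step_basis D st. jump st b a) = 1" if "b \<in> step_basis D st" for b
      using that colG[of b] cG unfolding I jump sum_divide_distrib[symmetric]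
      by (subst sum.swap) simp
  qed
  have t_norm: "(\<Sum>a\<in>I. (t a)\<^sup>2) = 1"
    using sum_amplitude_sq[OF d' q] by (simp add: t I)
  have r_blk: "r a = k i x / sqrt (real (bsize u n x))" if "i \<in> {1..D}" "x \<le> n" "a \<in> blk u n i x" for i x a
  proof -
    have "(\<Sum>h\<in>G. (t (\<pi> (h a)))\<^sup>2) / card G = (\<Sum>a\<in>blk u n i x. (t (\<pi> a))\<^sup>2) / bsize u n x"
      using sum_blk_perms[OF that, of "\<lambda>a. (t (\<pi> a))\<^sup>2"] cG bsize_pos[OF u, of n x]
      unfolding G_def[symmetric] by (simp add: field_simps)
    then show ?thesis by (simp add: r_def k_def real_sqrt_divide)
  qed
  have r_sq: "(r a)\<^sup>2 = (\<Sum>h\<in>G. (t (\<pi> (h a)))\<^sup>2) / card G" for a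
    unfolding r_def by (intro real_sqrt_pow2 divide_nonneg_nonneg sum_nonneg) auto
  \<comment> \<open>A vanishing mean of squares forces each term to vanish. Hence at labels with
    \<open>r a = 0\<close> the default Kraus entry meets zero amplitudes on both sides of the
    protocol equation.\<close>
  have r_zero: "t (\<pi> (h a)) = 0" if "r a = 0" "h \<in> G" for h a
  proof -
    have "(\<Sum>h\<in>G. (t (\<pi> (h a)))\<^sup>2) = 0" using r_sq[of a] that cG by simp
    then show ?thesis using that finG by (simp add: sum_nonneg_eq_0_iff)
  qed
  have r_norm: "(\<Sum>a\<in>I. (r a)\<^sup>2) = 1"
  proof -
    have "(\<Sum>a\<in>I. (r a)\<^sup>2) = (\<Sum>h\<in>G. \<Sum>a\<in>I. (t (\<pi> (h a)))\<^sup>2) / card G"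
      unfolding r_sq sum_divide_distrib by (rule sum.swap)
    also have "(\<Sum>h\<in>G. \<Sum>a\<in>I. (t (\<pi> (h a)))\<^sup>2) = (\<Sum>h\<in>G. 1)"
    proof (intro sum.cong refl)
      fix h assume "h \<in> G"
      then have "\<pi> \<circ> h permutes I" using \<pi>I GI permutes_compose by blast
      then show "(\<Sum>a\<in>I. (t (\<pi> (h a)))\<^sup>2) = 1"
        using sum.permute[of "\<pi> \<circ> h" I "\<lambda>a. (t a)\<^sup>2"] t_norm by (simp add: o_def)
    qed
    finally show ?thesis using cG by simp
  qed
  have mass: "mass st i x j y = card {a\<in>blk u n i x. \<pi> a \<in> blk u n j y}"
    if "i \<in> {1..D}" "x \<le> n" "j \<in> {1..D}" "y \<le> n" for i x j y
  proof -
    let ?S = "{a\<in>blk u n i x. \<pi> a \<in> blk u n j y}"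
    have "mass st i x j y = (\<Sum>a\<in>blk u n i x. \<Sum>b\<in>blk u n j y. \<Sum>h\<in>G. if b = \<pi> (h a) then 1 else 0) / card G"
      unfolding mass_def flow_def st jump sum_divide_distrib ..
    also have "(\<Sum>a\<in>blk u n i x. \<Sum>b\<in>blk u n j y. \<Sum>h\<in>G. if b = \<pi> (h a) then 1 else 0 :: real) =
       (\<Sum>h\<in>G. \<Sum>a\<in>blk u n i x. \<Sum>b\<in>blk u n j y. if b = \<pi> (h a) then 1 else 0)"
      by (rule sum_swap3[symmetric])
    also have "\<dots> = (\<Sum>h\<in>G. \<Sum>a\<in>blk u n i x. if \<pi> (h a) \<in> blk u n j y then 1 else 0)"
      by (intro sum.cong refl) (simp add: finite_blk)
    \<comment> \<open>Each h permutes the block (i, x), so it drops out of the count: averaging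
      alters the amplitudes inside the blocks but not the flow between them.\<close>
    also have "\<dots> = (\<Sum>h\<in>G. \<Sum>a\<in>blk u n i x. if \<pi> a \<in> blk u n j y then 1 else 0)"
    proof (rule sum.cong[OF refl])
      fix h assume "h \<in> G"
      then show "(\<Sum>a\<in>blk u n i x. if \<pi> (h a) \<in> blk u n j y then 1 else 0 :: real) =
          (\<Sum>a\<in>blk u n i x. if \<pi> a \<in> blk u n j y then 1 else 0)"
        unfolding G_def by (rule sum_blk_image[OF _ that(1,2), where f = "\<lambda>a. if \<pi> a \<in> blk u n j y then 1 else 0"])
    qed
    also have "\<dots> = card G * real (card ?S)"
      using sum.inter_filter[OF finite_blk, of "\<lambda>_. 1 :: real" u n i x "\<lambda>a. \<pi> a \<in> blk u n j y"] by simp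
    finally show ?thesis using cG by simp
  qed
  have valid: "valid_step D N st"
    unfolding valid_step_def Let_def I
  proof (intro conjI allI impI ballI)
    show "2 \<le> bat_u st" "1 \<le> bat_n st" using u n by (simp_all add: st)
    show "window N st \<subseteq> {0..bat_n st}" by (rule window_subset)
    show "nonneg_battery_form D (bat_u st) (bat_n st) (init_state st)"
      unfolding st(1,2)
    proof (rule nonneg_battery_formI[where k = k])
      show "0 \<le> k i x" for i x unfolding k_def by (intro real_sqrt_ge_zero sum_nonneg) auto
      show "init_state st (a, b) = (if a = b then complex_of_real (k i x / sqrt (real (bsize u n x))) else 0)"
        if "i \<in> {1..D}" "x \<le> n" "a \<in> blk u n i x" for i x a b
        unfolding st(7) r_blk[OF that] ..
    qed
    show "nonneg_battery_form D (bat_u st) (bat_n st) (fin_state st)"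
      unfolding st(1,2)
    proof (rule nonneg_battery_formI[where
          k = "\<lambda>i x. if i \<in> {1..d'} \<and> x \<in> window N st then sqrt (q i) / sqrt (real (N + 1)) else 0"])
      let ?k = "\<lambda>i x. if i \<in> {1..d'} \<and> x \<in> window N st then sqrt (q i) / sqrt (real (N + 1)) else 0"
      show "0 \<le> ?k i x" for i x using q(1)[of i] by auto
      show "fin_state st (a, b) = (if a = b then complex_of_real (?k i x / sqrt (real (bsize u n x))) else 0)"
        if "i \<in> {1..D}" "x \<le> n" "a \<in> blk u n i x" for i x a b
      proof -
        have "t a = ?k i x / sqrt (real (bsize u n x))"
          using amplitude_on_blk[of a i x d' q] that by (simp add: st t mult.commute)
        then show ?thesis unfolding st(8) by (simp only:)
      qed
    qed
    show "vnorm (I \<times> I) (init_state st) = 1"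
      using vnorm_diagonal[OF fin, of "init_state st" r] r_norm by (simp add: st)
    show "vnorm (I \<times> I) (fin_state st) = 1"
      using vnorm_diagonal[OF fin, of "fin_state st" t] t_norm by (simp add: st)
    show "unitary_on I (corr st m)" if "m < outcomes st" for m
    proof -
      have m: "e m \<in> G" using that eG by (simp add: st)
      have "op_mult I (adj (corr st m)) (corr st m) a b = id_op a b" if ab: "a \<in> I" "b \<in> I" for a b
      proof -
        have "op_mult I (adj (corr st m)) (corr st m) a b =
            (\<Sum>c\<in>I. if c = \<pi> (e m a) then (if c = \<pi> (e m b) then 1 else 0) else 0)"
          unfolding op_mult_def adj_def st by (intro sum.cong refl) auto
        also have "\<dots> = (if \<pi> (e m a) = \<pi> (e m b) then 1 else 0)"
          by (rule rowsum[OF m ab(1)])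
        also have "\<dots> = id_op a b"
          by (simp only: inj[OF m] id_op_def)
        finally show ?thesis .
      qed
      moreover have "op_mult I (corr st m) (adj (corr st m)) a b = id_op a b" if ab: "a \<in> I" "b \<in> I" for a b
      proof -
        have "op_mult I (corr st m) (adj (corr st m)) a b =
            (\<Sum>c\<in>I. if a = \<pi> (e m c) then (if b = a then 1 else 0) else 0)"
          unfolding op_mult_def adj_def st by (intro sum.cong refl) auto
        also have "\<dots> = (if b = a then 1 else 0)"
          by (rule colsum[OF m ab(1)])
        also have "\<dots> = id_op a b"
          by (auto simp: id_op_def)
        finally show ?thesis .
      qed
      ultimately show ?thesis by (simp add: unitary_on_def op_eq_def)
    qed
    show "0 \<le> weight st m" for m by (simp add: st)
    show "op_eq I (\<lambda>a b. \<Sum>m<outcomes st. op_mult I (adj (kraus st m)) (kraus st m) a b) id_op"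
      unfolding op_eq_def
    proof (intro ballI)
      fix a b assume ab: "a \<in> I" "b \<in> I"
      let ?s = "\<lambda>c. (1 / real (card G)) * (if r a = 0 then 1 else (t c / r a)\<^sup>2)"
      have M: "op_mult I (adj (kraus st m)) (kraus st m) a b =
          (if a = b then complex_of_real (?s (\<pi> (e m a))) else 0)" if "m < card G" for m
      proof -
        have m: "e m \<in> G" using that by (rule eG)
        let ?K = "sqrt (1 / real (card G)) * (if r a = 0 then 1 else t (\<pi> (e m a)) / r a)"
        have sq: "?K * ?K = ?s (\<pi> (e m a))"
          by (simp add: power2_eq_square[symmetric] power_mult_distrib)
        have "op_mult I (adj (kraus st m)) (kraus st m) a b =
            (\<Sum>c\<in>I. if c = \<pi> (e m a) then cnj (kraus st m c a) * kraus st m c b else 0)"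
          unfolding op_mult_def adj_def st(9) by (intro sum.cong refl) auto
        also have "\<dots> = cnj (kraus st m (\<pi> (e m a)) a) * kraus st m (\<pi> (e m a)) b"
          by (rule rowsum[OF m ab(1)])
        also have "\<dots> = (if a = b then complex_of_real (?s (\<pi> (e m a))) else 0)"
        proof (cases "a = b")
          case True
          have "cnj (kraus st m (\<pi> (e m a)) a) * kraus st m (\<pi> (e m a)) a = complex_of_real (?K * ?K)"
            by (simp add: st(9))
          then show ?thesis unfolding sq using True by simp
        next
          case False
          then show ?thesis by (simp add: st(9) inj[OF m])
        qed
        finally show ?thesis .
      qed
      have "(\<Sum>m<outcomes st. op_mult I (adj (kraus st m)) (kraus st m) a b) =
          (if a = b then complex_of_real (\<Sum>m<card G. ?s (\<pi> (e m a))) else 0)"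
        using M by (simp add: st(4))
      also have "(\<Sum>m<card G. ?s (\<pi> (e m a))) = (\<Sum>h\<in>G. ?s (\<pi> (h a)))"
        by (rule sum_e[of "\<lambda>h. ?s (\<pi> (h a))"])
      also have "\<dots> = 1"
      proof (cases "r a = 0")
        case True
        then show ?thesis using cG by simp
      next
        case False
        then have "(\<Sum>h\<in>G. ?s (\<pi> (h a))) = (\<Sum>h\<in>G. (t (\<pi> (h a)))\<^sup>2) / card G / (r a)\<^sup>2"
          by (simp add: power_divide sum_divide_distrib)
        then show ?thesis using False unfolding r_sq[symmetric] by simp
      qed
      finally show "(\<Sum>m<outcomes st. op_mult I (adj (kraus st m)) (kraus st m) a b) = id_op a b"
        by (simp add: id_op_def)
    qed
    show "op_apply (I \<times> I) (op_tensor (kraus st m) (corr st m)) (init_state st) z =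
        complex_of_real (sqrt (weight st m)) * fin_state st z" if m: "m < outcomes st" and z: "z \<in> I \<times> I" for m z
    proof -
      obtain a b where ab: "z = (a, b)" "a \<in> I" "b \<in> I" using z by auto
      have eG': "e m \<in> G" using m eG by (simp add: st)
      have "op_apply (I \<times> I) (op_tensor (kraus st m) (corr st m)) (init_state st) z =
          (\<Sum>f\<in>I. kraus st m a f * corr st m b f * complex_of_real (r f))"
        unfolding op_apply_def ab(1)
        by (subst sum_product_diagonal[OF fin]) (auto simp: st(7) op_tensor_def)
      also have "\<dots> = (\<Sum>f\<in>I. if a = \<pi> (e m f) then
          (if a = b then complex_of_real (sqrt (weight st m) * t a) else 0) else 0)"
        using r_zero[OF _ eG'] by (intro sum.cong refl) (auto simp: st(5,6,9))
      also have "\<dots> = (if a = b then complex_of_real (sqrt (weight st m) * t a) else 0)"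
        by (rule colsum[OF eG' ab(2)])
      finally show ?thesis by (auto simp: ab(1) st(8))
    qed
  qed
  have k0: "0 \<le> k i x" for i x
    unfolding k_def by (intro real_sqrt_ge_zero sum_nonneg) auto
  have init: "init_state st (a, b) = (if a = b then complex_of_real (k i x / sqrt (real (bsize u n x))) else 0)"
    if "i \<in> {1..D}" "x \<le> n" "a \<in> blk u n i x" for i x a b
    unfolding st(7) r_blk[OF that] ..
  show ?thesis
    by (rule exI[of _ st], rule exI[of _ k], intro conjI allI ballI)
       (use valid mass k0 in \<open>simp_all add: st t init del: st(7)\<close>)
qed

section \<open>Protocol steps realizing prescribed fluctuations\<close>

text \<open>
  The optimal fluctuation \<open>w = log (q\<^sub>j / p\<^sub>i)\<close> is split into two equally likely values, shifted by
  \<open>log (lam r)\<close>. With \<open>lam True + lam False = 2\<close> the condition \<open>\<Sum>\<^bsub>j,w\<^esub> P(i,w|j) 2\<^sup>w = 1\<close> is kept, and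
  the mean changes by \<open>log (lam True lam False) / 2\<close>, which can be any number \<open>\<le> 0\<close>.
\<close>

definition gain :: "(nat \<Rightarrow> real) \<Rightarrow> (nat \<Rightarrow> real) \<Rightarrow> (bool \<Rightarrow> real) \<Rightarrow> nat \<Rightarrow> nat \<Rightarrow> bool \<Rightarrow> real" where
  "gain p q lam i j r = log 2 (q j * lam r / p i)"

text \<open>Rounding is downwards so that the target block is never larger than the ideal ratio of
  sizes allows; otherwise the prescribed shares could exceed the source block.\<close>

definition shift :: "nat \<Rightarrow> (nat \<Rightarrow> real) \<Rightarrow> (nat \<Rightarrow> real) \<Rightarrow> (bool \<Rightarrow> real) \<Rightarrow> nat \<Rightarrow> nat \<Rightarrow> bool \<Rightarrow> int" where
  "shift u p q lam i j r = \<lfloor>gain p q lam i j r / delta_w u\<rfloor>"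

text \<open>The number of labels that a final block of level y should receive from the index i for
  one of the two equally likely values, hence the factor 1/2. Rounding down keeps the total within
  the block.\<close>

definition share :: "nat \<Rightarrow> nat \<Rightarrow> (nat \<Rightarrow> real) \<Rightarrow> nat \<Rightarrow> nat \<Rightarrow> nat" where
  "share u n p i y = nat \<lfloor>real (bsize u n y) * p i / 2\<rfloor>"

lemma share_le: "0 \<le> p i \<Longrightarrow> real (share u n p i y) \<le> real (bsize u n y) * p i / 2"
  unfolding share_def by (rule of_nat_floor) simp

lemma share_ge: "real (bsize u n y) * p i / 2 - 1 \<le> real (share u n p i y)"
  unfolding share_def by linarith

lemma shift_mult_delta_w:
  assumes "2 \<le> u"
  shows "of_int (shift u p q lam i j r) * delta_w u \<le> gain p q lam i j r"
    and "gain p q lam i j r - delta_w u \<le> of_int (shift u p q lam i j r) * delta_w u"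
proof -
  let ?k = "real_of_int (shift u p q lam i j r)" and ?v = "gain p q lam i j r"
  have \<delta>: "0 < delta_w u" by (rule delta_w_pos[OF assms])
  have "?k \<le> ?v / delta_w u" unfolding shift_def by simp
  then show "?k * delta_w u \<le> ?v" using \<delta> by (simp add: pos_le_divide_eq)
  have "?v / delta_w u < ?k + 1" unfolding shift_def by linarith
  then have "?v < (?k + 1) * delta_w u" using \<delta> by (simp add: pos_divide_less_eq)
  then show "?v - delta_w u \<le> ?k * delta_w u" by (simp add: algebra_simps)
qed

lemma bsize_shift_int:
  assumes "2 \<le> u" "x \<le> n" "0 \<le> int x + k" "int x + k \<le> int n"
  shows "real (bsize u n (nat (int x + k))) = real (bsize u n x) * 2 powr (of_int k * delta_w u)"
  using bsize_shift[OF assms(1,2), of "nat (int x + k)"] assms by simp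

text \<open>The first bound keeps the source blocks from overflowing; the second says that rounding
  the shift loses at most the factor \<open>2 powr (- delta_w u)\<close>, which tends to 1 as u
  grows.\<close>

lemma powr_shift_bounds:
  assumes "2 \<le> u" "0 < p i" "0 < q j" "0 < lam r"
  shows "2 powr (of_int (shift u p q lam i j r) * delta_w u) * p i \<le> q j * lam r"
    and "2 powr (- delta_w u) * (q j * lam r) \<le> 2 powr (of_int (shift u p q lam i j r) * delta_w u) * p i"
proof -
  let ?s = "of_int (shift u p q lam i j r) * delta_w u" and ?v = "gain p q lam i j r"
  have v: "2 powr ?v = q j * lam r / p i"
    unfolding gain_def using assms by simp
  have "2 powr ?s \<le> 2 powr ?v"
    using shift_mult_delta_w(1)[OF assms(1)] by (intro powr_mono) auto
  then show "2 powr ?s * p i \<le> q j * lam r"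
    unfolding v using assms by (simp add: pos_le_divide_eq)
  have "2 powr (?v - delta_w u) \<le> 2 powr ?s"
    using shift_mult_delta_w(2)[OF assms(1)] by (intro powr_mono) auto
  then have "2 powr (- delta_w u) * 2 powr ?v \<le> 2 powr ?s"
    by (simp add: powr_diff powr_minus divide_inverse mult.commute)
  then show "2 powr (- delta_w u) * (q j * lam r) \<le> 2 powr ?s * p i"
    unfolding v using assms by (simp add: pos_divide_le_eq)
qed

section \<open>Transport between blocks with the prescribed shares\<close>

lemma blk_eq_or_disjoint:
  "x \<le> n \<Longrightarrow> y \<le> n \<Longrightarrow> blk u n i x = blk u n j y \<or> blk u n i x \<inter> blk u n j y = {}"
  using blk_disjoint[of _ u n i x j y] by blast

lemma blk_eq_iff:
  assumes "2 \<le> u" "x \<le> n" "y \<le> n"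
  shows "blk u n i x = blk u n j y \<longleftrightarrow> i = j \<and> x = y"
proof
  assume eq: "blk u n i x = blk u n j y"
  have "blk u n i x \<noteq> {}"
    using card_blk[OF assms(2), of u i] bsize_pos[OF assms(1), of n x] by auto
  then show "i = j \<and> x = y" using blk_disjoint eq assms by blast
qed simp

text \<open>Both capacities are met. A target block of size g receives at most
  \<open>g * p i / 2\<close> for each i and r, in total g because p sums to 1. A source block of
  size g sends at most \<open>g * q j * lam r / 2\<close> for each j and r, in total g because q
  sums to 1 and lam to 2.\<close>

lemma transport_permutation:
  assumes u: "2 \<le> u" and d: "d \<le> D" "d' \<le> D"
    and p: "\<And>i. i \<in> {1..d} \<Longrightarrow> 0 < p i" "(\<Sum>i=1..d. p i) = 1"
    and q: "\<And>j. j \<in> {1..d'} \<Longrightarrow> 0 < q j" "(\<Sum>j=1..d'. q j) = 1"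
    and lam: "\<And>r. 0 < lam r" "lam True + lam False = 2"
  shows "\<exists>\<pi>. \<pi> permutes loc_basis D u n \<and>
    (\<forall>i\<in>{1..d}. \<forall>j\<in>{1..d'}. \<forall>x\<in>{0..n}. \<forall>y\<in>{0..n}.
      (\<Sum>r\<in>UNIV. if int y = int x + shift u p q lam i j r then share u n p i y else 0) \<le>
      card {a\<in>blk u n i x. \<pi> a \<in> blk u n j y})"
proof -
  txt \<open>
    A slot \<open>(i, x, j, r)\<close> stands for \<open>share u n p i (x + k)\<close> elements of block \<open>(i, x)\<close> that are sent
    to block \<open>(j, x + k)\<close>.
  \<close>
  define k where "k = shift u p q lam"
  define S where "S = (\<lambda>(i, x, j :: nat, r :: bool). blk u n i x)"
  define y where "y = (\<lambda>(i, x, j, r). nat (int x + k i j r))"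
  define T where "T e = (case e of (i, x, j, r) \<Rightarrow> blk u n j (y e))" for e
  define c where "c e = share u n p (fst e) (y e)" for e
  define E where "E = {(i, x, j, r). i \<in> {1..d} \<and> x \<in> {0..n} \<and> j \<in> {1..d'} \<and> 0 \<le> int x + k i j r \<and> int x + k i j r \<le> int n}"
  have "E \<subseteq> {1..d} \<times> {0..n} \<times> {1..d'} \<times> UNIV" by (auto simp: E_def)
  then have finE: "finite E" by (rule finite_subset) simp
  have yn: "y e \<le> n" if "e \<in> E" for e using that by (auto simp: E_def y_def)
  have c_le_T: "real (c (i, x, j, r)) \<le> bsize u n (y (i, x, j, r)) * p i / 2" if "(i, x, j, r) \<in> E" for i x j r
    using share_le[of p i u n] p(1)[of i] that by (auto simp: c_def E_def)
  have c_le_S: "real (c (i, x, j, r)) \<le> bsize u n x * (q j * lam r) / 2" if e: "(i, x, j, r) \<in> E" for i x j r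
  proof -
    have "real (bsize u n (y (i, x, j, r))) = real (bsize u n x) * 2 powr (of_int (k i j r) * delta_w u)"
      unfolding y_def prod.case using e by (intro bsize_shift_int u) (auto simp: E_def)
    then have "bsize u n (y (i, x, j, r)) * p i / 2 = bsize u n x * (2 powr (of_int (k i j r) * delta_w u) * p i) / 2"
      by simp
    also have "\<dots> \<le> bsize u n x * (q j * lam r) / 2"
      unfolding k_def using e
      by (intro divide_right_mono mult_left_mono powr_shift_bounds(1) u p q lam) (auto simp: E_def)
    finally show ?thesis using c_le_T[OF e] by simp
  qed
  have lam_sum: "(\<Sum>r\<in>UNIV. lam r) = 2" using lam(2) by (simp add: UNIV_bool add.commute)
  have S_le: "(\<Sum>e'\<in>{e'\<in>E. S e' = S e}. c e') \<le> card (S e)" if e: "e \<in> E" for e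
  proof -
    obtain i x j r where ijr: "e = (i, x, j, r)" by (cases e)
    have x: "x \<le> n" using e by (auto simp: ijr E_def)
    let ?F = "{i} \<times> {x} \<times> {1..d'} \<times> (UNIV :: bool set)"
    let ?h = "\<lambda>(i :: nat, x' :: nat, j, r). real (bsize u n x) * (q j * lam r) / 2"
    have sub: "{e'\<in>E. S e' = S e} \<subseteq> ?F"
    proof
      fix e' assume e': "e' \<in> {e'\<in>E. S e' = S e}"
      obtain i' x' j' r' where ijr': "e' = (i', x', j', r')" by (cases e')
      show "e' \<in> ?F"
        using e' x blk_eq_iff[OF u _ x, of x' i' i] by (auto simp: ijr ijr' S_def E_def)
    qed
    have "real (\<Sum>e'\<in>{e'\<in>E. S e' = S e}. c e') \<le> (\<Sum>e'\<in>{e'\<in>E. S e' = S e}. ?h e')"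
      unfolding of_nat_sum
    proof (rule sum_mono)
      fix e' assume e': "e' \<in> {e'\<in>E. S e' = S e}"
      then obtain j' r' where "e' = (i, x, j', r')" using sub by auto
      then show "real (c e') \<le> ?h e'" using c_le_S e' by simp
    qed
    also have "\<dots> \<le> (\<Sum>e'\<in>?F. ?h e')"
      by (rule sum_mono2[OF _ sub]) (use q(1) lam(1) in \<open>auto simp: less_imp_le\<close>)
    also have "\<dots> = (\<Sum>j=1..d'. \<Sum>r\<in>UNIV. real (bsize u n x) * (q j * lam r) / 2)"
      by (simp add: sum.cartesian_product[symmetric])
    also have "\<dots> = real (bsize u n x) * ((\<Sum>j=1..d'. q j) * (\<Sum>r\<in>UNIV. lam r)) / 2"
      by (simp only: sum_distrib_left[symmetric] sum_distrib_right[symmetric] sum_divide_distrib[symmetric])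
    also have "\<dots> = card (S e)"
      using lam_sum q(2) by (simp add: ijr S_def card_blk[OF x])
    finally show ?thesis by (simp only: of_nat_le_iff)
  qed
  have T_le: "(\<Sum>e'\<in>{e'\<in>E. T e' = T e}. c e') \<le> card (T e)" if e: "e \<in> E" for e
  proof -
    let ?h = "\<lambda>(i, r :: bool). real (bsize u n (y e)) * p i / 2"
    \<comment> \<open>For a fixed target block, j and the target level are fixed, and the source
      level is recovered by subtracting the shift. A slot is therefore determined by i and r, and
      the bound can be summed over these pairs.\<close>
    let ?pr = "\<lambda>(i, x :: nat, j :: nat, r). (i, r :: bool)"
    have same: "y e' = y e \<and> fst (snd (snd e')) = fst (snd (snd e))" if "e' \<in> E" "T e' = T e" for e'
      using that blk_eq_iff[OF u yn[OF that(1)] yn[OF e]] by (auto simp: T_def split: prod.splits)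
    have inj: "inj_on ?pr {e'\<in>E. T e' = T e}"
    proof (rule inj_onI)
      fix a b assume a: "a \<in> {e'\<in>E. T e' = T e}" and b: "b \<in> {e'\<in>E. T e' = T e}" and eq: "?pr a = ?pr b"
      obtain i x j r where a': "a = (i, x, j, r)" by (cases a)
      obtain i' x' j' r' where b': "b = (i', x', j', r')" by (cases b)
      have "y a = y b" "j = j'" "i = i'" "r = r'" using a b eq same[of a] same[of b] by (auto simp: a' b')
      then show "a = b" using a b by (auto simp: a' b' y_def E_def)
    qed
    have "real (\<Sum>e'\<in>{e'\<in>E. T e' = T e}. c e') \<le> (\<Sum>e'\<in>{e'\<in>E. T e' = T e}. ?h (?pr e'))"
      unfolding of_nat_sum
    proof (rule sum_mono)
      fix e' assume e': "e' \<in> {e'\<in>E. T e' = T e}"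
      obtain i x j r where ijr: "e' = (i, x, j, r)" by (cases e')
      have "y e' = y e" using e' same by blast
      then show "real (c e') \<le> ?h (?pr e')" using c_le_T[of i x j r] e' by (simp add: ijr)
    qed
    also have "\<dots> = (\<Sum>ir\<in>?pr ` {e'\<in>E. T e' = T e}. ?h ir)"
      using inj by (simp add: sum.reindex)
    also have "\<dots> \<le> (\<Sum>ir\<in>{1..d} \<times> UNIV. ?h ir)"
      by (rule sum_mono2) (use p(1) in \<open>auto simp: E_def less_imp_le\<close>)
    also have "\<dots> = (\<Sum>i=1..d. \<Sum>r\<in>(UNIV::bool set). real (bsize u n (y e)) * p i / 2)"
      by (simp add: sum.cartesian_product[symmetric])
    also have "\<dots> = real (bsize u n (y e)) * (\<Sum>i=1..d. p i)"
      by (simp add: sum_distrib_left)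
    also have "\<dots> = card (T e)"
      using p(2) by (simp add: T_def split_beta card_blk[OF yn[OF e]])
    finally show ?thesis by (simp only: of_nat_le_iff)
  qed
  have sub: "S e \<subseteq> loc_basis D u n" "T e \<subseteq> loc_basis D u n" if "e \<in> E" for e
    using that yn[OF that] d by (auto simp: E_def S_def T_def blk_def loc_basis_def battery_basis_def split: prod.splits)
  have disjS: "S e = S e' \<or> S e \<inter> S e' = {}" if "e \<in> E" "e' \<in> E" for e e'
    using that blk_eq_or_disjoint by (simp add: E_def S_def split_beta)
  have disjT: "T e = T e' \<or> T e \<inter> T e' = {}" if "e \<in> E" "e' \<in> E" for e e'
    using yn[OF that(1)] yn[OF that(2)] blk_eq_or_disjoint by (simp add: T_def split_beta)
  obtain \<pi> where \<pi>: "\<pi> permutes loc_basis D u n"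
    "\<And>X Y. finite X \<Longrightarrow> (\<Sum>e\<in>{e\<in>E. S e = X \<and> T e = Y}. c e) \<le> card {a\<in>X. \<pi> a \<in> Y}"
    using permutation_with_prescribed_flow[where S = S and T = T and c = c,
        OF finite_loc_basis finE sub disjS disjT S_le T_le] by blast
  have "(\<Sum>r\<in>UNIV. if int z = int x + k i j r then share u n p i z else 0) \<le>
      card {a\<in>blk u n i x. \<pi> a \<in> blk u n j z}"
    if ij: "i \<in> {1..d}" "j \<in> {1..d'}" "x \<in> {0..n}" "z \<in> {0..n}" for i j x z
  proof -
    \<comment> \<open>The two values of r may be rounded to the same shift; both slots then join the
      same pair of blocks and their shares add.\<close>
    let ?R = "{r. int z = int x + k i j r}"
    have "(\<Sum>r\<in>UNIV. if int z = int x + k i j r then share u n p i z else 0) = (\<Sum>r\<in>?R. share u n p i z)"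
      by (subst sum.inter_filter[symmetric]) auto
    also have "\<dots> = (\<Sum>r\<in>?R. c (i, x, j, r))"
    proof (intro sum.cong refl)
      fix r assume "r \<in> ?R"
      then have "int x + k i j r = int z" by simp
      then show "share u n p i z = c (i, x, j, r)" by (simp add: c_def y_def)
    qed
    also have "\<dots> = (\<Sum>e\<in>(\<lambda>r. (i, x, j, r)) ` ?R. c e)"
      by (subst sum.reindex) (auto simp: inj_on_def)
    also have "\<dots> \<le> (\<Sum>e\<in>{e\<in>E. S e = blk u n i x \<and> T e = blk u n j z}. c e)"
    proof (rule sum_mono2)
      show "(\<lambda>r. (i, x, j, r)) ` ?R \<subseteq> {e\<in>E. S e = blk u n i x \<and> T e = blk u n j z}"
      proof (intro image_subsetI CollectI conjI)
        fix r assume r: "r \<in> ?R"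
        then have "int x + k i j r = int z" by simp
        then show "(i, x, j, r) \<in> E" "T (i, x, j, r) = blk u n j z"
          using ij by (simp_all add: E_def T_def y_def)
        show "S (i, x, j, r) = blk u n i x" by (simp add: S_def)
      qed
    qed (use finE in auto)
    also have "\<dots> \<le> card {a\<in>blk u n i x. \<pi> a \<in> blk u n j z}"
      by (rule \<pi>(2)[OF finite_blk])
    finally show ?thesis .
  qed
  then show ?thesis using \<pi>(1) unfolding k_def by blast
qed

text \<open>The window is {N..2N} inside {0..3N}, and shifts are at most \<open>N / 2\<close>, so
  from any window level every prescribed shift stays inside the battery in both directions. The flow
  is bounded only from below; the conservation laws of the bistochastic matrix supply the upper
  bounds.\<close>

locale transport_step = bistochastic_step D N st for D N st +
  fixes d d' :: nat and p q :: "nat \<Rightarrow> real" and lam :: "bool \<Rightarrow> real" and w_max :: real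
    and k :: "nat \<Rightarrow> nat \<Rightarrow> real"
  assumes d: "d \<le> D" "d' \<le> D"
    and p: "\<And>i. i \<in> {1..d} \<Longrightarrow> 0 < p i" "(\<Sum>i=1..d. p i) = 1"
    and q: "\<And>j. j \<in> {1..d'} \<Longrightarrow> 0 < q j" "(\<Sum>j=1..d'. q j) = 1"
    and lam: "\<And>r. 0 < lam r" "lam True + lam False = 2"
    and valid: "valid_step D N st"
    and n_eq: "bat_n st = 3 * N" and start: "win_start st = N"
    and mass_ge_share: "\<And>i j x y. i \<in> {1..d} \<Longrightarrow> j \<in> {1..d'} \<Longrightarrow> x \<le> bat_n st \<Longrightarrow> y \<le> bat_n st \<Longrightarrow>
      (\<Sum>r\<in>UNIV. if int y = int x + shift (bat_u st) p q lam i j r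
         then real (share (bat_u st) (bat_n st) p i y) else 0) \<le> mass st i x j y"
    and fin_state_eq: "\<And>a b. a \<in> step_basis D st \<Longrightarrow> b \<in> step_basis D st \<Longrightarrow>
      fin_state st (a, b) = (if a = b then complex_of_real (amplitude N d' q st a) else 0)"
    and k_nonneg: "\<And>i x. 0 \<le> k i x"
    and init_state_eq: "\<And>i x a b. i \<in> {1..D} \<Longrightarrow> x \<le> bat_n st \<Longrightarrow> a \<in> blk (bat_u st) (bat_n st) i x \<Longrightarrow>
      b \<in> step_basis D st \<Longrightarrow> init_state st (a, b) =
        (if a = b then complex_of_real (k i x / sqrt (real (bsize (bat_u st) (bat_n st) x))) else 0)"
    and shift_le: "\<And>i j r. i \<in> {1..d} \<Longrightarrow> j \<in> {1..d'} \<Longrightarrow>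
      \<bar>shift (bat_u st) p q lam i j r\<bar> \<le> Kmax w_max (bat_u st)"
    and Kmax_le: "2 * Kmax w_max (bat_u st) \<le> int N" and w_max: "0 < w_max"
begin

abbreviation kk where "kk i j r \<equiv> shift (bat_u st) p q lam i j r"
abbreviation cnt where "cnt i y \<equiv> real (share (bat_u st) (bat_n st) p i y)"
abbreviation K where "K \<equiv> Kmax w_max (bat_u st)"

lemma mem_window: "y \<in> window N st \<longleftrightarrow> N \<le> y \<and> y \<le> 2 * N"
  by (auto simp: window_def start)

lemma K_nonneg: "0 \<le> K"
  by (rule Kmax_nonneg[OF w_max u_ge_2])

lemma g_ge: "N \<le> x \<Longrightarrow> 2 ^ N \<le> g x"
proof -
  assume "N \<le> x"
  then have "(2::nat) ^ N \<le> 2 ^ x" by (intro power_increasing) auto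
  also have "\<dots> \<le> u ^ x" using u_ge_2 by (intro power_mono) auto
  also have "\<dots> \<le> bsize u n x" using u_ge_2 by (simp add: bsize_def)
  finally have "real (2 ^ N) \<le> g x" by (simp only: of_nat_le_iff)
  then show ?thesis by simp
qed

lemma divide_g_le: "N \<le> x \<Longrightarrow> 0 \<le> c \<Longrightarrow> c / g x \<le> c / 2 ^ N"
  using g_pos[of x] by (intro divide_left_mono g_ge mult_pos_pos) auto

text \<open>For a final level in the window, each r points back to exactly one initial level, which
  exists in the battery and is near; the sum over levels thus collapses to a sum over r.\<close>

lemma slot_sum_to:
  assumes y: "y \<in> window N st" and ij: "i \<in> {1..d}" "j \<in> {1..d'}"
  shows "(\<Sum>x\<in>near w_max st y. (\<Sum>r\<in>UNIV. if int y = int x + kk i j r then F else 0) * h (int y - int x)) =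
    (\<Sum>r\<in>UNIV. F * h (kk i j r) :: real)"
proof -
  have "(\<Sum>x\<in>near w_max st y. (\<Sum>r\<in>UNIV. if int y = int x + kk i j r then F else 0) * h (int y - int x)) =
      (\<Sum>r\<in>UNIV. \<Sum>x\<in>near w_max st y. if x = nat (int y - kk i j r) then F * h (kk i j r) else 0)"
    unfolding sum_distrib_right
  proof (subst sum.swap, intro sum.cong refl)
    fix r x assume "x \<in> near w_max st y"
    have "0 \<le> int y - kk i j r"
      using shift_le[OF ij, of r] y Kmax_le K_nonneg by (auto simp: mem_window)
    then have "int y = int x + kk i j r \<longleftrightarrow> x = nat (int y - kk i j r)" by auto
    then show "(if int y = int x + kk i j r then F else 0) * h (int y - int x) =
        (if x = nat (int y - kk i j r) then F * h (kk i j r) else 0)" by auto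
  qed
  also have "\<dots> = (\<Sum>r\<in>UNIV. F * h (kk i j r))"
  proof (intro sum.cong refl)
    fix r
    have "nat (int y - kk i j r) \<in> near w_max st y"
      using shift_le[OF ij, of r] y Kmax_le K_nonneg by (auto simp: mem_window near_def n_eq)
    then show "(\<Sum>x\<in>near w_max st y. if x = nat (int y - kk i j r) then F * h (kk i j r) else 0) =
        F * h (kk i j r)" by (simp add: finite_near)
  qed
  finally show ?thesis .
qed

lemma slot_sum_from:
  assumes x: "x \<in> window N st" and ij: "i \<in> {1..d}" "j \<in> {1..d'}"
  shows "(\<Sum>y\<in>near w_max st x. \<Sum>r\<in>UNIV. if int y = int x + kk i j r then F y else 0) =
    (\<Sum>r\<in>UNIV. F (nat (int x + kk i j r)) :: real)"
proof -
  have "(\<Sum>y\<in>near w_max st x. \<Sum>r\<in>UNIV. if int y = int x + kk i j r then F y else 0) =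
      (\<Sum>r\<in>UNIV. \<Sum>y\<in>near w_max st x. if y = nat (int x + kk i j r) then F y else 0)"
  proof (subst sum.swap, intro sum.cong refl)
    fix r y assume "y \<in> near w_max st x"
    have "0 \<le> int x + kk i j r"
      using shift_le[OF ij, of r] x Kmax_le K_nonneg by (auto simp: mem_window)
    then show "(if int y = int x + kk i j r then F y else 0) =
        (if y = nat (int x + kk i j r) then F y else 0)" by auto
  qed
  also have "\<dots> = (\<Sum>r\<in>UNIV. F (nat (int x + kk i j r)))"
  proof (intro sum.cong refl)
    fix r
    have "nat (int x + kk i j r) \<in> near w_max st x"
      using shift_le[OF ij, of r] x Kmax_le K_nonneg by (auto simp: mem_window near_def n_eq)
    then show "(\<Sum>y\<in>near w_max st x. if y = nat (int x + kk i j r) then F y else 0) =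
        F (nat (int x + kk i j r))" by (simp add: finite_near)
  qed
  finally show ?thesis .
qed

lemma average_window_le:
  assumes "\<And>y. y \<in> window N st \<Longrightarrow> f y \<le> (c::real)"
  shows "1 / real (N + 1) * (\<Sum>y\<in>window N st. f y) \<le> c"
proof -
  have "(\<Sum>y\<in>window N st. f y) \<le> real (N + 1) * c"
    using sum_mono[of "window N st" f "\<lambda>_. c"] assms by (simp add: card_window)
  then show ?thesis by (simp add: pos_divide_le_eq mult.commute)
qed

lemma sum_share_bound: "(\<Sum>i=1..d. 2 * (g y * p i / 2 - 1)) = g y - 2 * real d"
proof -
  have "(\<Sum>i=1..d. 2 * (g y * p i / 2 - 1)) = (\<Sum>i=1..d. g y * p i - 2)"
    by (intro sum.cong refl) simp
  also have "\<dots> = g y * (\<Sum>i=1..d. p i) - 2 * real d"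
    by (simp add: sum_subtractf sum_distrib_left)
  finally show ?thesis using p(2) by simp
qed

text \<open>There are \<open>2 * d\<close> pairs (i, r), and rounding down the share costs each of
  them at most one label.\<close>

lemma sum_mass_to_ge:
  assumes "y \<in> window N st" "j \<in> {1..d'}"
  shows "g y - 2 * real d \<le> (\<Sum>i=1..d. \<Sum>x\<in>near w_max st y. mass st i x j y)"
proof -
  have "g y - 2 * real d = (\<Sum>i=1..d. 2 * (g y * p i / 2 - 1))"
    by (simp only: sum_share_bound)
  also have "\<dots> \<le> (\<Sum>i=1..d. 2 * cnt i y)"
    by (intro sum_mono mult_left_mono share_ge) simp
  also have "\<dots> = (\<Sum>i=1..d. \<Sum>x\<in>near w_max st y. \<Sum>r\<in>UNIV. if int y = int x + kk i j r then cnt i y else 0)"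
    using slot_sum_to[OF assms(1) _ assms(2), where h = "\<lambda>_. 1"] by (intro sum.cong refl) simp
  also have "\<dots> \<le> (\<Sum>i=1..d. \<Sum>x\<in>near w_max st y. mass st i x j y)"
    using assms window_le by (intro sum_mono mass_ge_share) (auto simp: near_def)
  finally show ?thesis .
qed

lemma norm_far_weight_final_le:
  "norm (far_weight_final w_max D d d' N st) \<le> 2 * real d * real d' / 2 ^ N"
proof -
  let ?t = "\<lambda>y j. 1 - (\<Sum>i=1..d. \<Sum>x\<in>near w_max st y. mass st i x j y / g y)"
  have t: "?t y j = 1 - (\<Sum>i=1..d. \<Sum>x\<in>near w_max st y. mass st i x j y) / g y" for y j
    by (simp only: sum_divide_distrib)
  have le: "?t y j \<le> 2 * real d / 2 ^ N" if "y \<in> window N st" "j \<in> {1..d'}" for y j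
  proof -
    have "?t y j \<le> 2 * real d / g y"
      unfolding t using divide_right_mono[OF sum_mass_to_ge[OF that], of "g y"] g_pos[of y]
      by (simp add: diff_divide_distrib)
    also have "\<dots> \<le> 2 * real d / 2 ^ N"
      using that by (intro divide_g_le) (auto simp: mem_window)
    finally show ?thesis .
  qed
  have ge: "0 \<le> ?t y j" if "y \<in> window N st" "j \<in> {1..d'}" for y j
    unfolding t using sum_mass_to_le[OF d(1) _ near_subset window_le[OF that(1)], of j w_max] g_pos[of y] that d
    by simp
  have "1 / real (N + 1) * (\<Sum>y\<in>window N st. \<Sum>j=1..d'. ?t y j) \<le> (\<Sum>j=1..d'. 2 * real d / 2 ^ N)"
    by (intro average_window_le sum_mono le)
  moreover have "0 \<le> 1 / real (N + 1) * (\<Sum>y\<in>window N st. \<Sum>j=1..d'. ?t y j)"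
    by (intro mult_nonneg_nonneg sum_nonneg ge) auto
  ultimately show ?thesis
    unfolding far_weight_final_eq[OF d] norm_of_real by (simp add: mult_ac)
qed

text \<open>Two roundings cause the loss here: that of the shift costs the factor
  \<open>2 powr (- delta_w u)\<close>, and that of the share costs one label for each of the
  \<open>2 * d'\<close> pairs (j, r).\<close>

lemma sum_mass_from_ge:
  assumes x: "x \<in> window N st" and i: "i \<in> {1..d}"
  shows "g x * 2 powr (- delta_w u) - 2 * real d' \<le> (\<Sum>j=1..d'. \<Sum>y\<in>near w_max st x. mass st i x j y)"
proof -
  have lam_sum: "(\<Sum>r\<in>UNIV. lam r) = 2" using lam(2) by (simp add: UNIV_bool add.commute)
  have "g x * 2 powr (- delta_w u) - 2 * real d' =
      g x * 2 powr (- delta_w u) * ((\<Sum>j=1..d'. q j) * (\<Sum>r\<in>UNIV. lam r)) / 2 - (\<Sum>j=1..d'. \<Sum>r\<in>(UNIV::bool set). 1)"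
    using lam_sum q(2) by simp
  also have "\<dots> = (\<Sum>j=1..d'. \<Sum>r\<in>UNIV. g x * 2 powr (- delta_w u) * (q j * lam r) / 2 - 1)"
    by (simp only: sum_distrib_left[symmetric] sum_distrib_right[symmetric] sum_divide_distrib[symmetric] sum_subtractf)
  also have "\<dots> \<le> (\<Sum>j=1..d'. \<Sum>r\<in>UNIV. cnt i (nat (int x + kk i j r)))"
  proof (intro sum_mono)
    fix j r assume j: "j \<in> {1..d'}"
    have rng: "0 \<le> int x + kk i j r" "int x + kk i j r \<le> int n"
      using shift_le[OF i j, of r] x Kmax_le K_nonneg by (auto simp: mem_window n_eq)
    have "g x * (2 powr (- delta_w u) * (q j * lam r)) \<le> g x * (2 powr (of_int (kk i j r) * delta_w u) * p i)"
      using g_pos[of x] by (intro mult_left_mono powr_shift_bounds(2) u_ge_2 p i q j lam) auto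
    also have "\<dots> = g (nat (int x + kk i j r)) * p i"
      using bsize_shift_int[OF u_ge_2 window_le[OF x] rng] by simp
    finally show "g x * 2 powr (- delta_w u) * (q j * lam r) / 2 - 1 \<le> cnt i (nat (int x + kk i j r))"
      using share_ge[of u n "nat (int x + kk i j r)" p i] by (simp add: mult.assoc)
  qed
  also have "\<dots> = (\<Sum>j=1..d'. \<Sum>y\<in>near w_max st x. \<Sum>r\<in>UNIV. if int y = int x + kk i j r then cnt i y else 0)"
    using slot_sum_from[OF x i, where F = "cnt i"] by (intro sum.cong refl) simp
  also have "\<dots> \<le> (\<Sum>j=1..d'. \<Sum>y\<in>near w_max st x. mass st i x j y)"
    using x i window_le by (intro sum_mono mass_ge_share) (auto simp: near_def)
  finally show ?thesis .
qed

lemma norm_far_weight_initial_le: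
  "norm (far_weight_initial w_max D d d' N st) \<le> real d * (1 - 2 powr (- delta_w u) + 2 * real d' / 2 ^ N)"
proof -
  let ?t = "\<lambda>x i. 1 - (\<Sum>j=1..d'. \<Sum>y\<in>near w_max st x. mass st i x j y / g x)"
  have t: "?t x i = 1 - (\<Sum>j=1..d'. \<Sum>y\<in>near w_max st x. mass st i x j y) / g x" for x i
    by (simp only: sum_divide_distrib)
  have le: "?t x i \<le> 1 - 2 powr (- delta_w u) + 2 * real d' / 2 ^ N" if "x \<in> window N st" "i \<in> {1..d}" for x i
  proof -
    have "?t x i \<le> 1 - 2 powr (- delta_w u) + 2 * real d' / g x"
      unfolding t using divide_right_mono[OF sum_mass_from_ge[OF that], of "g x"] g_pos[of x]
      by (simp add: diff_divide_distrib)
    also have "2 * real d' / g x \<le> 2 * real d' / 2 ^ N"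
      using that by (intro divide_g_le) (auto simp: mem_window)
    finally show ?thesis by simp
  qed
  have ge: "0 \<le> ?t x i" if "x \<in> window N st" "i \<in> {1..d}" for x i
    unfolding t using sum_mass_from_le[OF d(2) _ near_subset window_le[OF that(1)], of i w_max] g_pos[of x] that d
    by simp
  have "1 / real (N + 1) * (\<Sum>x\<in>window N st. \<Sum>i=1..d. ?t x i) \<le>
      (\<Sum>i=1..d. 1 - 2 powr (- delta_w u) + 2 * real d' / 2 ^ N)"
    by (intro average_window_le sum_mono le)
  moreover have "0 \<le> 1 / real (N + 1) * (\<Sum>x\<in>window N st. \<Sum>i=1..d. ?t x i)"
    by (intro mult_nonneg_nonneg sum_nonneg ge) auto
  ultimately show ?thesis
    unfolding far_weight_initial_eq[OF d] norm_of_real by simp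
qed

text \<open>The prescribed shares alone give weight \<open>p i / 2\<close> to each value of r, up to
  one label each; this accounts for the summand 2. The summand \<open>2 * real d\<close> bounds the
  extra flow created by the arbitrary matching of leftovers.\<close>

lemma fluct_close:
  assumes i: "i \<in> {1..d}" and j: "j \<in> {1..d'}" and f: "\<And>w. \<bar>f w\<bar> \<le> B"
  shows "\<bar>(\<Sum>l\<in>{l. \<bar>l\<bar> \<le> K}. fluct D N st i l j * f (of_int l * delta_w u)) -
    (\<Sum>r\<in>UNIV. p i / 2 * f (of_int (kk i j r) * delta_w u))\<bar> \<le> (2 * real d + 2) * B / 2 ^ N"
proof -
  have iD: "i \<in> {1..D}" and jD: "j \<in> {1..D}" using i j d by auto
  have B: "0 \<le> B" using f[of 0] by simp
  let ?h = "\<lambda>l::int. f (of_int l * delta_w u)"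
  define L where "L = (\<Sum>r\<in>UNIV. p i / 2 * ?h (kk i j r))"
  define A where "A y = (\<Sum>x\<in>near w_max st y. mass st i x j y / g y * ?h (int y - int x))" for y
  have close: "\<bar>A y - L\<bar> \<le> (2 * real d + 2) * B / 2 ^ N" if y: "y \<in> window N st" for y
  proof -
    let ?sl = "\<lambda>i x. \<Sum>r\<in>UNIV. if int y = int x + kk i j r then cnt i y else 0"
    let ?D = "\<lambda>i x. mass st i x j y - ?sl i x"
    have D0: "0 \<le> ?D i x" if "i \<in> {1..d}" "x \<in> near w_max st y" for i x
      using mass_ge_share[OF that(1) j near_le[OF that(2)] window_le[OF y]] by simp
    \<comment> \<open>The excess for a single i has no direct bound. It is nonnegative, so it is at
      most the excess over all i, and there the total inflow is limited by the block size.\<close>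
    have "(\<Sum>x\<in>near w_max st y. ?D i x) \<le> (\<Sum>i=1..d. \<Sum>x\<in>near w_max st y. ?D i x)"
      by (rule member_le_sum[OF i]) (auto intro!: sum_nonneg D0)
    also have "\<dots> = (\<Sum>i=1..d. \<Sum>x\<in>near w_max st y. mass st i x j y) - (\<Sum>i=1..d. 2 * cnt i y)"
      using slot_sum_to[OF y _ j, where h = "\<lambda>_. 1"] by (simp add: sum_subtractf)
    also have "\<dots> \<le> g y - (\<Sum>i=1..d. 2 * (g y * p i / 2 - 1))"
      using y by (intro diff_mono sum_mono mult_left_mono share_ge sum_mass_to_le d jD near_subset window_le) auto
    also have "\<dots> = 2 * real d"
      unfolding sum_share_bound by simp
    finally have D_le: "(\<Sum>x\<in>near w_max st y. ?D i x) \<le> 2 * real d" .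
    have "A y = (\<Sum>x\<in>near w_max st y. ?sl i x * ?h (int y - int x)) / g y +
        (\<Sum>x\<in>near w_max st y. ?D i x * ?h (int y - int x)) / g y"
      unfolding A_def add_divide_distrib[symmetric] sum.distrib[symmetric] sum_divide_distrib
      by (intro sum.cong refl) (simp add: algebra_simps)
    also have "(\<Sum>x\<in>near w_max st y. ?sl i x * ?h (int y - int x)) = (\<Sum>r\<in>UNIV. cnt i y * ?h (kk i j r))"
      by (rule slot_sum_to[OF y i j])
    finally have A: "A y - L = (\<Sum>r\<in>UNIV. (cnt i y / g y - p i / 2) * ?h (kk i j r)) +
        (\<Sum>x\<in>near w_max st y. ?D i x * ?h (int y - int x)) / g y"
      unfolding L_def by (simp add: left_diff_distrib sum_subtractf sum_divide_distrib)
    have "\<bar>\<Sum>r\<in>UNIV. (cnt i y / g y - p i / 2) * ?h (kk i j r)\<bar> \<le> (\<Sum>r\<in>(UNIV::bool set). 1 / g y * B)"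
    proof (intro order_trans[OF sum_abs] sum_mono)
      fix r
      have "(g y * p i / 2 - 1) / g y \<le> cnt i y / g y"
        by (intro divide_right_mono share_ge) simp
      moreover have "cnt i y / g y \<le> (g y * p i / 2) / g y"
        using p(1)[OF i] by (intro divide_right_mono share_le) auto
      ultimately have "\<bar>cnt i y / g y - p i / 2\<bar> \<le> 1 / g y"
        using g_pos[of y] by (simp add: abs_le_iff diff_divide_distrib)
      then show "\<bar>(cnt i y / g y - p i / 2) * ?h (kk i j r)\<bar> \<le> 1 / g y * B"
        unfolding abs_mult by (intro mult_mono f) auto
    qed
    also have "\<dots> = 2 * B / g y" by simp
    finally have 1: "\<bar>\<Sum>r\<in>UNIV. (cnt i y / g y - p i / 2) * ?h (kk i j r)\<bar> \<le> 2 * B / g y" .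
    have "\<bar>\<Sum>x\<in>near w_max st y. ?D i x * ?h (int y - int x)\<bar> \<le> (\<Sum>x\<in>near w_max st y. ?D i x * B)"
    proof (intro order_trans[OF sum_abs] sum_mono)
      fix x assume "x \<in> near w_max st y"
      then show "\<bar>?D i x * ?h (int y - int x)\<bar> \<le> ?D i x * B"
        unfolding abs_mult using D0[OF i] by (intro mult_mono f) auto
    qed
    also have "\<dots> \<le> 2 * real d * B"
      unfolding sum_distrib_right[symmetric] by (intro mult_right_mono D_le B)
    finally have "\<bar>\<Sum>x\<in>near w_max st y. ?D i x * ?h (int y - int x)\<bar> / g y \<le> 2 * real d * B / g y"
      using g_pos[of y] by (intro divide_right_mono) auto
    then have 2: "\<bar>(\<Sum>x\<in>near w_max st y. ?D i x * ?h (int y - int x)) / g y\<bar> \<le> 2 * real d * B / g y"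
      using g_pos[of y] by simp
    have "\<bar>A y - L\<bar> \<le> 2 * B / g y + 2 * real d * B / g y"
      unfolding A using 1 2 by linarith
    also have "\<dots> = (2 * real d + 2) * B / g y" by (simp add: add_divide_distrib algebra_simps)
    also have "\<dots> \<le> (2 * real d + 2) * B / 2 ^ N"
      using y B by (intro divide_g_le) (auto simp: mem_window)
    finally show ?thesis .
  qed
  have "(\<Sum>l\<in>{l. \<bar>l\<bar> \<le> K}. fluct D N st i l j * ?h l) - L =
      1 / real (N + 1) * (\<Sum>y\<in>window N st. A y - L)"
    unfolding sum_fluct[OF iD jD, where f = ?h] A_def[symmetric]
    by (simp add: sum_subtractf card_window right_diff_distrib)
  moreover have "\<bar>1 / real (N + 1) * (\<Sum>y\<in>window N st. A y - L)\<bar> \<le> 1 / real (N + 1) * (\<Sum>y\<in>window N st. \<bar>A y - L\<bar>)"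
    unfolding abs_mult using sum_abs[of "\<lambda>y. A y - L" "window N st"]
    by (simp add: divide_right_mono)
  moreover have "\<dots> \<le> (2 * real d + 2) * B / 2 ^ N"
    by (intro average_window_le close)
  ultimately show ?thesis unfolding L_def by linarith
qed

end

section \<open>Distance of the initial state from its target\<close>

context transport_step
begin

lemma sum_over_window: "(\<Sum>y=0..n. if y \<in> window N st then f y else 0) = (\<Sum>y\<in>window N st. f y)"
  using window_subset by (subst sum.inter_restrict[symmetric]) (auto simp: Int_absorb1)

text \<open>The balance summed over one block: the squared coefficient is the total initial
  probability of the block (i, x), collected from the uniform final distribution on the window
  blocks.\<close>

lemma init_coefficient_sq:
  assumes i: "i \<in> {1..D}" and x: "x \<le> n"
  shows "(k i x)\<^sup>2 = (\<Sum>j=1..d'. \<Sum>y\<in>window N st. q j / (g y * real (N + 1)) * mass st i x j y)"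
proof -
  let ?t = "amplitude N d' q st"
  obtain c c' where c: "\<And>a b. a \<in> I \<Longrightarrow> b \<in> I \<Longrightarrow> init_state st (a, b) = (if a = b then complex_of_real (c a) else 0)"
    "\<And>a b. a \<in> I \<Longrightarrow> b \<in> I \<Longrightarrow> fin_state st (a, b) = (if a = b then complex_of_real (c' a) else 0)"
    "\<And>a. a \<in> I \<Longrightarrow> (c a)\<^sup>2 = (\<Sum>b\<in>I. (c' b)\<^sup>2 * jump st b a)"
    using valid_step_majorization(2)[OF valid] by blast
  have sub: "blk u n i x \<subseteq> I" using i x by (rule blk_subset)
  have c_k: "c a = k i x / sqrt (g x)" if a: "a \<in> blk u n i x" for a
  proof -
    have "a \<in> I" using a sub by blast
    then have "complex_of_real (c a) = complex_of_real (k i x / sqrt (g x))"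
      using init_state_eq[OF i x a, of a] c(1)[of a a] by simp
    then show ?thesis by (simp only: of_real_eq_iff)
  qed
  have c'_t: "c' a = ?t a" if "a \<in> I" for a
    using fin_state_eq[OF that that] c(2)[OF that that] by simp
  have "(k i x)\<^sup>2 = (\<Sum>a\<in>blk u n i x. (c a)\<^sup>2)"
    using g_pos[of x] by (simp add: c_k card_blk[OF x] power_divide)
  also have "\<dots> = (\<Sum>a\<in>blk u n i x. \<Sum>b\<in>I. (?t b)\<^sup>2 * jump st b a)"
    using c(3) c'_t sub by (intro sum.cong refl) (auto simp: subset_iff intro!: sum.cong)
  also have "\<dots> = (\<Sum>b\<in>I. (?t b)\<^sup>2 * (\<Sum>a\<in>blk u n i x. jump st b a))"
    unfolding sum_distrib_left by (rule sum.swap)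
  also have "\<dots> = (\<Sum>j=1..D. \<Sum>y=0..n. \<Sum>b\<in>blk u n j y. (?t b)\<^sup>2 * (\<Sum>a\<in>blk u n i x. jump st b a))"
    by (rule sum_step_basis)
  also have "\<dots> = (\<Sum>j=1..D. \<Sum>y=0..n. if j \<in> {1..d'} \<and> y \<in> window N st
      then q j / (g y * real (N + 1)) * mass st i x j y else 0)"
  proof (intro sum.cong refl)
    fix j y assume "y \<in> {0..n}"
    then have y: "y \<le> n" by simp
    have "(\<Sum>b\<in>blk u n j y. (?t b)\<^sup>2 * (\<Sum>a\<in>blk u n i x. jump st b a)) =
        (\<Sum>b\<in>blk u n j y. (if j \<in> {1..d'} \<and> y \<in> window N st then q j / (g y * real (N + 1)) else 0) *
          (\<Sum>a\<in>blk u n i x. jump st b a))"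
      by (intro sum.cong refl) (simp only: amplitude_sq_on_blk[OF _ y q(1)])
    also have "\<dots> = (if j \<in> {1..d'} \<and> y \<in> window N st then q j / (g y * real (N + 1)) else 0) * mass st i x j y"
      unfolding mass_def flow_def sum_distrib_left[symmetric] by (subst sum.swap) (rule refl)
    finally show "(\<Sum>b\<in>blk u n j y. (?t b)\<^sup>2 * (\<Sum>a\<in>blk u n i x. jump st b a)) =
        (if j \<in> {1..d'} \<and> y \<in> window N st then q j / (g y * real (N + 1)) * mass st i x j y else 0)"
      by simp
  qed
  also have "\<dots> = (\<Sum>j=1..d'. \<Sum>y=0..n. if y \<in> window N st
      then q j / (g y * real (N + 1)) * mass st i x j y else 0)"
    using d(2) by (intro sum.mono_neutral_cong_right) auto
  also have "\<dots> = (\<Sum>j=1..d'. \<Sum>y\<in>window N st. q j / (g y * real (N + 1)) * mass st i x j y)"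
    by (rule sum.cong[OF refl sum_over_window])
  finally show ?thesis .
qed

text \<open>At distance at least K from both ends of the window, every prescribed shift lands in the
  window, so both values of r contribute for each j. Each contributes at least
  \<open>q j * (p i / 2 - 1 / 2 ^ N)\<close>, the subtraction being one rounded-off label in a block
  of size at least \<open>2 ^ N\<close>.\<close>

lemma init_coefficient_ge:
  assumes i: "i \<in> {1..d}" and x: "int N + K \<le> int x" "int x + K \<le> 2 * int N"
  shows "(p i - 2 / 2 ^ N) / real (N + 1) \<le> (k i x)\<^sup>2"
proof -
  have xw: "x \<in> window N st" using x K_nonneg by (auto simp: mem_window)
  have near_w: "near w_max st x \<subseteq> window N st"
    using x by (auto simp: near_def mem_window)
  have "(p i - 2 / 2 ^ N) / real (N + 1) =
      (\<Sum>j=1..d'. q j) * ((\<Sum>r\<in>(UNIV::bool set). p i / 2 - 1 / 2 ^ N) / real (N + 1))"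
    using q(2) by simp
  also have "\<dots> = (\<Sum>j=1..d'. \<Sum>r\<in>(UNIV::bool set). q j * (p i / 2 - 1 / 2 ^ N) / real (N + 1))"
    by (simp only: sum_distrib_right sum_distrib_left[symmetric] sum_divide_distrib[symmetric] times_divide_eq_right)
  also have "\<dots> = (\<Sum>j=1..d'. \<Sum>y\<in>near w_max st x. \<Sum>r\<in>UNIV. if int y = int x + kk i j r
      then q j * (p i / 2 - 1 / 2 ^ N) / real (N + 1) else 0)"
    using slot_sum_from[OF xw i] by (intro sum.cong refl) simp
  also have "\<dots> \<le> (\<Sum>j=1..d'. \<Sum>y\<in>near w_max st x. q j / (g y * real (N + 1)) * mass st i x j y)"
  proof (intro sum_mono)
    fix j y assume j: "j \<in> {1..d'}" and y: "y \<in> near w_max st x"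
    have yN: "N \<le> y" using y near_w mem_window by blast
    have "(p i / 2 - 1 / 2 ^ N) \<le> (g y * p i / 2 - 1) / g y"
      using divide_g_le[OF yN, of 1] g_pos[of y] by (simp add: diff_divide_distrib)
    also have "\<dots> \<le> cnt i y / g y"
      using g_pos[of y] by (intro divide_right_mono share_ge) auto
    finally have "q j * (p i / 2 - 1 / 2 ^ N) / real (N + 1) \<le> q j * (cnt i y / g y) / real (N + 1)"
      using q(1)[OF j] by (intro divide_right_mono mult_left_mono) auto
    then have "(\<Sum>r\<in>UNIV. if int y = int x + kk i j r then q j * (p i / 2 - 1 / 2 ^ N) / real (N + 1) else 0) \<le>
        (\<Sum>r\<in>UNIV. if int y = int x + kk i j r then q j * (cnt i y / g y) / real (N + 1) else 0)"
      by (intro sum_mono) simp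
    also have "\<dots> = q j / (g y * real (N + 1)) * (\<Sum>r\<in>UNIV. if int y = int x + kk i j r then cnt i y else 0)"
      unfolding sum_distrib_left by (intro sum.cong refl) simp
    also have "\<dots> \<le> q j / (g y * real (N + 1)) * mass st i x j y"
      using q(1)[OF j] g_pos[of y]
      by (intro mult_left_mono mass_ge_share i j window_le[OF xw] near_le[OF y]) (auto intro!: divide_nonneg_nonneg)
    finally show "(\<Sum>r\<in>UNIV. if int y = int x + kk i j r then q j * (p i / 2 - 1 / 2 ^ N) / real (N + 1) else 0) \<le>
        q j / (g y * real (N + 1)) * mass st i x j y" .
  qed
  also have "\<dots> \<le> (\<Sum>j=1..d'. \<Sum>y\<in>window N st. q j / (g y * real (N + 1)) * mass st i x j y)"
  proof (rule sum_mono, rule sum_mono2[OF finite_window near_w])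
    fix j y assume "j \<in> {1..d'}"
    then have "0 \<le> q j" using q(1) by (simp add: less_imp_le)
    then show "0 \<le> q j / (g y * real (N + 1)) * mass st i x j y"
      by (intro mult_nonneg_nonneg divide_nonneg_nonneg mass_nonneg) auto
  qed
  also have "\<dots> = (k i x)\<^sup>2"
    using i d by (intro init_coefficient_sq[symmetric] window_le[OF xw]) auto
  finally show ?thesis .
qed

text \<open>Both vectors have norm 1, so their squared distance is 2 minus twice their overlap, and
  lower bounds on the coefficients suffice. Only the inner window levels are kept in the overlap;
  there are \<open>N + 1 - 2 * K\<close> of them.\<close>

lemma vnorm_init_le:
  "vnorm (I \<times> I) (\<lambda>z. init_state st z - bip_tensor (schmidt_state d p) (battery_state N st) z) \<le>
    sqrt (2 - 2 * ((1 - 2 * real d / 2 ^ N) * ((real N + 1 - 2 * K) / (real N + 1))))"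
proof -
  let ?t = "amplitude N d p st"
  obtain c where c: "\<And>a b. a \<in> I \<Longrightarrow> b \<in> I \<Longrightarrow> init_state st (a, b) = (if a = b then complex_of_real (c a) else 0)"
    and c_norm: "(\<Sum>a\<in>I. (c a)\<^sup>2) = 1"
    using valid_step_majorization(2)[OF valid] by blast
  have c_k: "c a = k i x / sqrt (g x)" if "i \<in> {1..D}" "x \<le> n" "a \<in> blk u n i x" for i x a
  proof -
    have "a \<in> I" using blk_subset[OF that(1,2)] that(3) by blast
    then have "complex_of_real (c a) = complex_of_real (k i x / sqrt (g x))"
      using init_state_eq[OF that, of a] c(1)[of a a] by simp
    then show ?thesis by (simp only: of_real_eq_iff)
  qed
  have overlap: "(\<Sum>a\<in>I. c a * ?t a) = (\<Sum>i=1..d. \<Sum>x\<in>window N st. k i x * sqrt (p i) / sqrt (real (N + 1)))"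
  proof -
    have "(\<Sum>a\<in>I. c a * ?t a) = (\<Sum>i=1..D. \<Sum>x=0..n. \<Sum>a\<in>blk u n i x. c a * ?t a)"
      by (rule sum_step_basis)
    also have "\<dots> = (\<Sum>i=1..D. \<Sum>x=0..n. if i \<in> {1..d} \<and> x \<in> window N st
        then k i x * sqrt (p i) / sqrt (real (N + 1)) else 0)"
    proof (intro sum.cong refl)
      fix i x assume ix: "i \<in> {1..D}" "x \<in> {0..n}"
      then have x: "x \<le> n" by simp
      have "(\<Sum>a\<in>blk u n i x. c a * ?t a) = (\<Sum>a\<in>blk u n i x. k i x / sqrt (g x) *
          (if i \<in> {1..d} \<and> x \<in> window N st then sqrt (p i) / sqrt (g x) / sqrt (real (N + 1)) else 0))"
        by (intro sum.cong refl) (simp only: c_k[OF ix(1) x] amplitude_on_blk[OF _ x])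
      also have "\<dots> = g x * (k i x / sqrt (g x) *
          (if i \<in> {1..d} \<and> x \<in> window N st then sqrt (p i) / sqrt (g x) / sqrt (real (N + 1)) else 0))"
        by (simp only: sum_constant card_blk[OF x])
      also have "\<dots> = (sqrt (g x) * sqrt (g x)) * (k i x / sqrt (g x) *
          (if i \<in> {1..d} \<and> x \<in> window N st then sqrt (p i) / sqrt (g x) / sqrt (real (N + 1)) else 0))"
        by simp
      also have "\<dots> = (if i \<in> {1..d} \<and> x \<in> window N st then k i x * sqrt (p i) / sqrt (real (N + 1)) else 0)"
        using g_pos[of x] by (simp add: field_simps)
      finally show "(\<Sum>a\<in>blk u n i x. c a * ?t a) = (if i \<in> {1..d} \<and> x \<in> window N st
        then k i x * sqrt (p i) / sqrt (real (N + 1)) else 0)" .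
    qed
    also have "\<dots> = (\<Sum>i=1..d. \<Sum>x=0..n. if x \<in> window N st
        then k i x * sqrt (p i) / sqrt (real (N + 1)) else 0)"
      using d(1) by (intro sum.mono_neutral_cong_right) auto
    also have "\<dots> = (\<Sum>i=1..d. \<Sum>x\<in>window N st. k i x * sqrt (p i) / sqrt (real (N + 1)))"
      by (rule sum.cong[OF refl sum_over_window])
    finally show ?thesis .
  qed
  define X where "X = {x. int N + K \<le> int x \<and> int x + K \<le> 2 * int N}"
  have X_sub: "X \<subseteq> window N st" using K_nonneg by (auto simp: X_def mem_window)
  have card_X: "real (card X) = real N + 1 - 2 * K"
  proof -
    have "X = nat ` {int N + K..2 * int N - K}"
    proof (intro set_eqI iffI)
      fix x assume "x \<in> X"
      then have "int x \<in> {int N + K..2 * int N - K}" by (auto simp: X_def)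
      then show "x \<in> nat ` {int N + K..2 * int N - K}" by (metis image_eqI nat_int)
    qed (use K_nonneg in \<open>auto simp: X_def\<close>)
    moreover have "inj_on nat {int N + K..2 * int N - K}"
      using K_nonneg by (auto simp: inj_on_def)
    ultimately have "card X = card {int N + K..2 * int N - K}" by (simp add: card_image)
    then show ?thesis using Kmax_le by simp
  qed
  \<comment> \<open>With \<open>m = p i - 2 / 2 ^ N\<close>, the coefficient is at least
    \<open>sqrt (m / (N + 1))\<close> and \<open>sqrt (p i) \<ge> sqrt m\<close>, so the product is
    at least \<open>m / sqrt (N + 1)\<close>. If m is negative the bound is trivial.\<close>
  have term_ge: "(p i - 2 / 2 ^ N) / real (N + 1) \<le> k i x * sqrt (p i) / sqrt (real (N + 1))"
    if i: "i \<in> {1..d}" and x: "x \<in> X" for i x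
  proof (cases "2 / 2 ^ N \<le> p i")
    case True
    let ?m = "p i - 2 / 2 ^ N"
    have "sqrt (?m / real (N + 1)) \<le> sqrt ((k i x)\<^sup>2)"
      using init_coefficient_ge[OF i] x by (intro real_sqrt_le_mono) (auto simp: X_def)
    then have "sqrt ?m / sqrt (real (N + 1)) \<le> k i x"
      using k_nonneg[of i x] by (simp add: real_sqrt_divide)
    moreover have "sqrt ?m \<le> sqrt (p i)" by simp
    ultimately have "sqrt ?m / sqrt (real (N + 1)) * sqrt ?m \<le> k i x * sqrt (p i)"
      using True k_nonneg by (intro mult_mono) auto
    then have "?m / sqrt (real (N + 1)) \<le> k i x * sqrt (p i)"
      using True by simp
    then have "?m / sqrt (real (N + 1)) / sqrt (real (N + 1)) \<le> k i x * sqrt (p i) / sqrt (real (N + 1))"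
      by (rule divide_right_mono) simp
    then show ?thesis by simp
  next
    case False
    then have "(p i - 2 / 2 ^ N) / real (N + 1) \<le> 0" by (intro divide_nonpos_nonneg) auto
    also have "0 \<le> k i x * sqrt (p i) / sqrt (real (N + 1))"
      using p(1)[OF i] k_nonneg[of i x] by simp
    finally show ?thesis .
  qed
  have "(1 - 2 * real d / 2 ^ N) * ((real N + 1 - 2 * K) / (real N + 1)) =
      (\<Sum>i=1..d. p i - 2 / 2 ^ N) * (real (card X) / real (N + 1))"
    unfolding card_X sum_subtractf p(2) by (simp add: add.commute mult.commute)
  also have "\<dots> = (\<Sum>i=1..d. \<Sum>x\<in>X. (p i - 2 / 2 ^ N) / real (N + 1))"
    by (simp add: sum_distrib_left sum_divide_distrib mult.commute)
  also have "\<dots> \<le> (\<Sum>i=1..d. \<Sum>x\<in>X. k i x * sqrt (p i) / sqrt (real (N + 1)))"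
    by (intro sum_mono term_ge)
  also have "\<dots> \<le> (\<Sum>a\<in>I. c a * ?t a)"
    unfolding overlap
  proof (rule sum_mono, rule sum_mono2[OF finite_window X_sub])
    fix i x assume "i \<in> {1..d}"
    then show "0 \<le> k i x * sqrt (p i) / sqrt (real (N + 1))"
      using p(1)[of i] k_nonneg[of i x] by simp
  qed
  finally have le: "(1 - 2 * real d / 2 ^ N) * ((real N + 1 - 2 * K) / (real N + 1)) \<le> (\<Sum>a\<in>I. c a * ?t a)" .
  have "(\<Sum>a\<in>I. (c a - ?t a)\<^sup>2) = (\<Sum>a\<in>I. (c a)\<^sup>2) + (\<Sum>a\<in>I. (?t a)\<^sup>2) - 2 * (\<Sum>a\<in>I. c a * ?t a)"
    unfolding sum_distrib_left sum.distrib[symmetric] sum_subtractf[symmetric]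
    by (intro sum.cong refl) (simp add: power2_eq_square algebra_simps)
  also have "\<dots> = 2 - 2 * (\<Sum>a\<in>I. c a * ?t a)"
    using c_norm sum_amplitude_sq[OF d(1) p] by simp
  finally have dist: "(\<Sum>a\<in>I. (c a - ?t a)\<^sup>2) = 2 - 2 * (\<Sum>a\<in>I. c a * ?t a)" .
  have "vnorm (I \<times> I) (\<lambda>z. init_state st z - bip_tensor (schmidt_state d p) (battery_state N st) z) =
      sqrt (\<Sum>a\<in>I. (c a - ?t a)\<^sup>2)"
    by (rule vnorm_diagonal[OF finite_step_basis]) (simp add: c bip_tensor_schmidt_battery)
  then show ?thesis unfolding dist using le by simp
qed

lemma vnorm_fin:
  "vnorm (I \<times> I) (\<lambda>z. fin_state st z - bip_tensor (schmidt_state d' q) (battery_state N st) z) = 0"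
  using vnorm_diagonal[where I = I and c = "\<lambda>_. 0" and
      v = "\<lambda>z. fin_state st z - bip_tensor (schmidt_state d' q) (battery_state N st) z", OF finite_step_basis]
  by (simp add: fin_state_eq bip_tensor_schmidt_battery)

end

lemma exists_transport_step:
  assumes u: "2 \<le> u" and N: "0 < N" and d: "d \<le> D" "d' \<le> D"
    and p: "\<And>i. i \<in> {1..d} \<Longrightarrow> 0 < p i" "(\<Sum>i=1..d. p i) = 1"
    and q: "\<And>j. j \<in> {1..d'} \<Longrightarrow> 0 < q j" "(\<Sum>j=1..d'. q j) = 1"
    and lam: "\<And>r. 0 < lam r" "lam True + lam False = 2"
    and shift: "\<And>i j r. i \<in> {1..d} \<Longrightarrow> j \<in> {1..d'} \<Longrightarrow> \<bar>shift u p q lam i j r\<bar> \<le> Kmax w_max u"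
    and K: "2 * Kmax w_max u \<le> int N" and w: "0 < w_max"
  shows "\<exists>st k. bat_u st = u \<and> transport_step D N st d d' p q lam w_max k"
proof -
  have q_pos: "\<forall>j\<in>{1..d'}. 0 < q j" using q(1) by blast
  have n: "1 \<le> 3 * N" "N + N \<le> 3 * N" using N by auto
  obtain \<pi> where \<pi>: "\<pi> permutes loc_basis D u (3 * N)"
    and flow: "\<And>i j x y. i \<in> {1..d} \<Longrightarrow> j \<in> {1..d'} \<Longrightarrow> x \<le> 3 * N \<Longrightarrow> y \<le> 3 * N \<Longrightarrow>
      (\<Sum>r\<in>UNIV. if int y = int x + shift u p q lam i j r then share u (3 * N) p i y else 0) \<le>
      card {a\<in>blk u (3 * N) i x. \<pi> a \<in> blk u (3 * N) j y}"
    using transport_permutation[where n = "3 * N" and lam = lam and p = p and q = q, OF u d p q lam] by auto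
  from permutation_step[where n = "3 * N" and s = N and N = N and q = q, OF u n \<pi> d(2) q_pos q(2)]
  show ?thesis
  proof (elim exE conjE)
    fix st k
    assume st: "bat_u st = u" "bat_n st = 3 * N" "win_start st = N"
      and valid: "valid_step D N st"
      and mass: "\<forall>i\<in>{1..D}. \<forall>x\<in>{0..3 * N}. \<forall>j\<in>{1..D}. \<forall>y\<in>{0..3 * N}.
         mass st i x j y = card {a\<in>blk u (3 * N) i x. \<pi> a \<in> blk u (3 * N) j y}"
      and fin: "\<forall>a\<in>step_basis D st. \<forall>b\<in>step_basis D st.
         fin_state st (a, b) = (if a = b then complex_of_real (amplitude N d' q st a) else 0)"
      and k: "\<forall>i x. 0 \<le> k i x"
      and init: "\<forall>i\<in>{1..D}. \<forall>x\<in>{0..3 * N}. \<forall>a\<in>blk u (3 * N) i x. \<forall>b\<in>step_basis D st.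
         init_state st (a, b) = (if a = b then complex_of_real (k i x / sqrt (real (bsize u (3 * N) x))) else 0)"
    interpret bistochastic_step D N st
      by (rule valid_step_majorization(1)[OF valid])
    have "transport_step D N st d d' p q lam w_max k"
    proof
      show "(\<Sum>r\<in>UNIV. if int y = int x + shift (bat_u st) p q lam i j r
           then real (share (bat_u st) (bat_n st) p i y) else 0) \<le> mass st i x j y"
        if ij: "i \<in> {1..d}" "j \<in> {1..d'}" "x \<le> bat_n st" "y \<le> bat_n st" for i j x y
      proof -
        have "(\<Sum>r\<in>UNIV. if int y = int x + shift u p q lam i j r then real (share u (3 * N) p i y) else 0) =
            real (\<Sum>r\<in>UNIV. if int y = int x + shift u p q lam i j r then share u (3 * N) p i y else 0)"
          unfolding of_nat_sum by (intro sum.cong refl) simp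
        also have "\<dots> \<le> real (card {a\<in>blk u (3 * N) i x. \<pi> a \<in> blk u (3 * N) j y})"
          using flow[of i j x y] ij by (simp only: of_nat_le_iff st)
        also have "\<dots> = mass st i x j y"
          using mass ij d by (simp add: st)
        finally show ?thesis by (simp only: st)
      qed
      show "init_state st (a, b) =
          (if a = b then complex_of_real (k i x / sqrt (real (bsize (bat_u st) (bat_n st) x))) else 0)"
        if "i \<in> {1..D}" "x \<le> bat_n st" "a \<in> blk (bat_u st) (bat_n st) i x" "b \<in> step_basis D st" for i x a b
        using init that by (simp only: st) simp
    qed (use d p q lam valid st fin k shift K w in auto)
    then show "\<exists>st k. bat_u st = u \<and> transport_step D N st d d' p q lam w_max k" using st by blast
  qed
qed

section \<open>The limit of large windows\<close>

lemma delta_w_ge: "2 \<le> u \<Longrightarrow> 1 / real u \<le> delta_w u"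
proof -
  assume u: "2 \<le> u"
  have "ln (real (u - 1) / real u) \<le> real (u - 1) / real u - 1"
    using u by (intro ln_le_minus_one) auto
  also have "\<dots> = - (1 / real u)" using u by (simp add: field_simps)
  finally have "1 / real u \<le> ln (real u / real (u - 1))"
    using u by (simp add: ln_div)
  also have "\<dots> \<le> ln (real u / real (u - 1)) / ln 2"
    using u ln_le_minus_one[of 2] ln_gt_zero[of 2] by (simp add: pos_le_divide_eq mult_le_cancel_left1)
  finally show ?thesis by (simp add: delta_w_def log_def)
qed

lemma delta_w_le: "2 \<le> u \<Longrightarrow> delta_w u \<le> 1 / (real (u - 1) * ln 2)"
proof -
  assume u: "2 \<le> u"
  have "ln (real u / real (u - 1)) \<le> real u / real (u - 1) - 1"
    using u by (intro ln_le_minus_one) auto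
  also have "\<dots> = 1 / real (u - 1)" using u by (simp add: field_simps)
  finally have "ln (real u / real (u - 1)) / ln 2 \<le> 1 / real (u - 1) / ln 2"
    by (intro divide_right_mono) auto
  then show ?thesis by (simp add: delta_w_def log_def)
qed

lemma delta_w_le_1: "2 \<le> u \<Longrightarrow> delta_w u \<le> 1"
  by (simp add: delta_w_def log_le_iff pos_divide_le_eq)

text \<open>As \<open>delta_w u\<close> is of order \<open>1 / u\<close>, this choice sends it to 0
  while \<open>N * delta_w u\<close> still grows like \<open>sqrt N\<close>. The summand 2 ensures
  both \<open>2 \<le> u\<close> and \<open>u - 1 \<ge> sqrt N\<close> despite the floor.\<close>

definition battery_size :: "nat \<Rightarrow> nat" where
  "battery_size N = nat \<lfloor>sqrt (real N)\<rfloor> + 2"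

lemma battery_size_ge_2: "2 \<le> battery_size N"
  by (simp add: battery_size_def)

lemma filterlim_sqrt_nat: "filterlim (\<lambda>N. sqrt (real N)) at_top sequentially"
  by (rule filterlim_compose[OF sqrt_at_top filterlim_real_sequentially])

lemma filterlim_battery_window:
  "filterlim (\<lambda>N. real N * delta_w (battery_size N)) at_top sequentially"
proof (rule filterlim_at_top_mono)
  show "filterlim (\<lambda>N. (1 / 3) * sqrt (real N)) at_top sequentially"
    by (rule filterlim_tendsto_pos_mult_at_top[OF tendsto_const _ filterlim_sqrt_nat]) simp
  show "\<forall>\<^sub>F N in sequentially. 1 / 3 * sqrt (real N) \<le> real N * delta_w (battery_size N)"
    using eventually_ge_at_top[of 1]
  proof eventually_elim
    case (elim N)
    let ?s = "sqrt (real N)"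
    have s: "1 \<le> ?s" using elim by simp
    have "real (battery_size N) \<le> ?s + 2"
      using of_nat_floor[of ?s] by (simp add: battery_size_def)
    also have "\<dots> \<le> 3 * ?s" using s by simp
    finally have "1 / (3 * ?s) \<le> 1 / real (battery_size N)"
      using battery_size_ge_2[of N] s by (intro divide_left_mono mult_pos_pos) auto
    also have "\<dots> \<le> delta_w (battery_size N)" by (rule delta_w_ge[OF battery_size_ge_2])
    finally have "real N * (1 / (3 * ?s)) \<le> real N * delta_w (battery_size N)"
      by (intro mult_left_mono) auto
    moreover have "real N * (1 / (3 * ?s)) = 1 / 3 * ?s"
      using s real_sqrt_mult_self[of "real N"] by (simp add: field_simps)
    ultimately show ?case by simp
  qed
qed

lemma tendsto_battery_delta_w: "(\<lambda>N. delta_w (battery_size N)) \<longlonglongrightarrow> 0"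
proof (rule tendsto_sandwich)
  show "(\<lambda>_. 0 :: real) \<longlonglongrightarrow> 0" by simp
  have "(\<lambda>N. (1 / ln 2) / sqrt (real N)) \<longlonglongrightarrow> 0"
    by (rule tendsto_divide_0[OF tendsto_const filterlim_at_top_imp_at_infinity[OF filterlim_sqrt_nat]])
  then show "(\<lambda>N. (1 / ln 2) / sqrt (real N)) \<longlonglongrightarrow> 0" .
  show "\<forall>\<^sub>F N in sequentially. 0 \<le> delta_w (battery_size N)"
    using delta_w_pos[OF battery_size_ge_2] by (simp add: less_imp_le)
  show "\<forall>\<^sub>F N in sequentially. delta_w (battery_size N) \<le> (1 / ln 2) / sqrt (real N)"
    using eventually_ge_at_top[of 1]
  proof eventually_elim
    case (elim N)
    have "sqrt (real N) \<le> real (battery_size N - 1)"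
      unfolding battery_size_def by linarith
    then have "1 / (real (battery_size N - 1) * ln 2) \<le> 1 / (sqrt (real N) * ln 2)"
      using elim battery_size_ge_2[of N] by (intro divide_left_mono mult_right_mono) auto
    then show ?case
      using delta_w_le[OF battery_size_ge_2, of N] by (simp add: field_simps)
  qed
qed

section \<open>Convergence of the constructed sequence\<close>

lemma along_le: "along Ns \<le> sequentially"
  by (simp add: along_def)

lemma along_UNIV: "along UNIV = sequentially"
  by (simp add: along_def)

lemma tendsto_shift_mult_delta_w:
  "(\<lambda>N. of_int (shift (battery_size N) p q lam i j r) * delta_w (battery_size N)) \<longlonglongrightarrow> gain p q lam i j r"
proof (rule tendsto_sandwich)
  show "(\<lambda>N. gain p q lam i j r - delta_w (battery_size N)) \<longlonglongrightarrow> gain p q lam i j r"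
    using tendsto_diff[OF tendsto_const tendsto_battery_delta_w] by fastforce
  show "(\<lambda>_. gain p q lam i j r) \<longlonglongrightarrow> gain p q lam i j r" by simp
qed (auto intro!: always_eventually shift_mult_delta_w battery_size_ge_2)

lemma abs_shift_le_Kmax:
  assumes "2 \<le> u" "\<bar>gain p q lam i j r\<bar> + 1 \<le> w_max"
  shows "\<bar>shift u p q lam i j r\<bar> \<le> Kmax w_max u"
proof -
  let ?k = "shift u p q lam i j r"
  have \<delta>: "0 < delta_w u" by (rule delta_w_pos[OF assms(1)])
  have "\<bar>of_int ?k * delta_w u\<bar> \<le> w_max"
    using shift_mult_delta_w[OF assms(1), of p q lam i j r] delta_w_le_1[OF assms(1)] \<delta> assms(2) by linarith
  then have "of_int \<bar>?k\<bar> * delta_w u \<le> w_max" using \<delta> by (simp add: abs_mult)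
  then show ?thesis
    unfolding Kmax_def using \<delta> by (simp only: le_floor_iff pos_le_divide_eq)
qed

text \<open>The values \<open>v r\<close> may coincide, as they do when no entanglement is wasted
  and both entries of lam are 1. Defining the distribution as a sum over r adds up coinciding atoms,
  so integrals need no case distinction.\<close>

lemma sum_support_atoms:
  fixes v :: "'r::finite \<Rightarrow> real" and c :: real
  defines "P \<equiv> \<lambda>w. \<Sum>r\<in>UNIV. if w = v r then c else 0"
  shows "(\<Sum>w\<in>{w. P w \<noteq> 0}. P w * f w) = (\<Sum>r\<in>UNIV. c * f (v r))"
    and "finite {w. P w \<noteq> 0}"
proof -
  have sub: "{w. P w \<noteq> 0} \<subseteq> range v"
  proof
    fix w assume "w \<in> {w. P w \<noteq> 0}"
    then have "(\<Sum>r\<in>UNIV. if w = v r then c else 0) \<noteq> 0" by (simp add: P_def)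
    then obtain r where "(if w = v r then c else 0) \<noteq> 0" by (rule sum.not_neutral_contains_not_neutral)
    then show "w \<in> range v" by (auto split: if_splits)
  qed
  then show "finite {w. P w \<noteq> 0}" by (rule finite_subset) simp
  have "(\<Sum>w\<in>{w. P w \<noteq> 0}. P w * f w) = (\<Sum>w\<in>range v. P w * f w)"
    using sub by (intro sum.mono_neutral_left) auto
  also have "\<dots> = (\<Sum>r\<in>UNIV. \<Sum>w\<in>range v. if w = v r then c * f (v r) else 0)"
    unfolding P_def sum_distrib_right by (subst sum.swap) (intro sum.cong refl, auto)
  also have "\<dots> = (\<Sum>r\<in>UNIV. c * f (v r))" by simp
  finally show "(\<Sum>w\<in>{w. P w \<noteq> 0}. P w * f w) = (\<Sum>r\<in>UNIV. c * f (v r))" .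
qed

lemma blocc_possible_gain:
  assumes d: "d \<le> D" "d' \<le> D"
    and p: "\<And>i. i \<in> {1..d} \<Longrightarrow> 0 < p i" "(\<Sum>i=1..d. p i) = 1"
    and q: "\<And>j. j \<in> {1..d'} \<Longrightarrow> 0 < q j" "(\<Sum>j=1..d'. q j) = 1"
    and lam: "\<And>r. 0 < lam r" "lam True + lam False = 2"
  shows "blocc_possible D d p d' q
    (\<Sum>i=1..d. \<Sum>j=1..d'. \<Sum>r\<in>UNIV. p i / 2 * (q j * gain p q lam i j r))"
proof -
  let ?v = "gain p q lam"
  \<comment> \<open>The sum dominates every single gain, and the additional 1 absorbs the rounding
    of shifts, since \<open>delta_w u \<le> 1\<close>.\<close>
  define w_max where "w_max = (\<Sum>i=1..d. \<Sum>j=1..d'. \<Sum>r\<in>UNIV. \<bar>?v i j r\<bar>) + 1"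
  have w_max_pos: "0 < w_max"
    unfolding w_max_def by (intro add_nonneg_pos sum_nonneg) auto
  have v_le: "\<bar>?v i j r\<bar> + 1 \<le> w_max" if "i \<in> {1..d}" "j \<in> {1..d'}" for i j r
  proof -
    have "\<bar>?v i j r\<bar> \<le> (\<Sum>r\<in>UNIV. \<bar>?v i j r\<bar>)"
      by (rule member_le_sum) auto
    also have "\<dots> \<le> (\<Sum>j=1..d'. \<Sum>r\<in>UNIV. \<bar>?v i j r\<bar>)"
      by (rule member_le_sum[OF that(2)]) (auto intro: sum_nonneg)
    also have "\<dots> \<le> (\<Sum>i=1..d. \<Sum>j=1..d'. \<Sum>r\<in>UNIV. \<bar>?v i j r\<bar>)"
      by (rule member_le_sum[OF that(1)]) (auto intro: sum_nonneg)
    finally show ?thesis by (simp add: w_max_def)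
  qed
  define K where "K N = Kmax w_max (battery_size N)" for N
  \<comment> \<open>Only those N are used for which the shifts fit into the margins beside the
    window; as \<open>K / N\<close> tends to 0, these are all sufficiently large N.\<close>
  define Ns where "Ns = {N. 0 < N \<and> 2 * K N \<le> int N}"
  have "\<exists>st k. bat_u st = battery_size N \<and> transport_step D N st d d' p q lam w_max k" if "N \<in> Ns" for N
    using that unfolding Ns_def K_def
    by (intro exists_transport_step battery_size_ge_2 d p q lam w_max_pos abs_shift_le_Kmax v_le) auto
  then obtain st k where st: "\<And>N. N \<in> Ns \<Longrightarrow> bat_u (st N) = battery_size N"
    and step: "\<And>N. N \<in> Ns \<Longrightarrow> transport_step D N (st N) d d' p q lam w_max (k N)"
    by metis
  define W where "W = along Ns"
  have ev: "eventually (\<lambda>N. N \<in> Ns) W" unfolding W_def by (rule eventually_along)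
  have W_le: "W \<le> sequentially" unfolding W_def by (rule along_le)
  have seq_W: "(f \<longlongrightarrow> l) W" if "f \<longlonglongrightarrow> l" for f :: "nat \<Rightarrow> real" and l
    using tendsto_mono[OF W_le that] .
  \<comment> \<open>An arbitrary record serves as a carrier for \<open>battery_size N\<close>: the
    limit of \<open>K / N\<close> depends on a step only through \<open>bat_u\<close>, and it is
    needed for all N in order to show that \<open>Ns\<close> is infinite.\<close>
  obtain s :: blocc_step where True by blast
  have K_window: "(\<lambda>N. (real N + 1 + 2 * K N) / (real N + 1)) \<longlonglongrightarrow> 1"
    using tendsto_Kmax_window[where st = "\<lambda>N. s\<lparr>bat_u := battery_size N\<rparr>" and Ns = UNIV]
      filterlim_battery_window battery_size_ge_2 w_max_pos
    unfolding along_UNIV K_def by simp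
  have Ns_inf: "infinite Ns"
  proof -
    have "eventually (\<lambda>N. (real N + 1 + 2 * K N) / (real N + 1) < 3 / 2) sequentially"
      using K_window by (rule order_tendstoD) simp
    then have "eventually (\<lambda>N. N \<in> Ns) sequentially"
      using eventually_gt_at_top[of 1]
    proof eventually_elim
      case (elim N)
      then have "real N + 1 + 2 * K N < 3 / 2 * (real N + 1)" by (simp add: pos_divide_less_eq)
      then have "real_of_int (2 * K N) \<le> real_of_int (int N)" using elim(2) by simp
      then show ?case unfolding Ns_def using elim(2) by (simp only: of_int_le_iff) simp
    qed
    then obtain M where "{M..} \<subseteq> Ns"
      by (auto simp: eventually_sequentially)
    then show ?thesis by (rule infinite_super) (rule infinite_Ici)
  qed
  have pow0: "((\<lambda>N. a / 2 ^ N) \<longlongrightarrow> 0) W" for a :: real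
    by (rule seq_W, rule LIMSEQ_divide_realpow_zero) simp
  have null: "(f \<longlongrightarrow> 0) W" if "\<And>N. N \<in> Ns \<Longrightarrow> norm (f N) \<le> h N" "(h \<longlongrightarrow> 0) W"
    for f :: "nat \<Rightarrow> 'z::real_normed_vector" and h
    by (rule Lim_null_comparison[OF _ that(2)]) (use ev that(1) in \<open>auto elim: eventually_mono\<close>)
  have seq: "blocc_sequence D d p d' q w_max Ns st"
    unfolding blocc_sequence_def W_def[symmetric]
  proof (intro conjI ballI w_max_pos Ns_inf)
    show "0 < N" if "N \<in> Ns" for N using that by (simp add: Ns_def)
    show "valid_step D N (st N)" if "N \<in> Ns" for N
      by (rule transport_step.valid[OF step[OF that]])
    have "filterlim (\<lambda>N. real N * delta_w (battery_size N)) at_top W"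
      by (rule filterlim_mono[OF filterlim_battery_window order_refl W_le])
    then show "filterlim (\<lambda>N. real N * delta_w (bat_u (st N))) at_top W"
      by (rule filterlim_cong[THEN iffD1, OF refl refl, rotated])
         (use ev st in \<open>auto elim: eventually_mono\<close>)
    show "((\<lambda>N. far_weight_final w_max D d d' N (st N)) \<longlongrightarrow> 0) W"
      by (rule null[OF transport_step.norm_far_weight_final_le[OF step] pow0])
    show "((\<lambda>N. far_weight_initial w_max D d d' N (st N)) \<longlongrightarrow> 0) W"
    proof (rule null)
      show "norm (far_weight_initial w_max D d d' N (st N)) \<le>
          real d * (1 - 2 powr (- delta_w (battery_size N)) + 2 * real d' / 2 ^ N)" if "N \<in> Ns" for N
        using transport_step.norm_far_weight_initial_le[OF step[OF that]] st[OF that] by simp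
      have "((\<lambda>N. real d * (1 - 2 powr (- delta_w (battery_size N)) + 2 * real d' / 2 ^ N)) \<longlongrightarrow>
          real d * (1 - 2 powr (- 0) + 0)) W"
        by (intro tendsto_intros pow0 seq_W[OF tendsto_battery_delta_w]) simp_all
      then show "((\<lambda>N. real d * (1 - 2 powr (- delta_w (battery_size N)) + 2 * real d' / 2 ^ N)) \<longlongrightarrow> 0) W"
        by simp
    qed
    show "((\<lambda>N. vnorm (step_basis D (st N) \<times> step_basis D (st N))
         (\<lambda>z. init_state (st N) z - bip_tensor (schmidt_state d p) (battery_state N (st N)) z)) \<longlongrightarrow> 0) W"
    proof (rule null)
      \<comment> \<open>The fraction of inner window levels, with \<open>- 2 * K\<close> in the
        numerator, is written as 2 minus the fraction with \<open>+ 2 * K\<close>, so that the limit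
        \<open>K_window\<close> applies.\<close>
      let ?b = "\<lambda>N. sqrt (2 - 2 * ((1 - 2 * real d / 2 ^ N) * (2 - (real N + 1 + 2 * K N) / (real N + 1))))"
      show "norm (vnorm (step_basis D (st N) \<times> step_basis D (st N))
         (\<lambda>z. init_state (st N) z - bip_tensor (schmidt_state d p) (battery_state N (st N)) z)) \<le> ?b N"
        if "N \<in> Ns" for N
      proof -
        have "(real N + 1 - 2 * K N) / (real N + 1) = 2 - (real N + 1 + 2 * K N) / (real N + 1)"
          by (simp add: field_simps)
        then show ?thesis
          using transport_step.vnorm_init_le[OF step[OF that]]
          unfolding st[OF that] K_def[symmetric] by (simp add: vnorm_def sum_nonneg)
      qed
      have "(?b \<longlongrightarrow> sqrt (2 - 2 * ((1 - 0) * (2 - 1)))) W"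
        by (intro tendsto_intros pow0 seq_W[OF K_window])
      then show "(?b \<longlongrightarrow> 0) W" by simp
    qed
    show "((\<lambda>N. vnorm (step_basis D (st N) \<times> step_basis D (st N))
         (\<lambda>z. fin_state (st N) z - bip_tensor (schmidt_state d' q) (battery_state N (st N)) z)) \<longlongrightarrow> 0) W"
      by (rule null[OF _ tendsto_const]) (simp add: transport_step.vnorm_fin[OF step])
  qed
  define P where "P i w j = (\<Sum>r\<in>UNIV. if w = ?v i j r then p i / 2 else 0)" for i w j
  have P_sum: "(\<Sum>w\<in>{w. P i w j \<noteq> 0}. P i w j * f w) = (\<Sum>r\<in>UNIV. p i / 2 * f (?v i j r))"
    and P_fin: "finite {w. P i w j \<noteq> 0}" for i j f
    unfolding P_def by (rule sum_support_atoms)+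
  have real_P: "realizes D d d' w_max Ns st P"
    unfolding realizes_def W_def[symmetric]
  proof (intro ballI conjI allI impI P_fin)
    fix i j assume i: "i \<in> {1..d}" and j: "j \<in> {1..d'}"
    show "0 \<le> P i w j" for w
      unfolding P_def using p(1)[OF i] by (intro sum_nonneg) auto
    fix f :: "real \<Rightarrow> real" assume "continuous_on UNIV f \<and> bounded (range f)"
    then obtain B where cont: "continuous_on UNIV f" and B: "\<And>w. \<bar>f w\<bar> \<le> B"
      by (auto simp: bounded_iff)
    let ?X = "\<lambda>N. \<Sum>l\<in>{l. \<bar>l\<bar> \<le> Kmax w_max (bat_u (st N))}. fluct D N (st N) i l j * f (of_int l * delta_w (bat_u (st N)))"
    let ?L = "\<lambda>N. \<Sum>r\<in>UNIV. p i / 2 * f (of_int (shift (battery_size N) p q lam i j r) * delta_w (battery_size N))"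
    have "((\<lambda>N. ?X N - ?L N) \<longlongrightarrow> 0) W"
    proof (rule null[OF _ pow0])
      show "norm (?X N - ?L N) \<le> (2 * real d + 2) * B / 2 ^ N" if "N \<in> Ns" for N
        using transport_step.fluct_close[OF step[OF that] i j, of f B] B st[OF that] by simp
    qed
    moreover have "(?L \<longlongrightarrow> (\<Sum>r\<in>UNIV. p i / 2 * f (?v i j r))) W"
    proof (intro tendsto_sum tendsto_mult tendsto_const)
      fix r
      have "isCont f (?v i j r)" using cont by (simp add: continuous_on_eq_continuous_at)
      then show "((\<lambda>N. f (of_int (shift (battery_size N) p q lam i j r) * delta_w (battery_size N))) \<longlongrightarrow> f (?v i j r)) W"
        by (rule isCont_tendsto_compose[OF _ seq_W[OF tendsto_shift_mult_delta_w]])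
    qed
    ultimately have "((\<lambda>N. (?X N - ?L N) + ?L N) \<longlongrightarrow> 0 + (\<Sum>r\<in>UNIV. p i / 2 * f (?v i j r))) W"
      by (rule tendsto_add)
    then show "(?X \<longlongrightarrow> (\<Sum>w\<in>{w. P i w j \<noteq> 0}. P i w j * f w)) W"
      unfolding P_sum by simp
  qed
  have "(\<Sum>i=1..d. \<Sum>j=1..d'. \<Sum>w\<in>{w. P i w j \<noteq> 0}. P i w j * q j * w) =
      (\<Sum>i=1..d. \<Sum>j=1..d'. \<Sum>r\<in>UNIV. p i / 2 * (q j * ?v i j r))"
    unfolding mult.assoc P_sum ..
  then show ?thesis
    unfolding blocc_possible_def using seq real_P by blast
qed

text \<open>Under the constructed distribution i and j are independent with weights
  \<open>p i\<close> and \<open>q j\<close>, so the logarithm of the quotient splits into separate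
  averages.\<close>

lemma average_gain:
  assumes p: "\<And>i. i \<in> A \<Longrightarrow> 0 < p i" "(\<Sum>i\<in>A. p i) = 1"
    and q: "\<And>j. j \<in> B \<Longrightarrow> 0 < q j" "(\<Sum>j\<in>B. q j) = 1"
    and lam: "\<And>r. 0 < lam r"
  shows "(\<Sum>i\<in>A. \<Sum>j\<in>B. \<Sum>r\<in>UNIV. p i / 2 * (q j * gain p q lam i j r)) =
    (\<Sum>j\<in>B. q j * log 2 (q j)) - (\<Sum>i\<in>A. p i * log 2 (p i)) + (log 2 (lam True) + log 2 (lam False)) / 2"
proof -
  let ?c = "(log 2 (lam True) + log 2 (lam False)) / 2"
  have "(\<Sum>i\<in>A. \<Sum>j\<in>B. \<Sum>r\<in>UNIV. p i / 2 * (q j * gain p q lam i j r)) =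
      (\<Sum>i\<in>A. \<Sum>j\<in>B. p i * (q j * log 2 (q j)) - p i * log 2 (p i) * q j + p i * q j * ?c)"
  proof (intro sum.cong refl)
    fix i j assume ij: "i \<in> A" "j \<in> B"
    have g: "gain p q lam i j r = log 2 (q j) + log 2 (lam r) - log 2 (p i)" for r
      unfolding gain_def using p(1)[OF ij(1)] q(1)[OF ij(2)] lam[of r] by (simp add: log_mult log_divide)
    show "(\<Sum>r\<in>UNIV. p i / 2 * (q j * gain p q lam i j r)) =
        p i * (q j * log 2 (q j)) - p i * log 2 (p i) * q j + p i * q j * ?c"
      unfolding g by (simp add: UNIV_bool field_simps)
  qed
  also have "\<dots> = (\<Sum>i\<in>A. p i) * (\<Sum>j\<in>B. q j * log 2 (q j)) - (\<Sum>i\<in>A. p i * log 2 (p i)) * (\<Sum>j\<in>B. q j)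
      + (\<Sum>i\<in>A. p i) * (\<Sum>j\<in>B. q j) * ?c"
    by (simp only: sum.distrib sum_subtractf sum_distrib_left[symmetric] sum_distrib_right[symmetric])
  finally show ?thesis using p(2) q(2) by simp
qed

lemma le_imp_blocc_possible:
  assumes d: "d \<le> D" "d' \<le> D"
    and p: "\<And>i. i \<in> {1..d} \<Longrightarrow> 0 < p i" "(\<Sum>i=1..d. p i) = 1"
    and q: "\<And>j. j \<in> {1..d'} \<Longrightarrow> 0 < q j" "(\<Sum>j=1..d'. q j) = 1"
    and w: "w \<le> (\<Sum>j=1..d'. q j * log 2 (q j)) - (\<Sum>i=1..d. p i * log 2 (p i))"
  shows "blocc_possible D d p d' q w"
proof -
  define c where "c = (\<Sum>j=1..d'. q j * log 2 (q j)) - (\<Sum>i=1..d. p i * log 2 (p i)) - w"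
  have c: "0 \<le> c" using w by (simp add: c_def)
  \<comment> \<open>Chosen so that \<open>(1 + s) * (1 - s) = 2 powr (-2 * c)\<close>, which makes
    the mean of the two logarithms equal to \<open>- c\<close>. Here \<open>c \<ge> 0\<close> makes
    s real, and positivity of the power gives \<open>s < 1\<close>, so both entries of lam are
    positive.\<close>
  define s where "s = sqrt (1 - 2 powr (-2 * c))"
  define lam where "lam r = (if r then 1 + s else 1 - s)" for r
  have pw: "0 < 2 powr (-2 * c)" "2 powr (-2 * c) \<le> 2 powr 0"
    using c powr_mono[of "-2 * c" 0 "2::real"] by auto
  then have s2: "s\<^sup>2 = 1 - 2 powr (-2 * c)" and s0: "0 \<le> s" by (simp_all add: s_def)
  have s1: "s < 1"
    using s2 pw(1) s0 by (intro power2_less_imp_less[of s 1]) auto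
  have lam: "\<And>r. 0 < lam r" "lam True + lam False = 2"
    using s0 s1 by (auto simp: lam_def)
  have "log 2 (lam True) + log 2 (lam False) = log 2 ((1 + s) * (1 - s))"
    using s0 s1 by (simp add: lam_def log_mult)
  also have "(1 + s) * (1 - s) = 2 powr (-2 * c)"
    using s2 by (simp add: power2_eq_square algebra_simps)
  finally have "(log 2 (lam True) + log 2 (lam False)) / 2 = - c" by simp
  with average_gain[where p = p and q = q and lam = lam, OF p q lam(1)]
  have "(\<Sum>i=1..d. \<Sum>j=1..d'. \<Sum>r\<in>UNIV. p i / 2 * (q j * gain p q lam i j r)) = w"
    unfolding c_def by linarith
  then show ?thesis
    using blocc_possible_gain[where p = p and q = q and lam = lam, OF d p q lam] by simp
qed

theorem mainTheorem3:
  fixes D d d' :: nat and p q :: "nat \<Rightarrow> real" and w :: real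
  assumes "1 \<le> d" and "1 \<le> d'" and "max d d' \<le> D"
    and "\<And>i. i \<in> {1..d} \<Longrightarrow> 0 < p i" and "(\<Sum>i\<in>{1..d}. p i) = 1"
    and "\<And>j. j \<in> {1..d'} \<Longrightarrow> 0 < q j" and "(\<Sum>j\<in>{1..d'}. q j) = 1"
  shows "blocc_possible D d p d' q w \<longleftrightarrow>
    w \<le> vn_entropy {1..D} (tr_B {1..D} (ketbra (schmidt_state d p) (schmidt_state d p)))
      - vn_entropy {1..D} (tr_B {1..D} (ketbra (schmidt_state d' q) (schmidt_state d' q)))"
proof -
  have d: "d \<le> D" "d' \<le> D" using assms(3) by auto
  have "vn_entropy {1..D} (tr_B {1..D} (ketbra (schmidt_state d p) (schmidt_state d p)))
      - vn_entropy {1..D} (tr_B {1..D} (ketbra (schmidt_state d' q) (schmidt_state d' q))) =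
    (\<Sum>j=1..d'. q j * log 2 (q j)) - (\<Sum>i=1..d. p i * log 2 (p i))"
    using vn_entropy_schmidt[where p = p, OF d(1) assms(4)] vn_entropy_schmidt[where p = q, OF d(2) assms(6)]
    by simp
  moreover have "blocc_possible D d p d' q w \<longleftrightarrow>
      w \<le> (\<Sum>j=1..d'. q j * log 2 (q j)) - (\<Sum>i=1..d. p i * log 2 (p i))"
    using blocc_possible_imp_le[where p = p and q = q, OF _ d assms(4-7)]
      le_imp_blocc_possible[where p = p and q = q, OF d assms(4-7)] by blast
  ultimately show ?thesis by simp
qed

end
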